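(* Let $\alpha_0>0$ be a constant such that $$\int_{\mathbb T}(|z|^2+\alpha_0^2|h|^2)^{1/2}\,dm\le\int_{\mathbb T}|z+h|\,dm\qquad\text{for all } z\in\mathbb C,\ h\in H^1_0(\mathbb T),$$ and put $A_0=4\alpha_0^{-1}$ and $C_1=4\alpha_0^{-1}\sqrt{10}\,A_0$. Let $n\in\mathbb N$. Then every Hardy martingale $F=(F_k)_{k=1}^n$ (with the convention $F_0=0$) can be decomposed as $F=G+B$, where $G=(G_k)_{k=1}^n$ and $B=(B_k)_{k=1}^n$ are again Hardy martingales (with $G_0=B_0=0$), such that: 1. (Integral bounds) $$\mathbb E\Big(\sum_{k=1}^n\mathbb E_{k-1}|\Delta G_k|^2\Big)^{1/2}+\mathbb E\Big(\sum_{k=1}^n|\Delta B_k|\Big)\le C_1\,\mathbb E|F_n|;$$ 2. (Previsible uniform estimates) almost surely $$|\Delta G_k|\le A_0|F_{k-1}|,\qquad 1\le k\le n.$$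
   Context: $\mathbb T=\{e^{i\theta}:\theta\in[0,2\pi)\}$ carries normalized Haar measure $m$. $H^1(\mathbb T)$ is the space of $h\in L^1(\mathbb T)$ (complex valued) whose harmonic extension to the unit disk is analytic; $H^1_0(\mathbb T)=\{h\in H^1(\mathbb T):\int_{\mathbb T}h\,dm=0\}$. A constant $\alpha_0>0$ as in the claim exists (Bourgain's complex convexity inequality; e.g. $\alpha_0^2=1/27$). $\mathbb T^{\mathbb N}$ is the countable product of $\mathbb T$ with product Haar measure $\mathbb P$, with expectation $\mathbb E$. $\mathcal F_k$ is the $\sigma$-algebra on $\mathbb T^{\mathbb N}$ generated by the first $k$ coordinates ($\mathcal F_0$ is trivial), and $\mathbb E_k$ is conditional expectation with respect to $\mathcal F_k$. For a martingale $F=(F_k)$ write $\Delta F_k=F_k-F_{k-1}$. An integrable (complex-valued) $(\mathcal F_k)$-martingale $F=(F_k)_{k=1}^n$ on $\mathbb T^{\mathbb N}$ is a Hardy martingale if for every $k$ and almost every $(x_1,\dots,x_{k-1})\in\mathbb T^{k-1}$ the function $y\mapsto\Delta F_k(x_1,\dots,x_{k-1},y)$ belongs to $H^1_0(\mathbb T)$. *)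

theory Defs
  imports "HOL-Probability.Probability"
begin

text \<open>The circle carries normalized arc length, as a measure whose underlying space is the
  unit circle only. Functions on it are represented as functions on \<^typ>\<open>complex\<close>; their values off
  the circle are irrelevant in everything below.\<close>

definition circle_haar :: "complex measure" where
  "circle_haar =
     distr (uniform_measure lborel {0..<2 * pi}) (restrict_space borel (sphere 0 1)) cis"

definition harmonic_extension :: "(complex \<Rightarrow> complex) \<Rightarrow> complex \<Rightarrow> complex" where
  "harmonic_extension h z =
     (LINT w|circle_haar. of_real ((1 - (cmod z)\<^sup>2) / (cmod (w - z))\<^sup>2) * h w)"

definition hardy_H1 :: "(complex \<Rightarrow> complex) set" where
  "hardy_H1 = {h. integrable circle_haar h \<and> harmonic_extension h holomorphic_on ball 0 1}"

definition hardy_H1_0 :: "(complex \<Rightarrow> complex) set" where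
  "hardy_H1_0 = {h \<in> hardy_H1. (LINT w|circle_haar. h w) = 0}"

text \<open>Coordinates of the infinite torus are numbered from 1, so that the first \<open>k\<close> coordinates
  are those with index in \<open>{1..k}\<close>.\<close>

definition torus :: "(nat \<Rightarrow> complex) measure" where
  "torus = Pi\<^sub>M {1..} (\<lambda>_. circle_haar)"

definition coord_filtration :: "nat \<Rightarrow> (nat \<Rightarrow> complex) measure" where
  "coord_filtration k =
     vimage_algebra (space torus) (\<lambda>x. restrict x {1..k}) (Pi\<^sub>M {1..k} (\<lambda>_. circle_haar))"

definition complex_cond_exp ::
  "'a measure \<Rightarrow> 'a measure \<Rightarrow> ('a \<Rightarrow> complex) \<Rightarrow> 'a \<Rightarrow> complex" where
  "complex_cond_exp M F f =
     (\<lambda>x. Complex (real_cond_exp M F (\<lambda>y. Re (f y)) x) (real_cond_exp M F (\<lambda>y. Im (f y)) x))"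

definition mart_diff :: "(nat \<Rightarrow> 'a \<Rightarrow> complex) \<Rightarrow> nat \<Rightarrow> 'a \<Rightarrow> complex" where
  "mart_diff F k x = F k x - F (k - 1) x"

definition integrable_martingale :: "nat \<Rightarrow> (nat \<Rightarrow> (nat \<Rightarrow> complex) \<Rightarrow> complex) \<Rightarrow> bool" where
  "integrable_martingale n F \<longleftrightarrow>
     (\<forall>k\<in>{1..n}. F k \<in> borel_measurable (coord_filtration k) \<and> integrable torus (F k)) \<and>
     (\<forall>k\<in>{2..n}. AE x in torus.
        complex_cond_exp torus (coord_filtration (k - 1)) (F k) x = F (k - 1) x)"

text \<open>The members of the martingale are \<open>F 1, \<dots>, F n\<close>; \<open>F 0\<close> is the conventional zero. Since
  \<open>F k\<close> and \<open>F (k - 1)\<close> depend on the first \<open>k\<close> coordinates only, the section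
  \<open>y \<mapsto> \<Delta>F\<^sub>k(x\<^sub>1, \<dots>, x\<^sub>k\<^sub>-\<^sub>1, y)\<close> is obtained by overwriting the \<open>k\<close>-th coordinate of a point of the
  infinite torus, and it depends on the coordinates below \<open>k\<close> only. So ``almost every point of
  the torus'' amounts to ``almost every \<open>(x\<^sub>1, \<dots>, x\<^sub>k\<^sub>-\<^sub>1)\<close>''.\<close>

definition hardy_martingale :: "nat \<Rightarrow> (nat \<Rightarrow> (nat \<Rightarrow> complex) \<Rightarrow> complex) \<Rightarrow> bool" where
  "hardy_martingale n F \<longleftrightarrow>
     F 0 = (\<lambda>_. 0) \<and> integrable_martingale n F \<and>
     (\<forall>k\<in>{1..n}. AE x in torus. (\<lambda>y. mart_diff F k (x(k := y))) \<in> hardy_H1_0)"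

text \<open>Conditional expectations of nonnegative, possibly non-integrable functions take values in
  \<^typ>\<open>ennreal\<close>, where the library has no square root.\<close>

definition ennreal_sqrt :: "ennreal \<Rightarrow> ennreal" where
  "ennreal_sqrt t = (if t = \<top> then \<top> else ennreal (sqrt (enn2real t)))"

end

theory Submission
  imports Defs "HOL-Complex_Analysis.Complex_Analysis"
begin

text \<open>Given \<open>z\<close> and \<open>h \<in> H\<^sup>1\<^sub>0\<close>, put \<open>M = 4\<bar>z\<bar>/\<alpha>\<^sub>0\<close>, \<open>u = max 0 (\<bar>h\<bar>/M - 1)\<close>, let \<open>S\<close> be the Herglotz transform
  of \<open>u\<close> and \<open>a = 1/(1 + S)\<close>. Then \<open>Re S\<close> is the Poisson extension of \<open>u\<close>, so \<open>g = h a\<close> is bounded by \<open>M\<close> in the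
  disc. Writing \<open>\<delta> = \<integral>\<bar>z + h\<bar> - \<bar>z\<bar>\<close>, the convexity inequality bounds \<open>\<integral>u\<close> by \<open>\<delta>/(4\<bar>z\<bar>)\<close>, and
  \<open>\<integral>\<bar>1 - a\<bar>\<^sup>2 \<le> 2(1 - a(0)) \<le> 2\<integral>u\<close>; hence \<open>\<alpha>\<^sub>0\<^sup>2 \<integral>\<bar>g\<bar>\<^sup>2 \<le> 6\<bar>z\<bar>\<delta>\<close> and \<open>\<alpha>\<^sub>0 \<integral>\<bar>h - g\<bar> \<le> 4\<delta>\<close>. To avoid
  boundary values of \<open>a\<close>, everything is evaluated at a radius \<open>r < 1\<close>, at the price of the small error
  \<open>\<integral>\<bar>h - h\<^sub>r\<bar>\<close>.

  Applied to the martingale differences with \<open>z = F\<^sub>k\<^sub>-\<^sub>1\<close>, the \<open>\<delta>\<^sub>k\<close> have total expectation \<open>E\<bar>F\<^sub>n\<bar>\<close>. This bounds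
  \<open>B\<close> directly, while \<open>E (\<Sum>\<bar>F\<^sub>k\<^sub>-\<^sub>1\<bar>\<delta>\<^sub>k)\<^sup>1\<^sup>/\<^sup>2 \<le> E (max \<bar>F\<^sub>k\<bar>/4 + \<Sum>\<delta>\<^sub>k)\<close> bounds \<open>G\<close> by Doob's inequality for the
  submartingale \<open>\<bar>F\<^sub>k\<bar>\<^sup>1\<^sup>/\<^sup>2\<close>.\<close>

section \<open>The Poisson integral on the circle\<close>

text \<open>Truncating h at height M would destroy analyticity, while multiplying its extension by a
  bounded analytic function does not; the multiplier a plays the role of a stopping rule. Positivity
  of Re S does everything at once: \<open>1 + S\<close> has no zeros, |a| \<le> 1, and |1 + S|
  dominates exactly the majorant of |h| / M, so no conjugate function has to be estimated.

  A fixed radius has a second benefit. The new differences are explicit integrals in x and y, hence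
  measurable without selecting anything for each x. In return one radius must serve all k and x, and
  only the total error integrated over the torus is made small, namely at most E|F_n|.

  The square root enters because |F_n| is merely integrable, and the maximal function of an L^1
  submartingale need not be integrable. The function |F_k|^(1/2) is in L^2 and still a
  submartingale, a property special to Hardy martingales.

  The argument yields the constant 1 + 9 / \<alpha>, and \<alpha> \<le> 1 places it below C_1 = 16
  sqrt 10 / \<alpha>^2.\<close>

lemma space_circle_haar [simp]: "space circle_haar = sphere 0 1"
  by (simp add: circle_haar_def space_restrict_space)

lemma sets_circle_haar [measurable_cong]: "sets circle_haar = sets (restrict_space borel (sphere 0 1))"
  by (simp add: circle_haar_def)

lemma cis_measurable_sphere [measurable]: "cis \<in> measurable borel (restrict_space borel (sphere 0 1))"
  by (intro measurable_restrict_space2) (auto intro!: borel_measurable_continuous_onI continuous_intros)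

lemma prob_space_circle_haar: "prob_space circle_haar"
  unfolding circle_haar_def
  by (intro prob_space.prob_space_distr prob_space_uniform_measure) (auto simp: emeasure_lborel_Ico)

interpretation circle: prob_space circle_haar by (rule prob_space_circle_haar)

lemma measurable_ident_circle_haar [measurable]: "(\<lambda>w. w) \<in> borel_measurable circle_haar"
  by (subst measurable_cong_sets[OF sets_circle_haar refl]) (auto intro: measurable_restrict_space1)

lemma borel_measurable_circle_haar_continuous:
  fixes f :: "complex \<Rightarrow> 'b::topological_space"
  shows "continuous_on (sphere 0 1) f \<Longrightarrow> f \<in> borel_measurable circle_haar"
  by (subst measurable_cong_sets[OF sets_circle_haar refl])
     (auto intro: borel_measurable_continuous_on_restrict)

lemma integrable_circle_haar_continuous:
  fixes f :: "complex \<Rightarrow> 'b::{banach, second_countable_topology}"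
  assumes "continuous_on (sphere 0 1) f"
  shows "integrable circle_haar f"
proof -
  have "compact (f ` sphere 0 1)"
    using assms by (intro compact_continuous_image) auto
  then obtain C where "\<And>w. w \<in> sphere 0 1 \<Longrightarrow> norm (f w) \<le> C"
    using compact_imp_bounded bounded_iff by (metis imageI)
  then show ?thesis
    by (intro circle.integrable_const_bound[where B=C])
       (auto intro!: borel_measurable_circle_haar_continuous assms)
qed

text \<open>Bridge to the parametrised integrals that contour integration delivers. The half-open
  and the closed interval differ by the null point 2 pi.\<close>

lemma integral_circle_haar_continuous:
  fixes f :: "complex \<Rightarrow> complex"
  assumes "continuous_on (sphere 0 1) f"
  shows "(LINT w|circle_haar. f w) = integral {0..2*pi} (\<lambda>t. f (cis t)) / (2 * pi)"
proof -
  have m: "f \<in> borel_measurable (restrict_space borel (sphere 0 1))"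
    using assms by (rule borel_measurable_continuous_on_restrict)
  have c: "continuous_on {0..2*pi} (\<lambda>t. f (cis t))"
    by (rule continuous_on_compose2[OF assms]) (auto intro!: continuous_intros)
  have s: "set_integrable lborel {0..2*pi} (\<lambda>t. f (cis t))"
    using c by (intro borel_integrable_compact[OF compact_Icc, unfolded set_integrable_def[symmetric]]) auto
  have fm: "(\<lambda>t. f (cis t)) \<in> borel_measurable borel"
    by (rule measurable_compose[OF cis_measurable_sphere m])
  have "(LINT w|circle_haar. f w) = (LINT t|uniform_measure lborel {0..<2*pi}. f (cis t))"
    unfolding circle_haar_def by (rule integral_distr) (use m in auto)
  also have "\<dots> = (LINT t|density lborel (\<lambda>t. ennreal (indicator {0..<2*pi} t / (2*pi))). f (cis t))"
    unfolding uniform_measure_def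
    by (intro arg_cong2[where f="integral\<^sup>L"] density_cong refl)
       (auto simp: emeasure_lborel_Ico divide_ennreal simp flip: ennreal_1 split: split_indicator)
  also have "\<dots> = (LINT t|lborel. (indicator {0..<2*pi} t / (2*pi)) *\<^sub>R f (cis t))"
    by (rule integral_density) (use fm in auto)
  also have "\<dots> = (LINT t|lborel. (1/(2*pi)) *\<^sub>R (indicator {0..2*pi} t *\<^sub>R f (cis t)))"
  proof (rule integral_cong_AE)
    have "AE t in lborel. t \<noteq> 2*pi" by (rule AE_lborel_singleton)
    then show "AE t in lborel. (indicator {0..<2*pi} t / (2*pi)) *\<^sub>R f (cis t) =
        (1/(2*pi)) *\<^sub>R (indicator {0..2*pi} t *\<^sub>R f (cis t))"
      by eventually_elim (auto simp: indicator_def)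
  qed (use fm in measurable)
  also have "\<dots> = (1/(2*pi)) *\<^sub>R (LINT t:{0..2*pi}|lborel. f (cis t))"
    unfolding set_lebesgue_integral_def by (rule Bochner_Integration.integral_scaleR_right)
  also have "(LINT t:{0..2*pi}|lborel. f (cis t)) = integral {0..2*pi} (\<lambda>t. f (cis t))"
    by (rule set_borel_integral_eq_integral(2)[OF s])
  finally show ?thesis by (simp add: scaleR_conv_of_real)
qed

text \<open>With w = cis t one has dw = i w dt, so dw / (2 pi i (w - z)) becomes
  \<open>w / (w - z)\<close> times Haar measure: this is Cauchy's formula. The room R > 1 keeps
  boundary values out of the picture; dilation will provide it.\<close>

lemma cauchy_integral_circle_haar:
  assumes K: "K holomorphic_on ball 0 R" and "1 < R" "cmod z < 1"
  shows "(LINT w|circle_haar. K w * (w / (w - z))) = K z"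
proof -
  have K1: "K holomorphic_on cball 0 1"
    using K by (rule holomorphic_on_subset) (use assms in auto)
  have cK: "continuous_on (sphere 0 1) K"
    using holomorphic_on_imp_continuous_on[OF K1] by (rule continuous_on_subset) auto
  have cont: "continuous_on (sphere 0 1) (\<lambda>w. K w * (w / (w - z)))"
    using assms by (intro continuous_intros cK) auto
  have "((\<lambda>u. K u/(u-z)) has_contour_integral (2 * of_real pi * \<i> * K z)) (circlepath 0 1)"
    by (rule Cauchy_integral_circlepath_simple[OF K1]) (use assms in auto)
  then have "((\<lambda>t. K (0 + 1 * cis t) / (0 + 1 * cis t - z) * 1 * \<i> * cis t) has_integral (2 * of_real pi * \<i> * K z)) {0..2*pi}"
    unfolding circlepath_def using has_contour_integral_part_circlepath_iff[of 0 "2*pi" "\<lambda>u. K u/(u-z)" _ 0 1]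
        by simp
  then have "((\<lambda>t. (- \<i>) * (K (cis t) / (cis t - z) * \<i> * cis t)) has_integral (- \<i>) * (2 * of_real pi * \<i> * K z)) {0..2*pi}"
    by (intro has_integral_mult_right) simp
  also have "(\<lambda>t. (- \<i>) * (K (cis t) / (cis t - z) * \<i> * cis t)) = (\<lambda>t. K (cis t) * (cis t / (cis t - z)))"
    by (auto simp: fun_eq_iff algebra_simps)
  finally have "integral {0..2*pi} (\<lambda>t. K (cis t) * (cis t / (cis t - z))) = 2 * of_real pi * K z"
    by (intro integral_unique) (simp add: algebra_simps)
  then show ?thesis
    by (subst integral_circle_haar_continuous[OF cont]) simp
qed

lemma mean_value_circle_haar:
  assumes "K holomorphic_on ball 0 R" "1 < R"
  shows "(LINT w|circle_haar. K w) = K 0"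
proof -
  have "(LINT w|circle_haar. K w) = (LINT w|circle_haar. K w * (w / (w - 0)))"
    by (rule Bochner_Integration.integral_cong) auto
  with cauchy_integral_circle_haar[OF assms, of 0] show ?thesis by simp
qed

section \<open>The Poisson kernel and its action on holomorphic functions\<close>

definition poisson :: "complex \<Rightarrow> complex \<Rightarrow> real" where
  "poisson z w = (1 - (cmod z)\<^sup>2) / (cmod (w - z))\<^sup>2"

lemma harmonic_extension_poisson:
  "harmonic_extension h z = (LINT w|circle_haar. of_real (poisson z w) * h w)"
  by (simp add: harmonic_extension_def poisson_def)

lemma poisson_nonneg: "cmod z < 1 \<Longrightarrow> 0 \<le> poisson z w"
  unfolding poisson_def by (auto intro!: divide_nonneg_nonneg simp: power_le_one_iff)

lemma poisson_le:
  assumes "cmod z < 1" "cmod w = 1"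
  shows "poisson z w \<le> (1 + cmod z) / (1 - cmod z)"
proof -
  have d: "1 - cmod z \<le> cmod (w - z)" using assms norm_triangle_ineq2[of w z] by simp
  have "poisson z w \<le> (1 - (cmod z)\<^sup>2) / (1 - cmod z)\<^sup>2"
    unfolding poisson_def using assms d
    by (intro divide_left_mono power_mono mult_pos_pos) (auto simp: power_le_one_iff zero_less_power)
  also have "\<dots> = (1 + cmod z) / (1 - cmod z)"
    using assms by (simp add: power2_eq_square divide_simps) (simp add: algebra_simps)
  finally show ?thesis .
qed

text \<open>The symmetry |w - r v| = |v - r w| of unit vectors gives the kernel mean 1 in either
  variable, which is the source of the L^1 contraction.\<close>

lemma poisson_commute:
  assumes "cmod v = 1" "cmod w = 1" "0 \<le> r"
  shows "poisson (of_real r * v) w = poisson (of_real r * w) v"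
proof -
  have "(cmod (w - of_real r * v))\<^sup>2 = (cmod (v - of_real r * w))\<^sup>2"
  proof -
    have "(Re v)\<^sup>2 + (Im v)\<^sup>2 = 1" "(Re w)\<^sup>2 + (Im w)\<^sup>2 = 1"
      using assms cmod_power2[of v] cmod_power2[of w] by auto
    moreover have "(a - r * c)\<^sup>2 + (b - r * d)\<^sup>2 = (c - r * a)\<^sup>2 + (d - r * b)\<^sup>2"
      if "a\<^sup>2 + b\<^sup>2 = 1" "c\<^sup>2 + d\<^sup>2 = 1" for a b c d :: real
      using that by algebra
    ultimately show ?thesis
      by (simp only: cmod_power2) simp
  qed
  then show ?thesis unfolding poisson_def using assms by (simp add: norm_mult)
qed

lemma Re_herglotz_kernel:
  assumes "cmod w = 1" "w \<noteq> z"
  shows "Re ((w + z) / (w - z)) = poisson z w"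
proof -
  have "Re ((w + z) / (w - z)) = Re ((w + z) * cnj (w - z)) / (cmod (w - z))\<^sup>2"
    by (simp add: complex_div_cnj[of "w + z"] flip: of_real_power)
  also have "Re ((w + z) * cnj (w - z)) = (cmod w)\<^sup>2 - (cmod z)\<^sup>2"
    by (simp only: cmod_power2) (simp add: algebra_simps power2_eq_square)
  finally show ?thesis using assms by (simp add: poisson_def)
qed

text \<open>The first summand is the Cauchy kernel. The second is holomorphic in w across the closed
  disc and vanishes at w = 0, so it contributes nothing when integrated against a holomorphic
  function.\<close>

lemma poisson_split:
  assumes "cmod w = 1" "cmod z < 1"
  shows "complex_of_real (poisson z w) = w / (w - z) + cnj z * w / (1 - cnj z * w)"
proof -
  have ww: "w * cnj w = 1" using assms by (simp add: complex_mult_cnj flip: cmod_power2 of_real_power)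
  have ne: "w \<noteq> z" "1 \<noteq> cnj z * w"
  proof -
    show "w \<noteq> z" using assms by auto
    show "1 \<noteq> cnj z * w"
    proof
      assume "1 = cnj z * w"
      then have "cmod (cnj z * w) = 1" by (metis norm_one)
      then show False using assms by (simp add: norm_mult)
    qed
  qed
  have e: "1 - cnj z * w = w * cnj (w - z)" using ww by (simp add: algebra_simps)
  have n: "complex_of_real ((cmod (w - z))\<^sup>2) = (w - z) * cnj (w - z)"
    by (rule complex_norm_square)
  have n1: "complex_of_real (1 - (cmod z)\<^sup>2) = 1 - z * cnj z"
    by (simp only: of_real_diff of_real_1 complex_norm_square)
  have ne2: "w \<noteq> 0" "cnj w - cnj z \<noteq> 0" using assms ne by auto
  have "w / (w - z) + cnj z * w / (1 - cnj z * w) = w/(w-z) + cnj z / cnj (w - z)"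
    unfolding e using ne2(1) by (simp del: complex_cnj_diff)
  also have "\<dots> = (w * (cnj w - cnj z) + cnj z * (w - z)) / ((w-z) * cnj (w - z))"
    using ne ne2 by (simp add: field_simps)
  also have "w * (cnj w - cnj z) + cnj z * (w - z) = 1 - z * cnj z"
    using ww by (simp add: algebra_simps)
  finally show ?thesis by (simp only: poisson_def of_real_divide n n1)
qed

lemma continuous_on_poisson: "cmod z < 1 \<Longrightarrow> continuous_on (sphere 0 1) (poisson z)"
  unfolding poisson_def by (intro continuous_intros) auto

lemma poisson_measurable [measurable]: "case_prod poisson \<in> borel_measurable (borel \<Otimes>\<^sub>M borel)"
  unfolding poisson_def by measurable

lemma harmonic_extension_holomorphic:
  assumes K: "K holomorphic_on ball 0 R" and R: "1 < R" "cmod z < 1"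
  shows "harmonic_extension K z = K z"
proof -
  \<comment> \<open>The second summand of \<open>poisson_split\<close> has its pole at 1 / cnj z,
    outside the closed disc. R' stays clear of that pole and still exceeds 1.\<close>
  define R' where "R' = (if z = 0 then R else min R (1 / cmod z))"
  have R': "1 < R'" "R' \<le> R" "\<And>w. cmod w < R' \<Longrightarrow> cnj z * w \<noteq> 1"
  proof -
    show "1 < R'" using R by (auto simp: R'_def)
    show "R' \<le> R" by (auto simp: R'_def)
    fix w assume w: "cmod w < R'" show "cnj z * w \<noteq> 1"
    proof
      assume e: "cnj z * w = 1"
      then have "z \<noteq> 0" by auto
      moreover have "cmod z * cmod w = 1" using e by (metis norm_mult complex_mod_cnj norm_one)
      ultimately show False using w by (auto simp: R'_def field_simps)
    qed
  qed
  have K': "K holomorphic_on ball 0 R'" using K by (rule holomorphic_on_subset) (use R' in auto)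
  have h2: "(\<lambda>w. K w * (cnj z * w / (1 - cnj z * w))) holomorphic_on ball 0 R'"
    by (intro holomorphic_intros K') (use R' in auto)
  have cK: "continuous_on (sphere 0 1) K"
    using holomorphic_on_imp_continuous_on[OF K'] by (rule continuous_on_subset) (use R' in auto)
  have "harmonic_extension K z = (LINT w|circle_haar. K w * (w / (w - z)) + K w * (cnj z * w / (1 - cnj z * w)))"
    unfolding harmonic_extension_poisson
    by (rule Bochner_Integration.integral_cong) (use R in \<open>auto simp: poisson_split algebra_simps\<close>)
  also have "\<dots> = (LINT w|circle_haar. K w * (w / (w - z)))
      + (LINT w|circle_haar. K w * (cnj z * w / (1 - cnj z * w)))"
  proof (intro Bochner_Integration.integral_add integrable_circle_haar_continuous)
    show "continuous_on (sphere 0 1) (\<lambda>w. K w * (w / (w - z)))"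
      using R by (intro continuous_intros cK) auto
    show "continuous_on (sphere 0 1) (\<lambda>w. K w * (cnj z * w / (1 - cnj z * w)))"
      using holomorphic_on_imp_continuous_on[OF h2] by (rule continuous_on_subset) (use R' in auto)
  qed
  also have "\<dots> = K z"
    using cauchy_integral_circle_haar[OF K R] mean_value_circle_haar[OF h2 R'(1)] by simp
  finally show ?thesis .
qed

lemma integral_poisson: "cmod z < 1 \<Longrightarrow> (LINT w|circle_haar. poisson z w) = 1"
proof -
  assume z: "cmod z < 1"
  have "complex_of_real (LINT w|circle_haar. poisson z w) = harmonic_extension (\<lambda>_. 1) z"
    unfolding harmonic_extension_poisson by (simp flip: integral_complex_of_real)
  also have "\<dots> = 1" by (rule harmonic_extension_holomorphic[where R=2]) (use z in auto)
  finally show ?thesis by (metis of_real_eq_1_iff)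
qed

section \<open>Poisson extensions of integrable functions\<close>

definition poisson_ext :: "(complex \<Rightarrow> real) \<Rightarrow> complex \<Rightarrow> real" where
  "poisson_ext u z = (LINT w|circle_haar. poisson z w * u w)"

interpretation circle2: pair_prob_space circle_haar circle_haar ..

lemma integrable_circle_kernel_mult:
  fixes k f :: "complex \<Rightarrow> 'b::{real_normed_field, banach, second_countable_topology}"
  assumes "continuous_on (sphere 0 1) k" "integrable circle_haar f"
  shows "integrable circle_haar (\<lambda>w. k w * f w)"
proof -
  have "compact (k ` sphere 0 1)"
    using assms by (intro compact_continuous_image) auto
  then obtain C where C: "\<And>w. w \<in> sphere 0 1 \<Longrightarrow> norm (k w) \<le> C"
    using compact_imp_bounded bounded_iff by (metis imageI)
  have [measurable]: "k \<in> borel_measurable circle_haar" "f \<in> borel_measurable circle_haar"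
    using assms by (auto intro: borel_measurable_circle_haar_continuous)
  show ?thesis
  proof (rule Bochner_Integration.integrable_bound)
    show "integrable circle_haar (\<lambda>w. C * norm (f w))" using assms by auto
    show "AE w in circle_haar. norm (k w * f w) \<le> norm (C * norm (f w))"
    proof (rule AE_I2)
      fix w assume "w \<in> space circle_haar"
      then have "norm (k w) \<le> \<bar>C\<bar>" using C[of w] by auto
      then show "norm (k w * f w) \<le> norm (C * norm (f w))"
        by (simp add: norm_mult abs_mult mult_right_mono)
    qed
  qed measurable
qed

lemma integrable_poisson_mult:
  fixes f :: "complex \<Rightarrow> real"
  shows "cmod z < 1 \<Longrightarrow> integrable circle_haar f \<Longrightarrow> integrable circle_haar (\<lambda>w. poisson z w * f w)"
  by (intro integrable_circle_kernel_mult continuous_on_poisson)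

lemma integrable_poisson_mult_complex:
  fixes f :: "complex \<Rightarrow> complex"
  shows "cmod z < 1 \<Longrightarrow> integrable circle_haar f \<Longrightarrow> integrable circle_haar (\<lambda>w. of_real (poisson z w) * f w)"
  by (intro integrable_circle_kernel_mult continuous_on_of_real continuous_on_poisson)

lemma poisson_ext_mono:
  assumes "cmod z < 1" "integrable circle_haar u" "integrable circle_haar v"
    and "\<And>w. cmod w = 1 \<Longrightarrow> u w \<le> v w"
  shows "poisson_ext u z \<le> poisson_ext v z"
  unfolding poisson_ext_def using assms
  by (intro integral_mono integrable_poisson_mult mult_left_mono poisson_nonneg) auto

lemma poisson_ext_nonneg:
  assumes "cmod z < 1" "\<And>w. cmod w = 1 \<Longrightarrow> 0 \<le> u w"
  shows "0 \<le> poisson_ext u z"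
  unfolding poisson_ext_def using assms
  by (intro Bochner_Integration.integral_nonneg mult_nonneg_nonneg poisson_nonneg) auto

lemma norm_harmonic_extension_le:
  assumes "cmod z < 1"
  shows "cmod (harmonic_extension f z) \<le> poisson_ext (\<lambda>w. cmod (f w)) z"
proof -
  have "cmod (harmonic_extension f z) \<le> (LINT w|circle_haar. cmod (of_real (poisson z w) * f w))"
    unfolding harmonic_extension_poisson by (rule integral_norm_bound)
  also have "\<dots> = poisson_ext (\<lambda>w. cmod (f w)) z"
    unfolding poisson_ext_def
    by (rule Bochner_Integration.integral_cong) (use poisson_nonneg[OF assms] in \<open>auto simp: norm_mult\<close>)
  finally show ?thesis .
qed

lemma harmonic_extension_add:
  assumes "cmod z < 1" "integrable circle_haar f" "integrable circle_haar g"
  shows "harmonic_extension (\<lambda>w. f w + g w) z = harmonic_extension f z + harmonic_extension g z"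
  unfolding harmonic_extension_poisson ring_distribs
  by (intro Bochner_Integration.integral_add integrable_poisson_mult_complex assms)

lemma harmonic_extension_diff:
  assumes "cmod z < 1" "integrable circle_haar f" "integrable circle_haar g"
  shows "harmonic_extension (\<lambda>w. f w - g w) z = harmonic_extension f z - harmonic_extension g z"
  unfolding harmonic_extension_poisson right_diff_distrib
  by (intro Bochner_Integration.integral_diff integrable_poisson_mult_complex assms)

lemma harmonic_extension_cong:
  "(\<And>w. cmod w = 1 \<Longrightarrow> f w = g w) \<Longrightarrow> harmonic_extension f z = harmonic_extension g z"
  unfolding harmonic_extension_def by (rule Bochner_Integration.integral_cong) auto

lemma harmonic_extension_const: "cmod z < 1 \<Longrightarrow> harmonic_extension (\<lambda>_. c) z = c"
  by (rule harmonic_extension_holomorphic[where R=2]) auto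

lemma harmonic_extension_at_0: "harmonic_extension f 0 = (LINT w|circle_haar. f w)"
  unfolding harmonic_extension_poisson
  by (rule Bochner_Integration.integral_cong) (auto simp: poisson_def)

lemma harmonic_extension_measurable:
  assumes [measurable]: "f \<in> borel_measurable circle_haar"
  shows "(\<lambda>v. harmonic_extension f (c * v)) \<in> borel_measurable circle_haar"
  unfolding harmonic_extension_poisson
  by (intro circle.borel_measurable_lebesgue_integral) measurable

lemma poisson_ext_measurable:
  assumes [measurable]: "f \<in> borel_measurable circle_haar"
  shows "(\<lambda>v. poisson_ext f (c * v)) \<in> borel_measurable circle_haar"
  unfolding poisson_ext_def
  by (intro circle.borel_measurable_lebesgue_integral) measurable

text \<open>After exchanging the integrals, \<open>poisson_commute\<close> lets the kernel be
  integrated to 1 in the other variable. For fixed r < 1 the kernel is bounded by (1 + r) / (1 - r),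
  which supplies the joint integrability for Fubini.\<close>

lemma integral_poisson_ext:
  assumes f: "integrable circle_haar f" and r: "0 \<le> r" "r < 1"
  shows "integrable circle_haar (\<lambda>v. poisson_ext f (of_real r * v))"
    and "(LINT v|circle_haar. poisson_ext f (of_real r * v)) = (LINT v|circle_haar. f v)"
proof -
  have [measurable]: "f \<in> borel_measurable circle_haar" using f by auto
  have rv: "cmod (of_real r * v) < 1" if "cmod v = 1" for v using that r by (simp add: norm_mult)
  let ?F = "\<lambda>v w. poisson (of_real r * v) w * f w"
  have "integrable (circle_haar \<Otimes>\<^sub>M circle_haar) (\<lambda>(v, w). ?F v w)"
  proof (rule circle2.Fubini_integrable)
    show "(\<lambda>(v, w). ?F v w) \<in> borel_measurable (circle_haar \<Otimes>\<^sub>M circle_haar)" by measurable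
    show "AE x in circle_haar. integrable circle_haar (\<lambda>y. case (x, y) of (v, w) \<Rightarrow> ?F v w)"
      using integrable_poisson_mult[OF rv f] by (intro AE_I2) auto
    show "integrable circle_haar (\<lambda>x. LINT y|circle_haar. norm (case (x, y) of (v, w) \<Rightarrow> ?F v w))"
    proof (rule circle.integrable_const_bound)
      show "AE x in circle_haar. norm (LINT y|circle_haar. norm (case (x, y) of (v, w) \<Rightarrow> ?F v w))
         \<le> (1 + r) / (1 - r) * (LINT y|circle_haar. \<bar>f y\<bar>)"
      proof (rule AE_I2)
        fix x assume "x \<in> space circle_haar"
        then have x: "cmod x = 1" by simp
        have "(LINT y|circle_haar. \<bar>?F x y\<bar>) \<le> (LINT y|circle_haar. (1 + r) / (1 - r) * \<bar>f y\<bar>)"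
        proof (rule integral_mono)
          show "integrable circle_haar (\<lambda>y. \<bar>?F x y\<bar>)"
            using integrable_poisson_mult[OF rv[OF x] f] by auto
          fix y assume "y \<in> space circle_haar"
          then have "poisson (of_real r * x) y * \<bar>f y\<bar> \<le> (1 + r) / (1 - r) * \<bar>f y\<bar>"
            using poisson_le[OF rv[OF x], of y] x r
            by (intro mult_right_mono) (auto simp: norm_mult)
          then show "\<bar>?F x y\<bar> \<le> (1 + r) / (1 - r) * \<bar>f y\<bar>"
            using poisson_nonneg[OF rv[OF x], of y] by (simp add: abs_mult)
        qed (use f in auto)
        then show "norm (LINT y|circle_haar. norm (case (x, y) of (v, w) \<Rightarrow> ?F v w))
         \<le> (1 + r) / (1 - r) * (LINT y|circle_haar. \<bar>f y\<bar>)"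
          by simp
      qed
      show "(\<lambda>x. LINT y|circle_haar. norm (case (x, y) of (v, w) \<Rightarrow> ?F v w)) \<in> borel_measurable circle_haar"
        by measurable
    qed
  qed
  note I = this
  show "integrable circle_haar (\<lambda>v. poisson_ext f (of_real r * v))"
    using circle2.integrable_fst'[OF I] by (simp add: poisson_ext_def)
  have "(LINT v|circle_haar. poisson_ext f (of_real r * v)) = (LINT w|circle_haar. (LINT v|circle_haar. ?F v w))"
    unfolding poisson_ext_def by (rule circle2.Fubini_integral[symmetric, OF I])
  also have "\<dots> = (LINT w|circle_haar. f w)"
  proof (rule Bochner_Integration.integral_cong)
    fix w assume "w \<in> space circle_haar"
    then have w: "cmod w = 1" by simp
    have "(LINT v|circle_haar. ?F v w) = (LINT v|circle_haar. poisson (of_real r * w) v * f w)"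
      by (rule Bochner_Integration.integral_cong) (use w r poisson_commute in auto)
    also have "\<dots> = f w" using integral_poisson[OF rv[OF w]] by simp
    finally show "(LINT v|circle_haar. ?F v w) = f w" .
  qed simp
  finally show "(LINT v|circle_haar. poisson_ext f (of_real r * v)) = (LINT v|circle_haar. f v)" .
qed

text \<open>The extension of |f| dominates and preserves the mean. The bound is uniform in r, so
  convergence as r tends to 1 needs to be known on a dense class only.\<close>

lemma harmonic_extension_contraction:
  fixes f :: "complex \<Rightarrow> complex"
  assumes f: "integrable circle_haar f" and r: "0 \<le> r" "r < 1"
  shows "integrable circle_haar (\<lambda>v. harmonic_extension f (of_real r * v))"
    and "(LINT v|circle_haar. cmod (harmonic_extension f (of_real r * v))) \<le> (LINT v|circle_haar. cmod (f v))"
proof -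
  have [measurable]: "f \<in> borel_measurable circle_haar" using f by auto
  have rv: "cmod (of_real r * v) < 1" if "cmod v = 1" for v using that r by (simp add: norm_mult)
  have fn: "integrable circle_haar (\<lambda>v. cmod (f v))" using f by auto
  note * = integral_poisson_ext[OF fn r]
  have le: "cmod (harmonic_extension f (of_real r * v))
      \<le> poisson_ext (\<lambda>w. cmod (f w)) (of_real r * v)" if "cmod v = 1" for v
    by (rule norm_harmonic_extension_le[OF rv[OF that]])
  show i: "integrable circle_haar (\<lambda>v. harmonic_extension f (of_real r * v))"
  proof (rule Bochner_Integration.integrable_bound[OF *(1)])
    show "AE x in circle_haar. norm (harmonic_extension f (of_real r * x))
         \<le> norm (poisson_ext (\<lambda>w. cmod (f w)) (of_real r * x))"
      using le by (intro AE_I2) force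
  qed (rule harmonic_extension_measurable, measurable)
  show "(LINT v|circle_haar. cmod (harmonic_extension f (of_real r * v))) \<le> (LINT v|circle_haar. cmod (f v))"
    unfolding *(2)[symmetric] using i by (intro integral_mono *(1) le) auto
qed

lemma integral_norm_triangle3:
  fixes a b c :: "complex \<Rightarrow> complex"
  assumes "integrable M (\<lambda>x. a x)" "integrable M (\<lambda>x. b x)" "integrable M (\<lambda>x. c x)"
  shows "(LINT x|M. cmod (a x + b x + c x)) \<le> (LINT x|M. cmod (a x)) + (LINT x|M. cmod (b x))
      + (LINT x|M. cmod (c x))"
proof -
  have "(LINT x|M. cmod (a x + b x + c x)) \<le> (LINT x|M. cmod (a x) + cmod (b x) + cmod (c x))"
    by (intro integral_mono) (auto intro!: assms Bochner_Integration.integrable_add integrable_norm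
         intro: order_trans[OF norm_triangle_ineq] add_mono norm_triangle_ineq)
  then show ?thesis using assms by auto
qed

text \<open>On the circle |w - v|^2 = 2 - 2 Re (w cnj v) is the real part of a polynomial in w, and
  a polynomial is its own harmonic extension inside the disc.\<close>

lemma poisson_ext_dist_sq:
  assumes v: "cmod v = 1" and r: "0 \<le> r" "r < 1"
  shows "poisson_ext (\<lambda>w. (cmod (w - v))\<^sup>2) (of_real r * v) = 2 - 2 * r"
proof -
  have rv: "cmod (of_real r * v) < 1" using v r by (simp add: norm_mult)
  let ?K = "\<lambda>w. 2 - 2 * (w * cnj v)"
  have vv: "v * cnj v = 1" using v by (simp add: complex_mult_cnj flip: cmod_power2 of_real_power)
  have i: "integrable circle_haar (\<lambda>w. of_real (poisson (of_real r * v) w) * ?K w)"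
    by (intro integrable_poisson_mult_complex rv integrable_circle_haar_continuous continuous_intros)
  have "poisson_ext (\<lambda>w. (cmod (w - v))\<^sup>2) (of_real r * v)
      = (LINT w|circle_haar. Re (of_real (poisson (of_real r * v) w) * ?K w))"
    unfolding poisson_ext_def
  proof (rule Bochner_Integration.integral_cong)
    fix w assume "w \<in> space circle_haar"
    then have "(cmod w)\<^sup>2 = 1" by simp
    moreover have "(cmod v)\<^sup>2 = 1" using v by simp
    ultimately have "(cmod (w - v))\<^sup>2 = Re (?K w)"
      by (simp only: cmod_power2) (simp add: power2_diff algebra_simps)
    then show "poisson (of_real r * v) w * (cmod (w - v))\<^sup>2 = Re (of_real (poisson (of_real r * v) w) * ?K w)"
      by simp
  qed simp
  also have "\<dots> = Re (harmonic_extension ?K (of_real r * v))"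
    unfolding harmonic_extension_poisson using i by (rule integral_Re)
  also have "harmonic_extension ?K (of_real r * v) = ?K (of_real r * v)"
    by (rule harmonic_extension_holomorphic[where R=2]) (use rv in \<open>auto intro!: holomorphic_intros\<close>)
  also have "\<dots> = of_real (2 - 2 * r)"
    using vv by (simp add: mult.assoc)
  finally show ?thesis by simp
qed

text \<open>A Korovkin-type argument: a bounded function continuous at \<open>v\<close> satisfies
  \<open>\<bar>f w - f v\<bar> \<le> e + C \<bar>w - v\<bar>\<^sup>2\<close>, and the Poisson extension of the right-hand side is explicit.\<close>

lemma harmonic_extension_tendsto_continuous:
  fixes f :: "complex \<Rightarrow> complex"
  assumes f: "continuous_on (sphere 0 1) f" and v: "cmod v = 1"
    and r: "\<And>i. 0 \<le> r i" "\<And>i. r i < (1::real)" "r \<longlonglongrightarrow> 1"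
  shows "(\<lambda>i. harmonic_extension f (of_real (r i) * v)) \<longlonglongrightarrow> f v"
proof (rule LIMSEQ_I)
  fix e :: real assume e: "e > 0"
  have "compact (f ` sphere 0 1)"
    using f by (intro compact_continuous_image) auto
  then obtain B where B: "\<And>w. cmod w = 1 \<Longrightarrow> cmod (f w) \<le> B"
    using compact_imp_bounded bounded_iff by (metis imageI mem_sphere_0)
  obtain d where d: "d > 0" "\<And>w. cmod w = 1 \<Longrightarrow> cmod (w - v) < d \<Longrightarrow> cmod (f w - f v) < e/2"
    using f[unfolded continuous_on_iff, rule_format, of v "e/2"] e v by (auto simp: dist_norm)
  \<comment> \<open>Outside the d-neighbourhood of v the trivial bound 2 B is at most C |w -
    v|^2.\<close>
  define C where "C = 2 * B / d\<^sup>2"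
  have B0: "B \<ge> 0" using B[OF v] norm_ge_zero order_trans by blast
  have C0: "C \<ge> 0" using B0 by (simp add: C_def)
  have le: "cmod (f w - f v) \<le> e/2 + C * (cmod (w - v))\<^sup>2" if w: "cmod w = 1" for w
  proof (cases "cmod (w - v) < d")
    case True then show ?thesis using d(2)[OF w True] C0 by (smt (verit) mult_nonneg_nonneg zero_le_power2)
  next
    case False
    have "cmod (f w - f v) \<le> 2 * B" using B[OF w] B[OF v] norm_triangle_ineq4[of "f w" "f v"] by simp
    also have "\<dots> = C * d\<^sup>2" using d by (simp add: C_def)
    also have "\<dots> \<le> C * (cmod (w - v))\<^sup>2" using False d C0 by (intro mult_left_mono power_mono) auto
    finally show ?thesis using e by simp
  qed
  have est: "cmod (harmonic_extension f (of_real (r i) * v) - f v) \<le> e/2 + C * (2 - 2 * r i)" for i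
  proof -
    have rv: "cmod (of_real (r i) * v) < 1" using v r(1,2)[of i] by (simp add: norm_mult)
    have "harmonic_extension f (of_real (r i) * v) - f v = harmonic_extension (\<lambda>w. f w - f v) (of_real (r i) * v)"
      by (subst harmonic_extension_diff[OF rv])
          (auto intro: integrable_circle_haar_continuous f simp: harmonic_extension_const rv)
    then have "cmod (harmonic_extension f (of_real (r i) * v) - f v)
        \<le> poisson_ext (\<lambda>w. cmod (f w - f v)) (of_real (r i) * v)"
      using norm_harmonic_extension_le[OF rv] by simp
    also have "\<dots> \<le> poisson_ext (\<lambda>w. e/2 + C * (cmod (w - v))\<^sup>2) (of_real (r i) * v)"
      by (intro poisson_ext_mono rv integrable_circle_haar_continuous continuous_intros f le)
    also have "\<dots> = (LINT w|circle_haar. (e/2) * poisson (of_real (r i) * v) w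
        + C * (poisson (of_real (r i) * v) w * (cmod (w - v))\<^sup>2))"
      unfolding poisson_ext_def by (simp add: algebra_simps)
    also have "\<dots> = (e/2) * (LINT w|circle_haar. poisson (of_real (r i) * v) w)
        + C * poisson_ext (\<lambda>w. (cmod (w - v))\<^sup>2) (of_real (r i) * v)"
      unfolding poisson_ext_def
      by (subst Bochner_Integration.integral_add)
         (auto intro!: integrable_mult_right integrable_poisson_mult rv integrable_circle_haar_continuous continuous_intros continuous_on_poisson)
    also have "\<dots> = e/2 + C * (2 - 2 * r i)"
      using integral_poisson[OF rv] poisson_ext_dist_sq[OF v r(1) r(2)] by simp
    finally show ?thesis .
  qed
  have "(\<lambda>i. C * (2 - 2 * r i)) \<longlonglongrightarrow> C * (2 - 2 * 1)" by (intro tendsto_intros r(3))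
  then have "\<forall>\<^sub>F i in sequentially. C * (2 - 2 * r i) < e/2"
    using e by (intro order_tendstoD(2)[of _ "C * (2 - 2 * 1)"]) auto
  then obtain N where N: "\<And>i. i \<ge> N \<Longrightarrow> C * (2 - 2 * r i) < e/2" by (auto simp: eventually_sequentially)
  show "\<exists>no. \<forall>n\<ge>no. cmod (harmonic_extension f (of_real (r n) * v) - f v) < e"
    by (rule exI[of _ N]) (use est N in \<open>smt (verit) field_sum_of_halves\<close>)
qed

section \<open>Abel means converge in mean\<close>

definition radius :: "nat \<Rightarrow> real" where
  "radius i = 1 - inverse (real (Suc i))"

lemma radius_nonneg: "0 \<le> radius i" and radius_less_1: "radius i < 1"
  by (auto simp: radius_def field_simps)

lemma radius_tendsto: "radius \<longlonglongrightarrow> 1"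
  using tendsto_diff[OF tendsto_const LIMSEQ_inverse_real_of_nat, of 1] by (simp add: radius_def[abs_def])

definition abel_summable :: "(complex \<Rightarrow> complex) \<Rightarrow> bool" where
  "abel_summable f \<longleftrightarrow>
     (\<lambda>i. LINT v|circle_haar. cmod (harmonic_extension f (of_real (radius i) * v) - f v)) \<longlonglongrightarrow> 0"

lemma radius_disc: "cmod v = 1 \<Longrightarrow> cmod (of_real (radius i) * v) < 1"
  using radius_nonneg[of i] radius_less_1[of i] by (simp add: norm_mult)

text \<open>In the three-term splitting through g, the contraction property controls the extension
  of f - g by the distance of f and g, uniformly in the radius.\<close>

lemma abel_summable_closed:
  assumes f: "integrable circle_haar f"
    and approx: "\<And>e. e > 0 \<Longrightarrow> \<exists>g. integrable circle_haar g \<and> abel_summable g \<and> (LINT v|circle_haar. cmod (f v - g v)) < e"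
  shows "abel_summable f"
  unfolding abel_summable_def
proof (rule LIMSEQ_I)
  fix e :: real assume e: "e > 0"
  then obtain g where g: "integrable circle_haar g" "abel_summable g" "(LINT v|circle_haar. cmod (f v - g v)) < e/3"
    using approx[of "e/3"] by auto
  obtain N where N: "\<And>i. i \<ge> N \<Longrightarrow> (LINT v|circle_haar. cmod (harmonic_extension g (of_real (radius i) * v) - g v)) < e/3"
    using LIMSEQ_D[OF g(2)[unfolded abel_summable_def], of "e/3"] e by auto
  have "(LINT v|circle_haar. cmod (harmonic_extension f (of_real (radius i) * v) - f v)) < e" if "i \<ge> N" for i
  proof -
    let ?T = "\<lambda>f v. harmonic_extension f (of_real (radius i) * v)"
    note int = harmonic_extension_contraction(1)[OF _ radius_nonneg radius_less_1, of _ i]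
    have fg: "integrable circle_haar (\<lambda>v. f v - g v)" using f g by auto
    have "(LINT v|circle_haar. cmod (?T f v - f v)) =
        (LINT v|circle_haar. cmod (?T (\<lambda>w. f w - g w) v + (?T g v - g v) + (g v - f v)))"
      by (rule Bochner_Integration.integral_cong)
         (use f g in \<open>auto simp: harmonic_extension_diff radius_disc\<close>)
    also have "\<dots> \<le> (LINT v|circle_haar. cmod (?T (\<lambda>w. f w - g w) v)) + (LINT v|circle_haar. cmod (?T g v - g v))
       + (LINT v|circle_haar. cmod (g v - f v))"
      by (intro integral_norm_triangle3 Bochner_Integration.integrable_diff int f g fg)
    also have "\<dots> < e/3 + e/3 + e/3"
      using harmonic_extension_contraction(2)[OF fg radius_nonneg radius_less_1, of i] g(3) N[OF that]
      by (simp add: norm_minus_commute)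
    finally show ?thesis by simp
  qed
  moreover have "0 \<le> (LINT v|circle_haar. cmod (harmonic_extension f (of_real (radius i) * v) - f v))" for i
    by simp
  ultimately show "\<exists>no. \<forall>n\<ge>no. norm ((LINT v|circle_haar. cmod (harmonic_extension f (of_real (radius n) * v) - f v)) - 0) < e"
    by (intro exI[of _ N]) (simp)
qed

lemma abel_summable_limit:
  assumes f: "integrable circle_haar f"
    and s: "\<And>j. integrable circle_haar (s j)" "\<And>j. abel_summable (s j)"
    and lim: "(\<lambda>j. LINT v|circle_haar. cmod (f v - s j v)) \<longlonglongrightarrow> 0"
  shows "abel_summable f"
proof (rule abel_summable_closed[OF f])
  fix e :: real assume "e > 0"
  then obtain j where "(LINT v|circle_haar. cmod (f v - s j v)) < e"
    using order_tendstoD(2)[OF lim] by (auto simp: eventually_sequentially)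
  then show "\<exists>g. integrable circle_haar g \<and> abel_summable g \<and> (LINT v|circle_haar. cmod (f v - g v)) < e"
    using s by blast
qed

lemma abel_summable_continuous:
  assumes f: "continuous_on (sphere 0 1) f"
  shows "abel_summable f"
proof -
  have fi: "integrable circle_haar f" using f by (rule integrable_circle_haar_continuous)
  have "compact (f ` sphere 0 1)"
    using f by (intro compact_continuous_image) auto
  then obtain B where B: "\<And>w. cmod w = 1 \<Longrightarrow> cmod (f w) \<le> B"
    using compact_imp_bounded bounded_iff by (metis imageI mem_sphere_0)
  have TB: "cmod (harmonic_extension f (of_real (radius i) * v)) \<le> B" if v: "cmod v = 1" for i v
  proof -
    have "cmod (harmonic_extension f (of_real (radius i) * v)) \<le> poisson_ext (\<lambda>w. B) (of_real (radius i) * v)"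
      by (rule order_trans[OF norm_harmonic_extension_le[OF radius_disc[OF v]] poisson_ext_mono[OF radius_disc[OF v]]])
         (use fi B in auto)
    then show ?thesis using integral_poisson[OF radius_disc[OF v]] by (simp add: poisson_ext_def)
  qed
  have "(\<lambda>i. LINT v|circle_haar. cmod (harmonic_extension f (of_real (radius i) * v) - f v))
      \<longlonglongrightarrow> (LINT v|circle_haar. 0)"
  proof (rule integral_dominated_convergence[where w="\<lambda>_. 2 * B"])
    show "AE x in circle_haar. (\<lambda>i. cmod (harmonic_extension f (of_real (radius i) * x) - f x)) \<longlonglongrightarrow> 0"
      using harmonic_extension_tendsto_continuous[OF f _ radius_nonneg radius_less_1 radius_tendsto]
      by (intro AE_I2 tendsto_norm_zero LIM_zero) auto
    show "AE x in circle_haar. norm (cmod (harmonic_extension f (of_real (radius i) * x) - f x)) \<le> 2 * B" for i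
    proof (rule AE_I2)
      fix x assume "x \<in> space circle_haar"
      then have "cmod x = 1" by simp
      from TB[OF this, of i] B[OF this] show "norm (cmod (harmonic_extension f (of_real (radius i) * x) - f x))
          \<le> 2 * B"
        using norm_triangle_ineq4[of "harmonic_extension f (of_real (radius i) * x)" "f x"] by simp
    qed
  qed (use fi harmonic_extension_contraction(1)[OF fi radius_nonneg radius_less_1] in auto)
  then show ?thesis by (simp add: abel_summable_def)
qed

text \<open>The indicator is a bounded pointwise limit of continuous tents of slope j around K: off
  K the distance is positive, so the tent vanishes there once j is large.\<close>

lemma abel_summable_closed_indicator:
  assumes K: "closed K"
  shows "abel_summable (\<lambda>x. indicator K x *\<^sub>R c)"
\<comment> \<open>\<open>infdist\<close> to the empty set is 0, so the tents would be constantly 1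
  there instead of tending to 0.\<close>
proof (cases "K = {}")
  case True
  then show ?thesis using abel_summable_continuous[of "\<lambda>_. 0"] by simp
next
  case False
  let ?s = "\<lambda>j::nat. \<lambda>x. max 0 (1 - real j * infdist x K) *\<^sub>R c"
  have c: "continuous_on (sphere 0 1) (?s j)" for j by (intro continuous_intros)
  have Km: "(\<lambda>x. indicator K x *\<^sub>R c) \<in> borel_measurable circle_haar"
    using K by (intro borel_measurable_scaleR measurable_compose[OF measurable_ident_circle_haar]) auto
  have Ki: "integrable circle_haar (\<lambda>x. indicator K x *\<^sub>R c)"
    by (rule circle.integrable_const_bound[where B="cmod c"]) (use Km in \<open>auto simp: indicator_def\<close>)
  have "(\<lambda>j. LINT v|circle_haar. cmod (indicator K v *\<^sub>R c - ?s j v)) \<longlonglongrightarrow> (LINT v|circle_haar. 0)"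
  proof (rule integral_dominated_convergence[where w="\<lambda>_. cmod c"])
    show "AE x in circle_haar. (\<lambda>i. cmod (indicator K x *\<^sub>R c - ?s i x)) \<longlonglongrightarrow> 0"
    proof (rule AE_I2, rule tendsto_eventually)
      fix x :: complex
      show "\<forall>\<^sub>F i in sequentially. cmod (indicator K x *\<^sub>R c - ?s i x) = 0"
      proof (cases "x \<in> K")
        case True then show ?thesis by simp
      next
        case F: False
        then have "infdist x K > 0"
          using K \<open>K \<noteq> {}\<close> by (simp add: infdist_pos_not_in_closed)
        then obtain N :: nat where N: "1 < real N * infdist x K"
          using reals_Archimedean3 by blast
        show ?thesis unfolding eventually_sequentially
        proof (intro exI[of _ N] allI impI)
          fix i assume "N \<le> i"
          then have "1 < real i * infdist x K"
            using N mult_right_mono[of "real N" "real i" "infdist x K"] infdist_nonneg[of x K] by linarith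
          then show "cmod (indicator K x *\<^sub>R c - ?s i x) = 0" using F by simp
        qed
      qed
    qed
    show "AE x in circle_haar. norm (cmod (indicator K x *\<^sub>R c - ?s i x)) \<le> cmod c" for i
    proof (rule AE_I2)
      fix x :: complex
      have "indicator K x *\<^sub>R c - ?s i x = (indicator K x - max 0 (1 - real i * infdist x K)) *\<^sub>R c"
        by (simp add: scaleR_diff_left)
      moreover have "\<bar>indicator K x - max 0 (1 - real i * infdist x K)\<bar> \<le> 1"
        using infdist_nonneg[of x K] by (auto simp: indicator_def max_def)
      ultimately show "norm (cmod (indicator K x *\<^sub>R c - ?s i x)) \<le> cmod c"
        using mult_right_mono[of _ 1 "cmod c"] by auto
    qed
  qed (use Ki integrable_circle_haar_continuous[OF c] in auto)
  then show ?thesis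
    by (intro abel_summable_limit[OF Ki integrable_circle_haar_continuous[OF c] abel_summable_continuous[OF c]]) simp
qed

lemma abel_summable_indicator:
  assumes A: "A \<in> sets circle_haar"
  shows "abel_summable (\<lambda>x. indicator A x *\<^sub>R c)"
proof (rule abel_summable_closed)
  show Ai: "integrable circle_haar (\<lambda>x. indicator A x *\<^sub>R c)"
    using A by (intro integrable_scaleR_left integrable_real_indicator) (auto simp: less_top[symmetric])
  fix e :: real assume e: "e > 0"
  \<comment> \<open>Inner regularity speaks of Borel measures on the whole plane, hence the
    push-forward along the inclusion of the circle.\<close>
  let ?M = "distr circle_haar borel (\<lambda>w. w)"
  have Ab: "A \<in> sets borel"
    using A by (auto simp: sets_circle_haar sets_restrict_space)
  have eq: "emeasure ?M X = emeasure circle_haar (X \<inter> sphere 0 1)" if "X \<in> sets borel" for X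
    using that by (subst emeasure_distr) (auto simp: vimage_def Int_def)
  have As: "A \<inter> sphere 0 1 = A" using sets.sets_into_space[OF A] by auto
  interpret M: prob_space ?M by (intro circle.prob_space_distr) simp
  \<comment> \<open>The error will be at most d |c|; the summand 1 makes the quotient meaningful for
    c = 0 and the final inequality strict.\<close>
  define d where "d = e / (cmod c + 1)"
  have cp: "cmod c + 1 > 0" using norm_ge_zero[of c] by linarith
  have d: "d > 0" using e cp by (simp add: d_def)
  have "emeasure ?M A = (SUP K \<in> {K. K \<subseteq> A \<and> compact K}. emeasure ?M K)"
    by (rule inner_regular) (use Ab M.emeasure_finite in auto)
  moreover have "emeasure ?M A \<noteq> \<infinity>" using M.emeasure_finite by auto
  moreover have "{K. K \<subseteq> A \<and> compact K} \<noteq> {}" by auto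
  ultimately have "\<exists>K\<in>{K. K \<subseteq> A \<and> compact K}. emeasure ?M A < emeasure ?M K + ennreal d"
    using d by (intro SUP_approx_ennreal)
  then obtain K where K: "K \<subseteq> A" "compact K" "emeasure ?M A < emeasure ?M K + ennreal d" by blast
  have Kb: "K \<in> sets borel" "closed K" using K by (auto simp: compact_imp_closed)
  have "K \<inter> sphere 0 1 = K" using K As by auto
  then have Kc: "K \<in> sets circle_haar"
    unfolding sets_circle_haar sets_restrict_space using Kb by (metis Int_commute image_eqI)
  have Ki: "integrable circle_haar (\<lambda>x. indicator K x *\<^sub>R c)"
    using Kc by (intro integrable_scaleR_left integrable_real_indicator) (auto simp: less_top[symmetric])
  have "emeasure circle_haar A < emeasure circle_haar K + ennreal d"
    using K(3) Ab Kb As \<open>K \<inter> sphere 0 1 = K\<close> by (simp add: eq)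
  then have "ennreal (measure circle_haar A) < ennreal (measure circle_haar K + d)"
    using d by (simp only: circle.emeasure_eq_measure) (subst ennreal_plus; simp)
  then have "measure circle_haar A < measure circle_haar K + d"
    by (subst (asm) ennreal_less_iff) auto
  then have md: "measure circle_haar (A - K) < d"
    using K(1) A Kc by (simp add: circle.finite_measure_Diff)
  have "(LINT v|circle_haar. cmod (indicator A v *\<^sub>R c - indicator K v *\<^sub>R c))
      = (LINT v|circle_haar. indicator (A - K) v * cmod c)"
    by (rule Bochner_Integration.integral_cong) (use K(1) in \<open>auto simp: indicator_def\<close>)
  also have "\<dots> = measure circle_haar (A - K) * cmod c"
    using A Kc As by (subst integral_mult_left_zero) (auto simp: Diff_Int_distrib2 \<open>K \<inter> sphere 0 1 = K\<close>)
  also have "\<dots> \<le> d * cmod c" using md by (intro mult_right_mono) auto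
  also have "\<dots> < d * (cmod c + 1)" using d by (intro mult_strict_left_mono) auto
  also have "\<dots> = e" using cp by (simp add: d_def)
  finally show "\<exists>g. integrable circle_haar g \<and> abel_summable g \<and>
      (LINT v|circle_haar. cmod (indicator A v *\<^sub>R c - g v)) < e"
    using Ki abel_summable_closed_indicator[OF Kb(2)] by blast
qed

text \<open>Convergence in mean takes the place of Fatou's theorem on radial limits. The class
  contains the indicators and is closed under sums and L^1 limits, hence contains every integrable
  function.\<close>

theorem abel_summable_integrable:
  assumes "integrable circle_haar f"
  shows "abel_summable f"
  using assms
proof (induct rule: integrable_induct)
  case (base A c)
  then show ?case by (intro abel_summable_indicator)
next
  case (add f g)
  let ?T = "\<lambda>f i v. harmonic_extension f (of_real (radius i) * v)"
  note int = harmonic_extension_contraction(1)[OF _ radius_nonneg radius_less_1]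
  show ?case unfolding abel_summable_def
  proof (rule tendsto_sandwich[OF _ _ tendsto_const])
    show "(\<lambda>i. (LINT v|circle_haar. cmod (?T f i v - f v)) + (LINT v|circle_haar. cmod (?T g i v - g v))) \<longlonglongrightarrow> 0"
      using tendsto_add[OF add(2)[unfolded abel_summable_def] add(4)[unfolded abel_summable_def]] by simp
    show "\<forall>\<^sub>F i in sequentially. (LINT v|circle_haar. cmod (?T (\<lambda>x. f x + g x) i v - (f v + g v)))
        \<le> (LINT v|circle_haar. cmod (?T f i v - f v)) + (LINT v|circle_haar. cmod (?T g i v - g v))"
    proof (intro always_eventually allI)
      fix i
      have "(LINT v|circle_haar. cmod (?T (\<lambda>x. f x + g x) i v - (f v + g v)))
         = (LINT v|circle_haar. cmod ((?T f i v - f v) + (?T g i v - g v) + 0))"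
        by (rule Bochner_Integration.integral_cong)
           (use add(1,3) in \<open>auto simp: harmonic_extension_add radius_disc add_diff_add\<close>)
      also have "\<dots> \<le> (LINT v|circle_haar. cmod (?T f i v - f v)) + (LINT v|circle_haar. cmod (?T g i v - g v))
          + (LINT v|circle_haar. cmod 0)"
        by (rule integral_norm_triangle3) (auto intro!: Bochner_Integration.integrable_diff int add(1,3))
      finally show "(LINT v|circle_haar. cmod (?T (\<lambda>x. f x + g x) i v - (f v + g v)))
        \<le> (LINT v|circle_haar. cmod (?T f i v - f v)) + (LINT v|circle_haar. cmod (?T g i v - g v))" by simp
    qed
  qed auto
next
  case (lim f s)
  have "(\<lambda>j. LINT v|circle_haar. cmod (f v - s j v)) \<longlonglongrightarrow> (LINT v|circle_haar. 0)"
  \<comment> \<open>The approximants of the induction satisfy |s_j| \<le> 2 |f|, hence the factor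
    3.\<close>
  proof (rule integral_dominated_convergence[where w="\<lambda>v. 3 * cmod (f v)"])
    show "AE x in circle_haar. (\<lambda>i. cmod (f x - s i x)) \<longlonglongrightarrow> 0"
    proof (rule AE_I2)
      fix x assume "x \<in> space circle_haar"
      then show "(\<lambda>i. cmod (f x - s i x)) \<longlonglongrightarrow> 0"
        by (intro tendsto_norm_zero) (use tendsto_diff[OF tendsto_const[of "f x"] lim(3)[OF \<open>x \<in> space circle_haar\<close>]] in simp)
    qed
    show "AE x in circle_haar. norm (cmod (f x - s i x)) \<le> 3 * cmod (f x)" for i
      by (rule AE_I2) (use lim(4) norm_triangle_ineq4 in \<open>smt (verit) norm_ge_zero real_norm_def\<close>)
  qed (use lim in auto)
  then show ?case
    by (intro abel_summable_limit[OF lim(5) lim(1) lim(2)]) simp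
qed

section \<open>Herglotz transforms and Hardy spaces\<close>

text \<open>The analytic completion of the Poisson extension of u, normalised to be real at
  0.\<close>

definition herglotz :: "(complex \<Rightarrow> real) \<Rightarrow> complex \<Rightarrow> complex" where
  "herglotz u z = (LINT w|circle_haar. (w + z) / (w - z) * of_real (u w))"

lemma integrable_herglotz:
  assumes "cmod z < 1" "integrable circle_haar u"
  shows "integrable circle_haar (\<lambda>w. (w + z) / (w - z) * of_real (u w))"
  by (intro integrable_circle_kernel_mult continuous_intros) (use assms in auto)

lemma Re_herglotz:
  assumes "cmod z < 1" "integrable circle_haar u"
  shows "Re (herglotz u z) = poisson_ext u z"
proof -
  have "Re (herglotz u z) = (LINT w|circle_haar. Re ((w + z) / (w - z) * of_real (u w)))"
    unfolding herglotz_def by (rule integral_Re[symmetric, OF integrable_herglotz[OF assms]])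
  also have "\<dots> = poisson_ext u z"
    unfolding poisson_ext_def
  proof (rule Bochner_Integration.integral_cong)
    fix w assume "w \<in> space circle_haar"
    then have "Re ((w + z) / (w - z)) = poisson z w"
      using assms by (intro Re_herglotz_kernel) auto
    then show "Re ((w + z) / (w - z) * of_real (u w)) = poisson z w * u w"
      by (simp only: Re_complex_of_real Im_complex_of_real times_complex.simps)
  qed simp
  finally show ?thesis .
qed

lemma herglotz_0: "herglotz u 0 = of_real (LINT w|circle_haar. u w)"
proof -
  have "herglotz u 0 = (LINT w|circle_haar. of_real (u w))"
    unfolding herglotz_def by (rule Bochner_Integration.integral_cong) auto
  then show ?thesis by simp
qed

text \<open>With the difference quotient in closed form, differentiation under the integral sign is
  a matter of dominated convergence.\<close>

lemma herglotz_kernel_diff: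
  fixes w x y :: complex
  assumes "w \<noteq> x" "w \<noteq> y" "x \<noteq> y"
  shows "((w + y) / (w - y) - (w + x) / (w - x)) / (y - x) = 2 * w / ((w - y) * (w - x))"
proof -
  have "(w + y) / (w - y) - (w + x) / (w - x) = (2 * w / ((w - y) * (w - x))) * (y - x)"
    using assms by (simp add: divide_simps) (simp add: algebra_simps)
  then show ?thesis using assms by simp
qed

lemma herglotz_holomorphic:
  assumes u: "integrable circle_haar u"
  shows "herglotz u holomorphic_on ball 0 1"
  unfolding holomorphic_on_open[OF open_ball]
proof (intro ballI exI)
  fix x :: complex assume "x \<in> ball 0 1"
  then have x: "cmod x < 1" by simp
  have um: "u \<in> borel_measurable circle_haar" using u by auto
  \<comment> \<open>Half the distance from x to the circle: points within q of x keep distance at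
    least q from every w on the circle.\<close>
  define q where "q = (1 - cmod x) / 2"
  have q: "q > 0" using x by (simp add: q_def)
  let ?D = "LINT w|circle_haar. 2 * w / ((w - x) * (w - x)) * of_real (u w)"
  show "(herglotz u has_field_derivative ?D) (at x)"
    unfolding has_field_derivative_iff tendsto_at_iff_sequentially comp_def
  proof (intro allI impI)
    fix X assume X: "\<forall>i. X i \<in> UNIV - {x}" "X \<longlonglongrightarrow> x"
    obtain N where N: "\<And>i. i \<ge> N \<Longrightarrow> dist (X i) x < q"
      using metric_LIMSEQ_D[OF X(2) q] by blast
    \<comment> \<open>Early terms of X may leave this neighbourhood; the shift discards them, so the
      kernel bound 2 / q^2 holds for every index.\<close>
    define Y where "Y i = X (i + N)" for i
    have Y: "Y i \<noteq> x" "cmod (Y i) < 1 - q" for i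
    proof -
      show "Y i \<noteq> x" using X by (auto simp: Y_def)
      have "cmod (Y i - x) < q" using N[of "i + N"] by (simp add: Y_def dist_norm)
      then have "cmod (Y i) < q + cmod x" using norm_triangle_ineq2[of "Y i" x] by linarith
      then show "cmod (Y i) < 1 - q" by (simp add: q_def field_simps)
    qed
    have Ylim: "Y \<longlonglongrightarrow> x" unfolding Y_def using X(2) by (rule LIMSEQ_ignore_initial_segment)
    have Yq: "cmod (Y i) < 1" for i using Y(2)[of i] q by linarith
    have quot: "(herglotz u (Y i) - herglotz u x) / (Y i - x)
        = (LINT w|circle_haar. 2 * w / ((w - Y i) * (w - x)) * of_real (u w))" for i
    proof -
      have "herglotz u (Y i) - herglotz u x =
          (LINT w|circle_haar. (w + Y i) / (w - Y i) * of_real (u w) - (w + x) / (w - x) * of_real (u w))"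
        unfolding herglotz_def
        by (rule Bochner_Integration.integral_diff[symmetric]) (intro integrable_herglotz u Yq x)+
      then have "(herglotz u (Y i) - herglotz u x) / (Y i - x) =
          (LINT w|circle_haar. ((w + Y i) / (w - Y i) * of_real (u w) - (w + x) / (w - x) * of_real (u w)) / (Y i - x))"
        by simp
      also have "\<dots> = (LINT w|circle_haar. 2 * w / ((w - Y i) * (w - x)) * of_real (u w))"
      proof (rule Bochner_Integration.integral_cong)
        fix w assume "w \<in> space circle_haar"
        then have "w \<noteq> x" "w \<noteq> Y i" using x Yq[of i] by auto
        from herglotz_kernel_diff[OF this] Y(1)[of i]
        have k: "((w + Y i) / (w - Y i) - (w + x) / (w - x)) / (Y i - x) = 2 * w / ((w - Y i) * (w - x))" by auto
        then show "((w + Y i) / (w - Y i) * of_real (u w) - (w + x) / (w - x) * of_real (u w)) / (Y i - x) =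
           2 * w / ((w - Y i) * (w - x)) * of_real (u w)"
          by (simp only: k[symmetric]) (simp only: diff_divide_distrib left_diff_distrib times_divide_eq_left)
      qed simp
      finally show ?thesis .
    qed
    have "(\<lambda>i. LINT w|circle_haar. 2 * w / ((w - Y i) * (w - x)) * of_real (u w)) \<longlonglongrightarrow> ?D"
    proof (rule integral_dominated_convergence[where w="\<lambda>w. 2 / (q * q) * \<bar>u w\<bar>"])
      show "AE w in circle_haar. (\<lambda>i. 2 * w / ((w - Y i) * (w - x)) * of_real (u w))
          \<longlonglongrightarrow> 2 * w / ((w - x) * (w - x)) * of_real (u w)"
        by (rule AE_I2) (use x in \<open>auto intro!: tendsto_intros Ylim\<close>)
      show "AE w in circle_haar. cmod (2 * w / ((w - Y i) * (w - x)) * of_real (u w)) \<le> 2 / (q * q) * \<bar>u w\<bar>" for i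
      proof (rule AE_I2)
        fix w assume "w \<in> space circle_haar"
        then have w: "cmod w = 1" by simp
        have "q \<le> cmod (w - Y i)" using norm_triangle_ineq2[of w "Y i"] Y(2)[of i] w by linarith
        moreover have "q \<le> cmod (w - x)" using norm_triangle_ineq2[of w x] w x by (simp add: q_def)
        ultimately have "2 / (cmod (w - Y i) * cmod (w - x)) \<le> 2 / (q * q)"
          using q by (intro divide_left_mono mult_mono mult_pos_pos) auto
        then show "cmod (2 * w / ((w - Y i) * (w - x)) * of_real (u w)) \<le> 2 / (q * q) * \<bar>u w\<bar>"
          using mult_right_mono[of "2 / (cmod (w - Y i) * cmod (w - x))" "2 / (q * q)" "\<bar>u w\<bar>"] w
          by (simp add: norm_mult norm_divide)
      qed
      show "integrable circle_haar (\<lambda>w. 2 / (q * q) * \<bar>u w\<bar>)" using u by auto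
    qed (use um in measurable)
    then have "(\<lambda>i. (herglotz u (Y i) - herglotz u x) / (Y i - x)) \<longlonglongrightarrow> ?D"
      by (simp only: quot)
    then show "(\<lambda>i. (herglotz u (X i) - herglotz u x) / (X i - x)) \<longlonglongrightarrow> ?D"
      unfolding Y_def by (rule LIMSEQ_offset)
  qed
qed

text \<open>The real part of the denominator is e plus a nonnegative Poisson extension; this
  excludes zeros and bounds the modulus from below. The value e = 1 gives the damping factor, and
  small e serves the submean inequality for square roots.\<close>

lemma herglotz_resolvent:
  assumes u: "integrable circle_haar u" "\<And>w. cmod w = 1 \<Longrightarrow> 0 \<le> u w" and e: "0 < e"
  shows "(\<lambda>z. 1 / (of_real e + herglotz u z)) holomorphic_on ball 0 1"
    and "cmod z < 1 \<Longrightarrow> cmod (1 / (of_real e + herglotz u z)) \<le> 1 / (e + poisson_ext u z)"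
proof -
  have pos: "e + poisson_ext u z > 0" if "cmod z < 1" for z
    using poisson_ext_nonneg[of z u] that u e by fastforce
  have Re: "Re (of_real e + herglotz u z) = e + poisson_ext u z" if "cmod z < 1" for z
    using Re_herglotz[OF that u(1)] by simp
  have ne: "of_real e + herglotz u z \<noteq> 0" if "cmod z < 1" for z
    using Re[OF that] pos[OF that] by (metis less_irrefl zero_complex.simps(1))
  show "(\<lambda>z. 1 / (of_real e + herglotz u z)) holomorphic_on ball 0 1"
    using ne by (intro holomorphic_intros herglotz_holomorphic u) auto
  assume z: "cmod z < 1"
  have "e + poisson_ext u z \<le> cmod (of_real e + herglotz u z)"
    using Re[OF z] complex_Re_le_cmod by metis
  then show "cmod (1 / (of_real e + herglotz u z)) \<le> 1 / (e + poisson_ext u z)"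
    using pos[OF z] by (auto simp: norm_divide intro!: divide_left_mono mult_pos_pos)
qed

text \<open>The radius 2 / (1 + r) exceeds 1, is mapped by the dilation into the open disc, and,
  unlike 1 / r, makes sense at r = 0.\<close>

lemma dilate_holomorphic:
  assumes k: "k holomorphic_on ball 0 1" and r: "0 \<le> r" "r < (1::real)"
  shows "(\<lambda>w. k (of_real r * w)) holomorphic_on ball 0 (2 / (1 + r))" "1 < 2 / (1 + r)"
proof -
  show "1 < 2 / (1 + r)" using r by simp
  have "(\<lambda>w. complex_of_real r * w) ` ball 0 (2 / (1 + r)) \<subseteq> ball 0 1"
  proof
    fix y assume "y \<in> (\<lambda>w. complex_of_real r * w) ` ball 0 (2 / (1 + r))"
    then obtain w where w: "y = of_real r * w" "cmod w < 2 / (1 + r)" by force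
    have "r * cmod w \<le> r * (2 / (1 + r))" using w r by (intro mult_left_mono) auto
    also have "\<dots> < 1" using r by (simp add: field_simps)
    finally show "y \<in> ball 0 1" using w r by (simp add: norm_mult)
  qed
  then have "k \<circ> (\<lambda>w. of_real r * w) holomorphic_on ball 0 (2 / (1 + r))"
    by (intro holomorphic_on_compose_gen[OF _ k]) (auto intro!: holomorphic_intros)
  then show "(\<lambda>w. k (of_real r * w)) holomorphic_on ball 0 (2 / (1 + r))" by (simp add: comp_def)
qed

lemma continuous_on_dilate:
  assumes k: "k holomorphic_on ball 0 1" and r: "0 \<le> r" "r < (1::real)"
  shows "continuous_on (sphere 0 1) (\<lambda>w. k (of_real r * w))"
  using holomorphic_on_imp_continuous_on[OF dilate_holomorphic(1)[OF assms]]
  by (rule continuous_on_subset) (use dilate_holomorphic(2)[OF assms] in auto)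

lemma hardy_H1_0_holomorphic:
  assumes "K holomorphic_on ball 0 R" "1 < R" "K 0 = 0"
  shows "K \<in> hardy_H1_0"
proof -
  have "continuous_on (sphere 0 1) K"
    using holomorphic_on_imp_continuous_on[OF assms(1)] by (rule continuous_on_subset) (use assms in auto)
  moreover have "harmonic_extension K holomorphic_on ball 0 1"
    by (rule holomorphic_transform[of K])
        (use assms in \<open>auto intro: holomorphic_on_subset simp: harmonic_extension_holomorphic\<close>)
  ultimately show ?thesis
    using mean_value_circle_haar[OF assms(1,2)] assms(3)
    by (auto simp: hardy_H1_0_def hardy_H1_def integrable_circle_haar_continuous)
qed

lemma hardy_H1_0_dilate:
  assumes "k holomorphic_on ball 0 1" "0 \<le> r" "r < 1" "k 0 = 0"
  shows "(\<lambda>w. k (of_real r * w)) \<in> hardy_H1_0"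
  using dilate_holomorphic[OF assms(1-3)] assms(4) by (intro hardy_H1_0_holomorphic) auto

lemma hardy_H1_0D:
  assumes "h \<in> hardy_H1_0"
  shows "integrable circle_haar h" "harmonic_extension h holomorphic_on ball 0 1"
    "(LINT w|circle_haar. h w) = 0" "harmonic_extension h 0 = 0"
  using assms by (auto simp: hardy_H1_0_def hardy_H1_def harmonic_extension_at_0)

lemma hardy_H1_0_zero: "(\<lambda>_. 0) \<in> hardy_H1_0"
  by (rule hardy_H1_0_holomorphic[where R=2]) auto

lemma hardy_H1_0_diff:
  assumes "f \<in> hardy_H1_0" "g \<in> hardy_H1_0"
  shows "(\<lambda>w. f w - g w) \<in> hardy_H1_0"
proof -
  note f = hardy_H1_0D[OF assms(1)] and g = hardy_H1_0D[OF assms(2)]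
  have "harmonic_extension (\<lambda>w. f w - g w) holomorphic_on ball 0 1"
    by (rule holomorphic_transform[of "\<lambda>z. harmonic_extension f z - harmonic_extension g z"])
       (use f g in \<open>auto intro!: holomorphic_intros simp: harmonic_extension_diff\<close>)
  then show ?thesis using f g by (auto simp: hardy_H1_0_def hardy_H1_def)
qed

lemma hardy_H1_0_cong:
  assumes "f \<in> hardy_H1_0" "\<And>w. cmod w = 1 \<Longrightarrow> f w = g w"
  shows "g \<in> hardy_H1_0"
proof -
  have "harmonic_extension g = harmonic_extension f"
    using harmonic_extension_cong[of f g] assms(2) by auto
  moreover have "integrable circle_haar g \<longleftrightarrow> integrable circle_haar f"
    by (rule Bochner_Integration.integrable_cong) (use assms in auto)
  moreover have "(LINT w|circle_haar. g w) = (LINT w|circle_haar. f w)"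
    by (rule Bochner_Integration.integral_cong) (use assms in auto)
  ultimately show ?thesis using assms(1) by (auto simp: hardy_H1_0_def hardy_H1_def)
qed

text \<open>Mean convergence gives almost everywhere convergence along a subsequence, which is all
  of the radial limit theorem that the dominated convergence argument below asks for.\<close>

lemma poisson_ext_AE_subseq:
  assumes v: "integrable circle_haar v"
  shows "\<exists>s::nat \<Rightarrow> nat. strict_mono s \<and>
    (AE w in circle_haar. (\<lambda>i. poisson_ext v (of_real (radius (s i)) * w)) \<longlonglongrightarrow> v w)"
proof -
  let ?v = "\<lambda>w. complex_of_real (v w)"
  have vi: "integrable circle_haar ?v" using v by auto
  have eq: "harmonic_extension ?v z = of_real (poisson_ext v z)" for z
    unfolding harmonic_extension_poisson poisson_ext_def
    by (simp flip: integral_complex_of_real of_real_mult)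
  have "\<exists>s::nat \<Rightarrow> nat. strict_mono s \<and>
    (AE w in circle_haar. (\<lambda>i. harmonic_extension ?v (of_real (radius (s i)) * w) - ?v w) \<longlonglongrightarrow> 0)"
  proof (rule tendsto_L1_AE_subseq[where u="\<lambda>i w. harmonic_extension ?v (of_real (radius i) * w) - ?v w"])
    show "integrable circle_haar (\<lambda>w. harmonic_extension ?v (of_real (radius i) * w) - ?v w)" for i
      by (intro Bochner_Integration.integrable_diff harmonic_extension_contraction(1)[OF vi] radius_nonneg radius_less_1 vi)
  qed (rule abel_summable_integrable[OF vi, unfolded abel_summable_def])
  then obtain s :: "nat \<Rightarrow> nat" where s: "strict_mono s"
    "AE w in circle_haar. (\<lambda>i. harmonic_extension ?v (of_real (radius (s i)) * w) - ?v w) \<longlonglongrightarrow> 0" by blast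
  from s(2) have "AE w in circle_haar. (\<lambda>i. poisson_ext v (of_real (radius (s i)) * w)) \<longlonglongrightarrow> v w"
  proof eventually_elim
    case (elim w)
    have "(\<lambda>i. complex_of_real (poisson_ext v (of_real (radius (s i)) * w) - v w)) \<longlonglongrightarrow> of_real 0"
      using elim unfolding eq by simp
    then have "(\<lambda>i. poisson_ext v (of_real (radius (s i)) * w) - v w) \<longlonglongrightarrow> 0"
      by (simp only: tendsto_of_real_iff)
    then show ?case by (rule LIM_zero_cancel)
  qed
  with s(1) show ?thesis by blast
qed

lemma integrable_sqrt_norm:
  fixes f :: "complex \<Rightarrow> complex"
  assumes f: "integrable circle_haar f"
  shows "integrable circle_haar (\<lambda>w. sqrt (cmod (f w)))"
proof (rule Bochner_Integration.integrable_bound)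
  show "integrable circle_haar (\<lambda>w. 1 + cmod (f w))" using f by auto
  have "sqrt t \<le> 1 + t" if "t \<ge> 0" for t
    using that by (intro real_le_lsqrt) (auto simp: power2_eq_square algebra_simps)
  then show "AE w in circle_haar. norm (sqrt (cmod (f w))) \<le> norm (1 + cmod (f w))"
    by (intro AE_I2) (simp add: abs_of_nonneg)
qed (use borel_measurable_integrable[OF f] in measurable)

text \<open>With \<open>f = z + h\<close>, \<open>v = sqrt \<bar>f\<bar>\<close> and \<open>a = 1 / (e + herglotz v)\<close>, the mean value property gives
  \<open>z a(0) = \<integral> f a\<close>, while \<open>\<bar>a\<bar> \<le> 1 / (e + v)\<close> on the circle; so \<open>\<bar>z\<bar> / (e + \<integral>v) \<le> \<integral>v\<close>.\<close>

lemma sqrt_norm_submean: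
  assumes h: "h \<in> hardy_H1_0"
  shows "sqrt (cmod z) \<le> (LINT w|circle_haar. sqrt (cmod (z + h w)))"
proof -
  note h' = hardy_H1_0D[OF h]
  define f where "f w = z + h w" for w
  define v where "v w = sqrt (cmod (f w))" for w
  define I where "I = (LINT w|circle_haar. v w)"
  have f: "integrable circle_haar f" using h' by (auto simp: f_def[abs_def])
  have v: "integrable circle_haar v" unfolding v_def[abs_def] by (rule integrable_sqrt_norm[OF f])
  have v0: "v w \<ge> 0" for w by (simp add: v_def)
  have I0: "I \<ge> 0" unfolding I_def by (intro Bochner_Integration.integral_nonneg v0)
  define H where "H = harmonic_extension f"
  have H: "H x = z + harmonic_extension h x" if "cmod x < 1" for x
    unfolding H_def f_def[abs_def] using that h' by (subst harmonic_extension_add)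
        (auto simp: harmonic_extension_const)
  have Hh: "H holomorphic_on ball 0 1"
    by (rule holomorphic_transform[of "\<lambda>x. z + harmonic_extension h x"])
        (use h' H in \<open>auto intro!: holomorphic_intros\<close>)
  have [measurable]: "v \<in> borel_measurable circle_haar" "f \<in> borel_measurable circle_haar" using v f by auto
  obtain s :: "nat \<Rightarrow> nat" where s: "strict_mono s"
    "AE w in circle_haar. (\<lambda>i. poisson_ext v (of_real (radius (s i)) * w)) \<longlonglongrightarrow> v w"
    using poisson_ext_AE_subseq[OF v] by blast
  have main: "cmod z / (e + I) \<le> I" if e: "e > 0" for e
  proof -
    define a where "a x = 1 / (of_real e + herglotz v x)" for x
    have a: "a holomorphic_on ball 0 1" "\<And>x. cmod x < 1 \<Longrightarrow> cmod (a x) \<le> 1 / (e + poisson_ext v x)"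
      unfolding a_def[abs_def] using herglotz_resolvent[OF v v0 e] by auto
    have pp: "0 \<le> poisson_ext v x" if "cmod x < 1" for x by (rule poisson_ext_nonneg[OF that v0])
    \<comment> \<open>\<open>H * a\<close> is analytic, so its mean on the circle of radius r < 1 is
      z a(0), whatever r is. Replacing H by its boundary function f costs the first term, where |a|
      \<le> 1 / e; in the second term the sharper bound on |a| is kept, since it converges to 1 / (e
      + v).\<close>
    have le: "cmod z / (e + I) \<le> (LINT w|circle_haar. cmod (H (of_real (radius (s i)) * w) - f w)) / e
        + (LINT w|circle_haar. cmod (f w) / (e + poisson_ext v (of_real (radius (s i)) * w)))" for i
    proof -
      let ?r = "radius (s i)"
      have iH: "integrable circle_haar (\<lambda>w. H (of_real ?r * w))"
        unfolding H_def by (rule harmonic_extension_contraction(1)[OF f radius_nonneg radius_less_1])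
      have i1: "integrable circle_haar (\<lambda>w. cmod (H (of_real ?r * w) - f w) / e)"
        using iH f by auto
      have i2: "integrable circle_haar (\<lambda>w. cmod (f w) / (e + poisson_ext v (of_real ?r * w)))"
      proof (rule Bochner_Integration.integrable_bound)
        show "integrable circle_haar (\<lambda>w. cmod (f w) / e)" using f by auto
        show "(\<lambda>w. cmod (f w) / (e + poisson_ext v (of_real ?r * w))) \<in> borel_measurable circle_haar"
          by (intro borel_measurable_divide borel_measurable_add poisson_ext_measurable) measurable
        show "AE w in circle_haar. norm (cmod (f w) / (e + poisson_ext v (of_real ?r * w)))
            \<le> norm (cmod (f w) / e)"
          by (rule AE_I2) (use pp[OF radius_disc] e in \<open>auto intro!: divide_left_mono mult_pos_pos add_pos_nonneg\<close>)
      qed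
      have Ha: "(\<lambda>x. H x * a x) holomorphic_on ball 0 1" by (intro holomorphic_intros Hh a(1))
      have "(LINT w|circle_haar. H (of_real ?r * w) * a (of_real ?r * w)) = H 0 * a 0"
        using mean_value_circle_haar[OF dilate_holomorphic[OF Ha radius_nonneg radius_less_1]] by simp
      also have "H 0 = z" using H[of 0] h' by simp
      also have "a 0 = of_real (1 / (e + I))" by (simp add: a_def herglotz_0 I_def)
      finally have "cmod (z * of_real (1 / (e + I)))
          = cmod (LINT w|circle_haar. H (of_real ?r * w) * a (of_real ?r * w))"
        by simp
      also have "cmod (z * of_real (1 / (e + I))) = cmod z / (e + I)"
        using e I0 by (simp add: norm_mult norm_divide flip: of_real_add)
      also have "cmod (LINT w|circle_haar. H (of_real ?r * w) * a (of_real ?r * w))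
         \<le> (LINT w|circle_haar. cmod (H (of_real ?r * w) * a (of_real ?r * w)))"
        by (rule integral_norm_bound)
      also have "\<dots> \<le> (LINT w|circle_haar. cmod (H (of_real ?r * w) - f w) / e + cmod (f w) / (e
          + poisson_ext v (of_real ?r * w)))"
      proof (rule integral_mono)
        show "integrable circle_haar (\<lambda>w. cmod (H (of_real ?r * w) * a (of_real ?r * w)))"
          by (intro integrable_circle_haar_continuous continuous_intros
               continuous_on_dilate[OF Hh radius_nonneg radius_less_1] continuous_on_dilate[OF a(1) radius_nonneg radius_less_1])
        show "integrable circle_haar (\<lambda>w. cmod (H (of_real ?r * w) - f w) / e + cmod (f w) / (e
            + poisson_ext v (of_real ?r * w)))"
          using i1 i2 by auto
        fix w assume "w \<in> space circle_haar"
        then have w: "cmod w = 1" by simp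
        let ?x = "of_real ?r * w"
        have A: "cmod (a ?x) \<le> 1 / (e + poisson_ext v ?x)" by (rule a(2)[OF radius_disc[OF w]])
        also have "\<dots> \<le> 1 / e" using pp[OF radius_disc[OF w]] e
            by (intro divide_left_mono mult_pos_pos add_pos_nonneg) auto
        finally have A': "cmod (a ?x) \<le> 1 / e" .
        have "cmod (H ?x) \<le> cmod (H ?x - f w) + cmod (f w)" using norm_triangle_ineq[of "H ?x - f w" "f w"] by simp
        then have "cmod (H ?x * a ?x) \<le> (cmod (H ?x - f w) + cmod (f w)) * cmod (a ?x)"
          by (simp add: norm_mult mult_right_mono)
        also have "\<dots> \<le> cmod (H ?x - f w) * (1 / e) + cmod (f w) * (1 / (e + poisson_ext v ?x))"
          unfolding ring_distribs using A A' by (intro add_mono mult_left_mono) auto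
        finally show "cmod (H ?x * a ?x) \<le> cmod (H ?x - f w) / e + cmod (f w) / (e + poisson_ext v ?x)" by simp
      qed
      also have "\<dots> = (LINT w|circle_haar. cmod (H (of_real ?r * w) - f w)) / e
        + (LINT w|circle_haar. cmod (f w) / (e + poisson_ext v (of_real ?r * w)))"
        using i1 i2 by simp
      finally show ?thesis .
    qed
    have l1: "(\<lambda>i. LINT w|circle_haar. cmod (H (of_real (radius (s i)) * w) - f w)) \<longlonglongrightarrow> 0"
      using LIMSEQ_subseq_LIMSEQ[OF abel_summable_integrable[OF f, unfolded abel_summable_def] s(1)]
      by (simp add: H_def comp_def)
    have l2: "(\<lambda>i. LINT w|circle_haar. cmod (f w) / (e + poisson_ext v (of_real (radius (s i)) * w)))
        \<longlonglongrightarrow> (LINT w|circle_haar. cmod (f w) / (e + v w))"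
    proof (rule integral_dominated_convergence[where w="\<lambda>w. cmod (f w) / e"])
      show "integrable circle_haar (\<lambda>w. cmod (f w) / e)" using f by auto
      show "(\<lambda>w. cmod (f w) / (e + v w)) \<in> borel_measurable circle_haar" by measurable
      show "(\<lambda>w. cmod (f w) / (e + poisson_ext v (of_real (radius (s i)) * w)))
          \<in> borel_measurable circle_haar" for i
        by (intro borel_measurable_divide borel_measurable_add poisson_ext_measurable) measurable
      show "AE w in circle_haar. norm (cmod (f w) / (e + poisson_ext v (of_real (radius (s i)) * w)))
          \<le> cmod (f w) / e" for i
        by (rule AE_I2) (use pp[OF radius_disc] e in \<open>auto intro!: divide_left_mono mult_pos_pos add_pos_nonneg\<close>)
      show "AE w in circle_haar. (\<lambda>i. cmod (f w) / (e + poisson_ext v (of_real (radius (s i)) * w)))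
          \<longlonglongrightarrow> cmod (f w) / (e + v w)"
        using s(2)
      proof eventually_elim
        case (elim w)
        have "e + v w \<noteq> 0" using e v0[of w] by linarith
        then show ?case by (intro tendsto_intros elim)
      qed
    qed
    have "cmod z / (e + I) \<le> 0 / e + (LINT w|circle_haar. cmod (f w) / (e + v w))"
      by (rule LIMSEQ_le_const[OF tendsto_add[OF tendsto_divide[OF l1 tendsto_const] l2]]) (use le e in auto)
    also have "(LINT w|circle_haar. cmod (f w) / (e + v w)) \<le> I"
      unfolding I_def
    proof (rule integral_mono_AE'[OF v])
      show "AE w in circle_haar. cmod (f w) / (e + v w) \<le> v w"
      proof (rule AE_I2)
        fix w
        have "cmod (f w) = v w * v w" by (simp add: v_def)
        also have "\<dots> \<le> v w * (e + v w)" using e v0 by (intro mult_left_mono) auto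
        finally show "cmod (f w) / (e + v w) \<le> v w"
          using e v0[of w] by (simp add: divide_le_eq add_pos_nonneg)
      qed
      show "AE w in circle_haar. 0 \<le> v w" using v0 by auto
    qed
    finally show ?thesis by simp
  qed
  have "cmod z \<le> I * I"
  proof (rule field_le_epsilon)
    fix e :: real assume e: "e > 0"
    \<comment> \<open>Chosen so that I * d \<le> e, including the case I = 0.\<close>
    define d where "d = e / (I + 1)"
    have d: "d > 0" using e I0 by (simp add: d_def)
    have "cmod z \<le> I * (d + I)"
      using main[OF d] d I0 by (simp add: divide_le_eq add_pos_nonneg)
    moreover have "I * d \<le> e" using e I0 by (simp add: d_def field_simps)
    ultimately show "cmod z \<le> I * I + e" by (simp add: algebra_simps)
  qed
  then have "sqrt (cmod z) \<le> I"
    using I0 by (intro real_le_lsqrt) (auto simp: power2_eq_square)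
  then show ?thesis by (simp add: I_def v_def f_def)
qed

section \<open>Elementary bounds in terms of sqrt (m^2 + s^2) - m\<close>

context
  fixes m s :: real
  assumes m: "0 < m" and s: "0 \<le> s"
begin

text \<open>For s \<le> 4 m the lower bound m + s^2 / (6 m) for the root amounts to s^2 \<le> 24
  m^2, and 16 m^2 is available. For s > 4 m the root exceeds 4 m, and 16 m^2 \<le> 6 m * 3
  m.\<close>

lemma sqrt_gain_min: "(min s (4 * m))\<^sup>2 \<le> 6 * m * (sqrt (m\<^sup>2 + s\<^sup>2) - m)"
proof (cases "s \<le> 4 * m")
  case True
  have "s\<^sup>2 \<le> 16 * m\<^sup>2"
    using power_mono[OF True s, of 2] by (simp add: power_mult_distrib)
  then have "s\<^sup>2 \<le> 24 * m\<^sup>2"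
    using zero_le_power2[of m] by linarith
  then have "s\<^sup>2 * s\<^sup>2 \<le> s\<^sup>2 * (24 * m\<^sup>2)"
    by (intro mult_left_mono) auto
  then have "(m + s\<^sup>2 / (6 * m))\<^sup>2 \<le> m\<^sup>2 + s\<^sup>2"
    using m by (simp add: power2_eq_square field_simps)
  then have "m + s\<^sup>2 / (6 * m) \<le> sqrt (m\<^sup>2 + s\<^sup>2)" by (rule real_le_rsqrt)
  then show ?thesis using True m by (simp add: field_simps power2_eq_square)
next
  case False
  have "s \<le> sqrt (m\<^sup>2 + s\<^sup>2)" by simp
  with False have "4 * m \<le> sqrt (m\<^sup>2 + s\<^sup>2)" by linarith
  then have "6 * m * (3 * m) \<le> 6 * m * (sqrt (m\<^sup>2 + s\<^sup>2) - m)"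
    using m by (intro mult_left_mono) auto
  then show ?thesis using False m by (simp add: power2_eq_square)
qed

text \<open>Below 4 m this is Young's inequality s b \<le> s^2 / (2 m) + m b^2 / 2 followed by
  \<open>sqrt_gain_min\<close>. Above it, b \<le> 2 and 2 s \<le> 3 (s - m). It replaces
  Cauchy-Schwarz, which would lose the linear growth in s.\<close>

lemma sqrt_gain_mult:
  assumes "0 \<le> b" "b \<le> 2"
  shows "s * b \<le> 3 * (sqrt (m\<^sup>2 + s\<^sup>2) - m) + m * b\<^sup>2 / 2"
proof (cases "s \<le> 4 * m")
  case True
  have "0 \<le> (s / m - b)\<^sup>2" by simp
  then have "0 \<le> m / 2 * (s / m - b)\<^sup>2" using m by simp
  also have "\<dots> = s\<^sup>2 / (2 * m) + m * b\<^sup>2 / 2 - s * b"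
    using m by (simp add: power2_eq_square field_simps)
  finally have "s * b \<le> s\<^sup>2 / (2 * m) + m * b\<^sup>2 / 2" by simp
  moreover have "s\<^sup>2 / (2 * m) \<le> 3 * (sqrt (m\<^sup>2 + s\<^sup>2) - m)"
    using sqrt_gain_min True m by (simp add: field_simps)
  ultimately show ?thesis by linarith
next
  case False
  define q where "q = sqrt (m\<^sup>2 + s\<^sup>2)"
  have "s * b \<le> s * 2" using s assms by (intro mult_left_mono) auto
  moreover have "s \<le> q" by (simp add: q_def)
  moreover have "0 \<le> m * b\<^sup>2 / 2" using m by simp
  ultimately have "s * b \<le> 3 * (q - m) + m * b\<^sup>2 / 2" using False s by argo
  then show ?thesis by (simp add: q_def)
qed

text \<open>With s = \<alpha> |h| and m = |z| the left side is the excess of |h| over the cutoff 4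
  |z| / \<alpha>, so its mean is controlled by the convexity inequality.\<close>

lemma sqrt_gain_excess: "max 0 (s / (4 * m) - 1) \<le> (sqrt (m\<^sup>2 + s\<^sup>2) - m) / (4 * m)"
proof -
  define q where "q = sqrt (m\<^sup>2 + s\<^sup>2)"
  have "s \<le> q" "m \<le> q" using m by (auto simp: q_def intro: real_le_rsqrt)
  then have "(s - 4 * m) / (4 * m) \<le> (q - m) / (4 * m)" "0 \<le> (q - m) / (4 * m)"
    using m by (auto intro!: divide_right_mono divide_nonneg_nonneg)
  then show ?thesis using m by (simp add: diff_divide_distrib q_def)
qed

end

section \<open>The bounded part of a Hardy function\<close>

text \<open>For M > 0 the least nonnegative u with |h| \<le> M (1 + u).\<close>

definition excess :: "real \<Rightarrow> (complex \<Rightarrow> complex) \<Rightarrow> complex \<Rightarrow> real" where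
  "excess M h w = max 0 (cmod (h w) / M - 1)"

text \<open>The case \<open>z = 0\<close> is separate because \<open>excess 0 h\<close> vanishes, as \<open>x / 0 = 0\<close>, and would not damp at all.\<close>

definition damped :: "real \<Rightarrow> real \<Rightarrow> complex \<Rightarrow> (complex \<Rightarrow> complex) \<Rightarrow> complex \<Rightarrow> complex" where
  "damped \<alpha> r z h w =
     (if z = 0 then 0
      else harmonic_extension h (of_real r * w)
             * (1 / (1 + herglotz (excess (4 * cmod z / \<alpha>) h) (of_real r * w))))"

lemma damped_0 [simp]: "damped \<alpha> r 0 h = (\<lambda>_. 0)"
  by (simp add: damped_def[abs_def])

lemma integrable_excess:
  assumes "integrable circle_haar h"
  shows "integrable circle_haar (excess M h)"
  unfolding excess_def[abs_def] using assms by auto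

section \<open>Consequences of the convexity inequality for one function\<close>

locale convexity_constant =
  fixes \<alpha> :: real
  assumes pos: "\<alpha> > 0"
    and convexity: "\<And>(z::complex) h. h \<in> hardy_H1_0 \<Longrightarrow>
           (LINT w|circle_haar. sqrt ((cmod z)\<^sup>2 + \<alpha>\<^sup>2 * (cmod (h w))\<^sup>2))
             \<le> (LINT w|circle_haar. cmod (z + h w))"
begin

text \<open>The convexity inequality is tested at z = 0 with h(w) = w. The bound settles the case z
  = 0 below and the comparison of constants at the end.\<close>

lemma le_1: "\<alpha> \<le> 1"
proof -
  have "(\<lambda>w. w) \<in> hardy_H1_0" by (rule hardy_H1_0_holomorphic[where R=2]) auto
  from convexity[OF this, of 0]
  have "(LINT w|circle_haar. sqrt (\<alpha>\<^sup>2 * (cmod w)\<^sup>2)) \<le> (LINT w|circle_haar. cmod w)" by simp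
  also have "(LINT w|circle_haar. cmod w) = (LINT w|circle_haar. 1)"
    by (rule Bochner_Integration.integral_cong) auto
  also have "(LINT w|circle_haar. sqrt (\<alpha>\<^sup>2 * (cmod w)\<^sup>2)) = (LINT w|circle_haar. \<alpha>)"
    by (rule Bochner_Integration.integral_cong) (use pos in \<open>auto simp: real_sqrt_mult\<close>)
  also have "(LINT w|circle_haar. \<alpha>) = \<alpha>" using circle.prob_space by simp
  also have "(LINT w|circle_haar. 1) = (1::real)" using circle.prob_space by simp
  finally show ?thesis by simp
qed

text \<open>The \<delta> of the overview. For z = F_(k-1) and h the k-th section it is the
  conditional mean of |F_k| - |F_(k-1)|, which telescopes in expectation.\<close>

definition gain :: "complex \<Rightarrow> (complex \<Rightarrow> complex) \<Rightarrow> real" where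
  "gain z h = (LINT w|circle_haar. cmod (z + h w)) - cmod z"

lemma integrable_sqrt_gain:
  assumes "integrable circle_haar h"
  shows "integrable circle_haar (\<lambda>w. sqrt ((cmod z)\<^sup>2 + (\<alpha> * cmod (h w))\<^sup>2) - cmod z)"
proof (rule Bochner_Integration.integrable_bound)
  show "integrable circle_haar (\<lambda>w. \<alpha> * cmod (h w))" using assms by auto
  show "AE w in circle_haar. norm (sqrt ((cmod z)\<^sup>2 + (\<alpha> * cmod (h w))\<^sup>2) - cmod z) \<le> norm (\<alpha> * cmod (h w))"
  proof (rule AE_I2)
    fix w
    have "sqrt ((cmod z)\<^sup>2 + (\<alpha> * cmod (h w))\<^sup>2) \<le> cmod z + \<alpha> * cmod (h w)"
      using pos by (intro sqrt_sum_squares_le_sum) auto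
    moreover have "cmod z \<le> sqrt ((cmod z)\<^sup>2 + (\<alpha> * cmod (h w))\<^sup>2)" by (intro real_le_rsqrt) auto
    ultimately show "norm (sqrt ((cmod z)\<^sup>2 + (\<alpha> * cmod (h w))\<^sup>2) - cmod z) \<le> norm (\<alpha> * cmod (h w))"
      using pos by simp
  qed
qed (use borel_measurable_integrable[OF assms] in measurable)

lemma sqrt_gain_le_gain:
  assumes "h \<in> hardy_H1_0"
  shows "(LINT w|circle_haar. sqrt ((cmod z)\<^sup>2 + (\<alpha> * cmod (h w))\<^sup>2) - cmod z) \<le> gain z h"
proof -
  note i = integrable_sqrt_gain[OF hardy_H1_0D(1)[OF assms], of z]
  have "(LINT w|circle_haar. sqrt ((cmod z)\<^sup>2 + (\<alpha> * cmod (h w))\<^sup>2) - cmod z)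
     = (LINT w|circle_haar. (sqrt ((cmod z)\<^sup>2 + (\<alpha> * cmod (h w))\<^sup>2) - cmod z) + cmod z) - cmod z"
    using i circle.prob_space by (subst Bochner_Integration.integral_add) auto
  then show ?thesis using convexity[OF assms, of z] by (simp add: gain_def power_mult_distrib)
qed

lemma gain_nonneg:
  assumes "h \<in> hardy_H1_0"
  shows "0 \<le> gain z h"
proof -
  have "0 \<le> (LINT w|circle_haar. sqrt ((cmod z)\<^sup>2 + (\<alpha> * cmod (h w))\<^sup>2) - cmod z)"
    by (intro Bochner_Integration.integral_nonneg) (auto intro: real_le_rsqrt)
  then show ?thesis using sqrt_gain_le_gain[OF assms, of z] by linarith
qed

section \<open>Estimates for the damped function at nonzero z\<close>

context
  fixes h :: "complex \<Rightarrow> complex" and z :: complex and r :: real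
  assumes h: "h \<in> hardy_H1_0" and z: "z \<noteq> 0" and r: "0 \<le> r" "r < 1"
begin

abbreviation "cutoff \<equiv> 4 * cmod z / \<alpha>"
abbreviation "damping \<equiv> (\<lambda>x. 1 / (1 + herglotz (excess cutoff h) x))"
abbreviation "dilation \<equiv> (\<lambda>w. harmonic_extension h (of_real r * w))"

lemma damped_eq: "damped \<alpha> r z h = (\<lambda>w. dilation w * damping (of_real r * w))"
  using z by (auto simp: damped_def fun_eq_iff)

lemma cutoff_pos: "cutoff > 0" using z pos by simp

lemma dilated: "cmod w = 1 \<Longrightarrow> cmod (of_real r * w) < 1"
  using r by (simp add: norm_mult)

lemma excess_integrable: "integrable circle_haar (excess cutoff h)"
  by (rule integrable_excess[OF hardy_H1_0D(1)[OF h]])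

lemma excess_nonneg: "0 \<le> excess cutoff h w"
  by (simp add: excess_def)

lemma damping_holomorphic: "damping holomorphic_on ball 0 1"
  using herglotz_resolvent(1)[OF excess_integrable excess_nonneg zero_less_one] by simp

lemma norm_damping: "cmod x < 1 \<Longrightarrow> cmod (damping x) \<le> 1 / (1 + poisson_ext (excess cutoff h) x)"
  using herglotz_resolvent(2)[OF excess_integrable excess_nonneg zero_less_one, of x] by simp

lemma norm_damping_le_1:
  assumes "cmod x < 1" shows "cmod (damping x) \<le> 1"
proof -
  have "0 \<le> poisson_ext (excess cutoff h) x" by (rule poisson_ext_nonneg[OF assms excess_nonneg])
  then have "1 / (1 + poisson_ext (excess cutoff h) x) \<le> 1" by simp
  then show ?thesis using norm_damping[OF assms] by linarith
qed

lemma damped_hardy_nz: "damped \<alpha> r z h \<in> hardy_H1_0"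
proof -
  have "(\<lambda>w. harmonic_extension h (of_real r * w) * damping (of_real r * w)) \<in> hardy_H1_0"
    by (rule hardy_H1_0_dilate[where k="\<lambda>x. harmonic_extension h x * damping x"])
       (use r hardy_H1_0D[OF h] in \<open>auto intro!: holomorphic_on_mult[OF _ damping_holomorphic, simplified]\<close>)
  then show ?thesis by (simp add: damped_eq)
qed

text \<open>From |h| \<le> M + M u on the circle, the extension of h is at most M (1 + P u), where P
  u is the Poisson extension of u; this is exactly M times the lower bound for the denominator of
  the damping factor.\<close>

lemma norm_damped_nz:
  assumes w: "cmod w = 1"
  shows "cmod (damped \<alpha> r z h w) \<le> cutoff"
proof -
  let ?x = "of_real r * w"
  have x: "cmod ?x < 1" by (rule dilated[OF w])
  have P0: "0 \<le> poisson_ext (excess cutoff h) ?x" by (rule poisson_ext_nonneg[OF x excess_nonneg])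
  have i: "integrable circle_haar (\<lambda>w. cutoff + cutoff * excess cutoff h w)" using excess_integrable by auto
  have "cmod (harmonic_extension h ?x) \<le> poisson_ext (\<lambda>w. cmod (h w)) ?x"
    by (rule norm_harmonic_extension_le[OF x])
  also have "\<dots> \<le> poisson_ext (\<lambda>w. cutoff + cutoff * excess cutoff h w) ?x"
  proof (rule poisson_ext_mono[OF x _ i])
    fix w
    have "cutoff * (cmod (h w) / cutoff - 1) \<le> cutoff * excess cutoff h w"
      using cutoff_pos by (intro mult_left_mono) (auto simp: excess_def)
    moreover have "cutoff * (cmod (h w) / cutoff - 1) = cmod (h w) - cutoff"
      using z pos by (simp only: right_diff_distrib) simp
    ultimately show "cmod (h w) \<le> cutoff + cutoff * excess cutoff h w" by linarith
  qed (use hardy_H1_0D(1)[OF h] in auto)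
  also have "\<dots> = (LINT y|circle_haar. cutoff * poisson ?x y + cutoff * (poisson ?x y * excess cutoff h y))"
    unfolding poisson_ext_def by (rule Bochner_Integration.integral_cong) (auto simp: algebra_simps)
  also have "\<dots> = (LINT y|circle_haar. cutoff * poisson ?x y)
      + (LINT y|circle_haar. cutoff * (poisson ?x y * excess cutoff h y))"
    by (intro Bochner_Integration.integral_add integrable_mult_right integrable_poisson_mult[OF x]
        excess_integrable integrable_circle_haar_continuous[OF continuous_on_poisson[OF x]])
  also have "\<dots> = cutoff * (LINT y|circle_haar. poisson ?x y) + cutoff * poisson_ext (excess cutoff h) ?x"
    unfolding poisson_ext_def by (simp only: integral_mult_right_zero)
  also have "\<dots> = cutoff * (1 + poisson_ext (excess cutoff h) ?x)"
    using integral_poisson[OF x] by (simp add: algebra_simps)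
  finally have "cmod (harmonic_extension h ?x) \<le> cutoff * (1 + poisson_ext (excess cutoff h) ?x)" .
  then have "cmod (harmonic_extension h ?x) * cmod (damping ?x) \<le> cutoff * (1
      + poisson_ext (excess cutoff h) ?x) * (1 / (1 + poisson_ext (excess cutoff h) ?x))"
    using norm_damping[OF x] less_imp_le[OF cutoff_pos] P0
    by (intro mult_mono mult_nonneg_nonneg[of cutoff] add_nonneg_nonneg) auto
  also have "\<dots> = cutoff" using P0 by (simp add: divide_simps)
  finally show ?thesis by (simp only: damped_eq norm_mult)
qed

lemma dilation_hardy: "dilation \<in> hardy_H1_0"
  by (rule hardy_H1_0_dilate) (use hardy_H1_0D[OF h] r in auto)

text \<open>Constants are their own extension, so the contraction applies to z + h. Pointwise
  estimates can thus be made for the dilated function and still end in the gain of h itself.\<close>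

lemma gain_dilate: "gain z dilation \<le> gain z h"
proof -
  have i: "integrable circle_haar (\<lambda>w. z + h w)" using hardy_H1_0D(1)[OF h] by auto
  have "(LINT w|circle_haar. cmod (z + dilation w)) = (LINT w|circle_haar. cmod (harmonic_extension (\<lambda>w. z
      + h w) (of_real r * w)))"
    by (rule Bochner_Integration.integral_cong)
       (use hardy_H1_0D(1)[OF h] dilated in \<open>auto simp: harmonic_extension_add harmonic_extension_const\<close>)
  also have "\<dots> \<le> (LINT w|circle_haar. cmod (z + h w))"
    by (rule harmonic_extension_contraction(2)[OF i r])
  finally show ?thesis by (simp add: gain_def)
qed

lemma continuous_on_dilation: "continuous_on (sphere 0 1) dilation"
  by (rule continuous_on_dilate[OF hardy_H1_0D(2)[OF h] r])

lemma continuous_on_damping: "continuous_on (sphere 0 1) (\<lambda>w. damping (of_real r * w))"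
  by (rule continuous_on_dilate[OF damping_holomorphic r])

text \<open>The bound |a| \<le> 1 and the cutoff together give \<alpha> |g| \<le> min (\<alpha>
  |h_r|) (4 |z|), to which \<open>sqrt_gain_min\<close> applies pointwise.\<close>

lemma integral_square_damped_nz:
  "\<alpha>\<^sup>2 * (LINT w|circle_haar. (cmod (damped \<alpha> r z h w))\<^sup>2) \<le> 6 * cmod z * gain z h"
proof -
  have "\<alpha>\<^sup>2 * (LINT w|circle_haar. (cmod (damped \<alpha> r z h w))\<^sup>2)
      = (LINT w|circle_haar. (\<alpha> * cmod (damped \<alpha> r z h w))\<^sup>2)"
    by (simp add: power_mult_distrib)
  also have "\<dots> \<le> (LINT w|circle_haar. 6 * cmod z * (sqrt ((cmod z)\<^sup>2 + (\<alpha> * cmod (dilation w))\<^sup>2) - cmod z))"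
  proof (rule integral_mono)
    show "integrable circle_haar (\<lambda>w. (\<alpha> * cmod (damped \<alpha> r z h w))\<^sup>2)"
      unfolding damped_eq
      by (intro integrable_circle_haar_continuous continuous_intros continuous_on_dilation continuous_on_damping)
    show "integrable circle_haar (\<lambda>w. 6 * cmod z * (sqrt ((cmod z)\<^sup>2 + (\<alpha> * cmod (dilation w))\<^sup>2) - cmod z))"
      by (intro integrable_mult_right integrable_sqrt_gain hardy_H1_0D(1)[OF dilation_hardy])
    fix w assume "w \<in> space circle_haar"
    then have w: "cmod w = 1" by simp
    have "cmod (damped \<alpha> r z h w) \<le> cmod (dilation w) * 1"
      unfolding damped_eq norm_mult using norm_damping_le_1[OF dilated[OF w]] by (intro mult_left_mono) auto
    then have "\<alpha> * cmod (damped \<alpha> r z h w) \<le> \<alpha> * cmod (dilation w)"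
      using pos by simp
    moreover have "\<alpha> * cmod (damped \<alpha> r z h w) \<le> 4 * cmod z"
      using norm_damped_nz[OF w] pos by (simp add: field_simps)
    ultimately have "(\<alpha> * cmod (damped \<alpha> r z h w))\<^sup>2 \<le> (min (\<alpha> * cmod (dilation w)) (4 * cmod z))\<^sup>2"
      using pos by (intro power_mono) auto
    also have "\<dots> \<le> 6 * cmod z * (sqrt ((cmod z)\<^sup>2 + (\<alpha> * cmod (dilation w))\<^sup>2) - cmod z)"
      using z pos by (intro sqrt_gain_min) auto
    finally show "(\<alpha> * cmod (damped \<alpha> r z h w))\<^sup>2 \<le> 6 * cmod z * (sqrt ((cmod z)\<^sup>2
        + (\<alpha> * cmod (dilation w))\<^sup>2) - cmod z)" .
  qed
  also have "\<dots> = 6 * cmod z * (LINT w|circle_haar. sqrt ((cmod z)\<^sup>2 + (\<alpha> * cmod (dilation w))\<^sup>2) - cmod z)"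
    by (rule integral_mult_right_zero)
  also have "\<dots> \<le> 6 * cmod z * gain z h"
    using sqrt_gain_le_gain[OF dilation_hardy, of z] gain_dilate by (intro mult_left_mono) auto
  finally show ?thesis .
qed

lemma integral_one_minus_damping:
  "(LINT w|circle_haar. (cmod (1 - damping (of_real r * w)))\<^sup>2) \<le> gain z h / (2 * cmod z)"
proof -
  define U where "U = (LINT w|circle_haar. excess cutoff h w)"
  have U0: "0 \<le> U" unfolding U_def by (intro Bochner_Integration.integral_nonneg excess_nonneg)
  have ia: "integrable circle_haar (\<lambda>w. damping (of_real r * w))"
    by (intro integrable_circle_haar_continuous continuous_on_damping)
  have "(LINT w|circle_haar. (cmod (1 - damping (of_real r * w)))\<^sup>2)
      \<le> (LINT w|circle_haar. 2 - 2 * Re (damping (of_real r * w)))"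
  proof (rule integral_mono)
    show "integrable circle_haar (\<lambda>w. (cmod (1 - damping (of_real r * w)))\<^sup>2)"
      by (intro integrable_circle_haar_continuous continuous_intros continuous_on_damping)
    show "integrable circle_haar (\<lambda>w. 2 - 2 * Re (damping (of_real r * w)))"
      by (intro integrable_circle_haar_continuous continuous_intros continuous_on_damping)
    fix w assume "w \<in> space circle_haar"
    then have "cmod (damping (of_real r * w)) \<le> 1" using norm_damping_le_1 dilated by auto
    then have "(cmod (damping (of_real r * w)))\<^sup>2 \<le> 1" by (simp add: power_le_one_iff)
    moreover have "(cmod (1 - b))\<^sup>2 = 1 - 2 * Re b + (cmod b)\<^sup>2" for b
      by (simp only: cmod_power2) (simp add: power2_diff)
    ultimately show "(cmod (1 - damping (of_real r * w)))\<^sup>2 \<le> 2 - 2 * Re (damping (of_real r * w))" by simp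
  qed
  also have "\<dots> = 2 - 2 * Re (LINT w|circle_haar. damping (of_real r * w))"
    using integral_Re[OF ia] integrable_Re[OF ia] circle.prob_space by simp
  \<comment> \<open>The mean is the value at the centre, whatever the radius, so the resulting bound
    does not degrade as r tends to 1.\<close>
  also have "(LINT w|circle_haar. damping (of_real r * w)) = damping 0"
    using mean_value_circle_haar[OF dilate_holomorphic[OF damping_holomorphic r]] by simp
  also have "damping 0 = of_real (1 / (1 + U))" by (simp add: herglotz_0 U_def)
  also have "2 - 2 * Re (of_real (1 / (1 + U))) \<le> 2 * U"
    using U0 by (simp add: field_simps)
  also have "U \<le> (LINT w|circle_haar. (sqrt ((cmod z)\<^sup>2 + (\<alpha> * cmod (h w))\<^sup>2) - cmod z) / (4 * cmod z))"
    unfolding U_def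
  proof (rule integral_mono[OF excess_integrable])
    show "integrable circle_haar (\<lambda>w. (sqrt ((cmod z)\<^sup>2 + (\<alpha> * cmod (h w))\<^sup>2) - cmod z) / (4 * cmod z))"
      by (intro Bochner_Integration.integrable_divide integrable_sqrt_gain hardy_H1_0D(1)[OF h])
    fix w
    show "excess cutoff h w \<le> (sqrt ((cmod z)\<^sup>2 + (\<alpha> * cmod (h w))\<^sup>2) - cmod z) / (4 * cmod z)"
      using sqrt_gain_excess[of "cmod z" "\<alpha> * cmod (h w)"] z pos by (simp add: excess_def mult.commute)
  qed
  also have "\<dots> = (LINT w|circle_haar. sqrt ((cmod z)\<^sup>2 + (\<alpha> * cmod (h w))\<^sup>2) - cmod z) / (4 * cmod z)"
    by (rule integral_divide_zero)
  also have "\<dots> \<le> gain z h / (4 * cmod z)"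
    using sqrt_gain_le_gain[OF h, of z] by (intro divide_right_mono) auto
  finally show ?thesis by simp
qed

text \<open>The difference is h_r (1 - a), and \<open>sqrt_gain_mult\<close> splits this product
  into a part paid by the convexity inequality and a multiple of |1 - a|^2.\<close>

lemma integral_dilate_minus_damped:
  "\<alpha> * (LINT w|circle_haar. cmod (dilation w - damped \<alpha> r z h w)) \<le> 4 * gain z h"
proof -
  let ?b = "\<lambda>w. cmod (1 - damping (of_real r * w))"
  let ?G = "\<lambda>w. sqrt ((cmod z)\<^sup>2 + (\<alpha> * cmod (dilation w))\<^sup>2) - cmod z"
  have iG: "integrable circle_haar ?G"
    by (intro integrable_sqrt_gain hardy_H1_0D(1)[OF dilation_hardy])
  have ib: "integrable circle_haar (\<lambda>w. (?b w)\<^sup>2)"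
    by (intro integrable_circle_haar_continuous continuous_intros continuous_on_damping)
  have "\<alpha> * (LINT w|circle_haar. cmod (dilation w - damped \<alpha> r z h w))
      = (LINT w|circle_haar. \<alpha> * cmod (dilation w) * ?b w)"
    unfolding damped_eq by (simp add: norm_mult[symmetric] algebra_simps)
  also have "\<dots> \<le> (LINT w|circle_haar. 3 * ?G w + cmod z * (?b w)\<^sup>2 / 2)"
  proof (rule integral_mono)
    show "integrable circle_haar (\<lambda>w. \<alpha> * cmod (dilation w) * ?b w)"
      by (intro integrable_circle_haar_continuous continuous_intros continuous_on_damping continuous_on_dilation)
    show "integrable circle_haar (\<lambda>w. 3 * ?G w + cmod z * (?b w)\<^sup>2 / 2)"
      by (intro Bochner_Integration.integrable_add integrable_mult_right Bochner_Integration.integrable_divide iG ib)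
    fix w assume "w \<in> space circle_haar"
    then have "cmod (damping (of_real r * w)) \<le> 1" using norm_damping_le_1 dilated by auto
    then have "?b w \<le> 2" using norm_triangle_ineq4[of 1 "damping (of_real r * w)"] by simp
    then show "\<alpha> * cmod (dilation w) * ?b w \<le> 3 * ?G w + cmod z * (?b w)\<^sup>2 / 2"
      using z pos by (intro sqrt_gain_mult) auto
  qed
  also have "\<dots> = (LINT w|circle_haar. 3 * ?G w) + (LINT w|circle_haar. cmod z * (?b w)\<^sup>2 / 2)"
    by (intro Bochner_Integration.integral_add integrable_mult_right Bochner_Integration.integrable_divide iG ib)
  also have "\<dots> = 3 * (LINT w|circle_haar. ?G w) + cmod z * (LINT w|circle_haar. (?b w)\<^sup>2) / 2"
    by (simp only: integral_mult_right_zero integral_divide_zero)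
  \<comment> \<open>The total is 3 + 1/4 times the gain, rounded up to 4.\<close>
  also have "\<dots> \<le> 3 * gain z h + cmod z * (gain z h / (2 * cmod z)) / 2"
    using integral_one_minus_damping sqrt_gain_le_gain[OF dilation_hardy, of z] gain_dilate
    by (intro add_mono mult_left_mono divide_right_mono) auto
  also have "\<dots> \<le> 4 * gain z h" using z gain_nonneg[OF h, of z] by simp
  finally show ?thesis .
qed

end

lemma damped_hardy:
  assumes "h \<in> hardy_H1_0" "0 \<le> r" "r < 1"
  shows "damped \<alpha> r z h \<in> hardy_H1_0"
  using damped_hardy_nz[OF assms(1) _ assms(2,3)] by (cases "z = 0") (auto simp: hardy_H1_0_zero)

lemma norm_damped:
  assumes "h \<in> hardy_H1_0" "0 \<le> r" "r < 1" "cmod w = 1"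
  shows "cmod (damped \<alpha> r z h w) \<le> 4 * cmod z / \<alpha>"
  using norm_damped_nz[OF assms(1) _ assms(2,3,4)] by (cases "z = 0") auto

lemma integral_square_damped:
  assumes "h \<in> hardy_H1_0" "0 \<le> r" "r < 1"
  shows "\<alpha>\<^sup>2 * (LINT w|circle_haar. (cmod (damped \<alpha> r z h w))\<^sup>2) \<le> 6 * cmod z * gain z h"
  using integral_square_damped_nz[OF assms(1) _ assms(2,3)] by (cases "z = 0") auto

lemma integral_minus_damped:
  assumes h: "h \<in> hardy_H1_0" and r: "0 \<le> r" "r < 1"
  shows "\<alpha> * (LINT w|circle_haar. cmod (h w - damped \<alpha> r z h w))
     \<le> \<alpha> * (LINT w|circle_haar. cmod (h w - harmonic_extension h (of_real r * w))) + 4 * gain z h"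
proof (cases "z = 0")
  \<comment> \<open>Here the damped function is 0 and the gain is the mean of |h|, so the claim
    reduces to \<alpha> \<le> 4.\<close>
  case True
  have "\<alpha> * gain z h \<le> 4 * gain z h"
    using le_1 gain_nonneg[OF h] by (intro mult_right_mono) auto
  moreover have "0 \<le> \<alpha> * (LINT w|circle_haar. cmod (h w - harmonic_extension h (of_real r * w)))"
    using pos by auto
  ultimately show ?thesis using True by (simp add: gain_def)
next
  case False
  have H: "integrable circle_haar (\<lambda>w. harmonic_extension h (of_real r * w))"
    by (rule harmonic_extension_contraction(1)[OF hardy_H1_0D(1)[OF h] r])
  have "(LINT w|circle_haar. cmod (h w - damped \<alpha> r z h w)) =
     (LINT w|circle_haar. cmod ((h w - harmonic_extension h (of_real r * w))
         + (harmonic_extension h (of_real r * w) - damped \<alpha> r z h w) + 0))"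
    by simp
  also have "\<dots> \<le> (LINT w|circle_haar. cmod (h w - harmonic_extension h (of_real r * w)))
    + (LINT w|circle_haar. cmod (harmonic_extension h (of_real r * w) - damped \<alpha> r z h w))
        + (LINT w|circle_haar. cmod 0)"
    by (intro integral_norm_triangle3 Bochner_Integration.integrable_diff H hardy_H1_0D(1)[OF h] hardy_H1_0D(1)[OF damped_hardy] h r) auto
  finally have "(LINT w|circle_haar. cmod (h w - damped \<alpha> r z h w))
     \<le> (LINT w|circle_haar. cmod (h w - harmonic_extension h (of_real r * w)))
    + (LINT w|circle_haar. cmod (harmonic_extension h (of_real r * w) - damped \<alpha> r z h w))" by simp
  then have "\<alpha> * (LINT w|circle_haar. cmod (h w - damped \<alpha> r z h w))
     \<le> \<alpha> * ((LINT w|circle_haar. cmod (h w - harmonic_extension h (of_real r * w)))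
    + (LINT w|circle_haar. cmod (harmonic_extension h (of_real r * w) - damped \<alpha> r z h w)))"
    using pos by (intro mult_left_mono) auto
  then show ?thesis using integral_dilate_minus_damped[OF h False r] by (simp add: ring_distribs)
qed

end

section \<open>Resampling one coordinate of the torus\<close>

interpretation torus: prob_space torus
  unfolding torus_def by (intro prob_space_PiM prob_space_circle_haar)

interpretation torus_circle: pair_prob_space torus circle_haar ..

lemma space_torus: "space torus = PiE {1..} (\<lambda>_. sphere 0 1)"
  by (simp add: torus_def space_PiM)

lemma update_in_space_torus:
  "x \<in> space torus \<Longrightarrow> y \<in> sphere 0 1 \<Longrightarrow> 1 \<le> k \<Longrightarrow> x(k := y) \<in> space torus"
  by (auto simp: space_torus PiE_iff extensional_def)

lemma measurable_update [measurable]: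
  assumes "1 \<le> k"
  shows "(\<lambda>(x, y). x(k := y)) \<in> measurable (torus \<Otimes>\<^sub>M circle_haar) torus"
proof -
  have "insert k {1..} = {1..}" using assms by auto
  then show ?thesis
    using measurable_add_dim[of k "{1..}" "\<lambda>_. circle_haar"] by (simp add: torus_def)
qed

lemma measurable_update_section:
  assumes "1 \<le> k" "x \<in> space torus"
  shows "(\<lambda>y. x(k := y)) \<in> measurable circle_haar torus"
  using measurable_compose[OF measurable_Pair1'[OF assms(2)] measurable_update[OF assms(1)]] by simp

text \<open>Overwriting a coordinate by an independent uniform point preserves product measure; k
  \<ge> 1 because coordinates are numbered from 1. The factors are swapped to match the form in
  which the new coordinate comes first.\<close>

lemma distr_update:
  assumes "1 \<le> k"
  shows "distr (torus \<Otimes>\<^sub>M circle_haar) torus (\<lambda>(x, y). x(k := y)) = torus"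
proof -
  interpret ct: pair_prob_space circle_haar torus ..
  have i: "insert k {1..} = {1..}" using assms by auto
  have m: "(\<lambda>(x, y). x(k := y)) \<in> measurable (torus \<Otimes>\<^sub>M circle_haar) torus"
    by (rule measurable_update[OF assms])
  have "distr (torus \<Otimes>\<^sub>M circle_haar) torus (\<lambda>(x, y). x(k := y)) =
     distr (distr (circle_haar \<Otimes>\<^sub>M torus) (torus \<Otimes>\<^sub>M circle_haar) (\<lambda>(x, y). (y, x))) torus (\<lambda>(x, y). x(k := y))"
    using torus_circle.distr_pair_swap by simp
  also have "\<dots> = distr (circle_haar \<Otimes>\<^sub>M torus) torus (\<lambda>(y, x). x(k := y))"
    by (subst distr_distr[OF m]) (auto simp: comp_def case_prod_beta')
  also have "\<dots> = torus"
    using distr_pair_PiM_eq_PiM[of "{1..}" "\<lambda>_. circle_haar" k] i prob_space_circle_haar by (simp add: torus_def)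
  finally show ?thesis .
qed

lemma nn_integral_resample:
  assumes k: "1 \<le> k" and [measurable]: "f \<in> borel_measurable torus"
  shows "(\<integral>\<^sup>+ x. f x \<partial>torus) = (\<integral>\<^sup>+ x. (\<integral>\<^sup>+ y. f (x(k := y)) \<partial>circle_haar) \<partial>torus)"
proof -
  note m = measurable_update[OF k]
  have "(\<integral>\<^sup>+ x. f x \<partial>torus) = (\<integral>\<^sup>+ x. f x \<partial>distr (torus \<Otimes>\<^sub>M circle_haar) torus (\<lambda>(x, y). x(k := y)))"
    by (simp add: distr_update[OF k])
  also have "\<dots> = (\<integral>\<^sup>+ p. f (case p of (x, y) \<Rightarrow> x(k := y)) \<partial>(torus \<Otimes>\<^sub>M circle_haar))"
    by (rule nn_integral_distr[OF m]) simp
  also have "\<dots> = (\<integral>\<^sup>+ x. (\<integral>\<^sup>+ y. f (x(k := y)) \<partial>circle_haar) \<partial>torus)"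
    using circle.nn_integral_fst[of "\<lambda>p. f (case p of (x, y) \<Rightarrow> x(k := y))" torus] measurable_compose[OF m, of f]
        by simp
  finally show ?thesis .
qed

context
  fixes f :: "(nat \<Rightarrow> complex) \<Rightarrow> 'b::{banach, second_countable_topology}" and k :: nat
  assumes k: "1 \<le> k" and f: "integrable torus f"
begin

lemma integrable_update: "integrable (torus \<Otimes>\<^sub>M circle_haar) (\<lambda>(x, y). f (x(k := y)))"
proof -
  have "integrable (distr (torus \<Otimes>\<^sub>M circle_haar) torus (\<lambda>(x, y). x(k := y))) f"
    using f by (simp add: distr_update[OF k])
  from integrable_distr[OF measurable_update[OF k] this] show ?thesis by (simp add: case_prod_beta')
qed

lemma AE_integrable_resample: "AE x in torus. integrable circle_haar (\<lambda>y. f (x(k := y)))"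
  using torus_circle.AE_integrable_fst'[OF integrable_update] by simp

lemma integrable_resample: "integrable torus (\<lambda>x. LINT y|circle_haar. f (x(k := y)))"
  using torus_circle.integrable_fst'[OF integrable_update] by simp

lemma integral_resample: "(LINT x|torus. f x) = (LINT x|torus. LINT y|circle_haar. f (x(k := y)))"
proof -
  have "(LINT x|torus. f x) = (LINT x|distr (torus \<Otimes>\<^sub>M circle_haar) torus (\<lambda>(x, y). x(k := y)). f x)"
    by (simp add: distr_update[OF k])
  also have "\<dots> = (LINT p|(torus \<Otimes>\<^sub>M circle_haar). f (case p of (x, y) \<Rightarrow> x(k := y)))"
    by (rule integral_distr[OF measurable_update[OF k]]) (use f in auto)
  also have "\<dots> = (LINT x|torus. LINT y|circle_haar. f (x(k := y)))"
    using torus_circle.integral_fst'[OF integrable_update] by (simp add: case_prod_beta')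
  finally show ?thesis .
qed

end

text \<open>Equality is required at every pair of points, not almost everywhere, so that sections
  can be compared without exceptional sets.\<close>

definition depends_upto :: "nat \<Rightarrow> ((nat \<Rightarrow> complex) \<Rightarrow> 'b) \<Rightarrow> bool" where
  "depends_upto k f \<longleftrightarrow>
     (\<forall>x\<in>space torus. \<forall>y\<in>space torus. (\<forall>i\<in>{1..k}. x i = y i) \<longrightarrow> f x = f y)"

lemma depends_uptoD:
  "depends_upto k f \<Longrightarrow> x \<in> space torus \<Longrightarrow> y \<in> space torus \<Longrightarrow> (\<And>i. 1 \<le> i \<Longrightarrow> i \<le> k \<Longrightarrow> x i = y i) \<Longrightarrow> f x = f y"
  unfolding depends_upto_def by (meson atLeastAtMost_iff)

lemma depends_upto_mono: "depends_upto j f \<Longrightarrow> j \<le> k \<Longrightarrow> depends_upto k f"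
  unfolding depends_upto_def by (meson atLeastAtMost_iff order_trans)

lemma depends_upto_update:
  "depends_upto j f \<Longrightarrow> j < k \<Longrightarrow> x \<in> space torus \<Longrightarrow> y \<in> sphere 0 1 \<Longrightarrow> f (x(k := y)) = f x"
  by (rule depends_uptoD[OF _ update_in_space_torus]) auto

lemma space_coord_filtration [simp]: "space (coord_filtration k) = space torus"
  by (simp add: coord_filtration_def)

lemma restrict_measurable_torus:
  "(\<lambda>x. restrict x {1..k}) \<in> measurable torus (Pi\<^sub>M {1..k} (\<lambda>_. circle_haar))"
  unfolding torus_def by (rule measurable_restrict_subset) auto

lemma subalgebra_coord_filtration: "subalgebra torus (coord_filtration k)"
  unfolding subalgebra_def
proof
  show "sets (coord_filtration k) \<subseteq> sets torus"
    unfolding coord_filtration_def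
    by (subst sets_vimage_algebra2)
       (use measurable_sets[OF restrict_measurable_torus] measurable_space[OF restrict_measurable_torus] in auto)
qed simp

lemma sigma_finite_subalgebra_coord_filtration: "sigma_finite_subalgebra torus (coord_filtration k)"
proof -
  interpret finite_measure_subalgebra torus "coord_filtration k"
    by unfold_locales (rule subalgebra_coord_filtration)
  show ?thesis by unfold_locales
qed

text \<open>Forwards, each fibre of f is the preimage of a set under restriction to the first k
  coordinates. Backwards, f factors measurably through that restriction.\<close>

lemma measurable_coord_filtration_iff:
  fixes f :: "(nat \<Rightarrow> complex) \<Rightarrow> 'b::t2_space"
  shows "f \<in> borel_measurable (coord_filtration k) \<longleftrightarrow> f \<in> borel_measurable torus \<and> depends_upto k f"
proof safe
  assume f: "f \<in> borel_measurable (coord_filtration k)"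
  then show "f \<in> borel_measurable torus"
    by (rule measurable_from_subalg[OF subalgebra_coord_filtration])
  show "depends_upto k f"
    unfolding depends_upto_def
  proof (intro ballI impI)
    fix x y assume x: "x \<in> space torus" and y: "y \<in> space torus" and xy: "\<forall>i\<in>{1..k}. x i = y i"
    have "f -` {f x} \<inter> space (coord_filtration k) \<in> sets (coord_filtration k)"
      using f by (rule measurable_sets) auto
    then obtain A where A: "f -` {f x} \<inter> space torus = (\<lambda>x. restrict x {1..k}) -` A \<inter> space torus"
      unfolding coord_filtration_def
      by (subst (asm) sets_vimage_algebra2)
         (use measurable_space[OF restrict_measurable_torus] in auto)
    have "restrict x {1..k} = restrict y {1..k}" using xy by (auto simp: restrict_def)
    moreover have "x \<in> (\<lambda>x. restrict x {1..k}) -` A \<inter> space torus" using A x by blast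
    ultimately have "y \<in> (\<lambda>x. restrict x {1..k}) -` A \<inter> space torus" using y by simp
    then show "f x = f y" unfolding A[symmetric] by simp
  qed
next
  assume f: "f \<in> borel_measurable torus" and d: "depends_upto k f"
  \<comment> \<open>Fills the coordinates beyond k with the constant 1, a point of the circle, and
    so is a measurable right inverse of the restriction.\<close>
  define e :: "(nat \<Rightarrow> complex) \<Rightarrow> nat \<Rightarrow> complex" where
    "e p = (\<lambda>i\<in>{1..}. if i \<in> {1..k} then p i else 1)" for p
  have "(\<lambda>p. if i \<in> {1..k} then p i else 1) \<in> measurable (Pi\<^sub>M {1..k} (\<lambda>_. circle_haar)) circle_haar" for i
    by (cases "i \<in> {1..k}") (auto intro: measurable_component_singleton)
  then have e: "e \<in> measurable (Pi\<^sub>M {1..k} (\<lambda>_. circle_haar)) torus"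
    unfolding e_def[abs_def] torus_def by (intro measurable_restrict)
  have r: "(\<lambda>x. restrict x {1..k}) \<in> measurable (coord_filtration k) (Pi\<^sub>M {1..k} (\<lambda>_. circle_haar))"
    unfolding coord_filtration_def
    by (rule measurable_vimage_algebra1) (use measurable_space[OF restrict_measurable_torus] in auto)
  have "(\<lambda>x. f (e (restrict x {1..k}))) \<in> borel_measurable (coord_filtration k)"
    using measurable_compose[OF measurable_compose[OF r e] f] .
  moreover have "f (e (restrict x {1..k})) = f x" if x: "x \<in> space torus" for x
    by (rule depends_uptoD[OF d]) (use x in \<open>auto simp: e_def space_torus PiE_iff\<close>)
  ultimately show "f \<in> borel_measurable (coord_filtration k)"
    by (subst measurable_cong[of _ _ "\<lambda>x. f (e (restrict x {1..k}))"]) auto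
qed

lemma coord_filtration_set_update:
  assumes A: "A \<in> sets (coord_filtration (k - 1))" and k: "1 \<le> k"
    and x: "x \<in> space torus" and y: "y \<in> sphere 0 1"
  shows "x(k := y) \<in> A \<longleftrightarrow> x \<in> A"
proof -
  have "(indicator A :: _ \<Rightarrow> real) \<in> borel_measurable (coord_filtration (k - 1))" using A by simp
  then have "depends_upto (k - 1) (indicator A :: _ \<Rightarrow> real)"
    by (simp only: measurable_coord_filtration_iff)
  from depends_upto_update[OF this _ x y, of k] k show ?thesis
    by (auto simp: indicator_def split: if_splits)
qed

text \<open>L stands for any functional of the section. Since sections are functions on all complex
  numbers but agree on the circle only, they are made constant off it before L is applied.\<close>

lemma depends_upto_section:
  assumes "depends_upto k f" "1 \<le> k"
  shows "depends_upto (k - 1) (\<lambda>x. L (\<lambda>y. if y \<in> sphere 0 1 then f (x(k := y)) else c))"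
proof -
  have eq: "(\<lambda>y. if y \<in> sphere 0 1 then f (x(k := y)) else c) = (\<lambda>y. if y \<in> sphere 0 1 then f (x'(k := y)) else c)"
    if x: "x \<in> space torus" "x' \<in> space torus" "\<forall>i\<in>{1..k - 1}. x i = x' i" for x x'
  proof (rule ext)
    fix y
    have "f (x(k := y)) = f (x'(k := y))" if "y \<in> sphere 0 1"
      by (rule depends_uptoD[OF assms(1) update_in_space_torus[OF x(1) that assms(2)] update_in_space_torus[OF x(2) that assms(2)]])
         (use x(3) in auto)
    then show "(if y \<in> sphere 0 1 then f (x(k := y)) else c) = (if y \<in> sphere 0 1 then f (x'(k := y)) else c)"
        by simp
  qed
  show ?thesis unfolding depends_upto_def
    by (intro ballI impI arg_cong[where f=L]) (rule eq)
qed

lemma depends_upto_nn_integral: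
  assumes "depends_upto k f" "1 \<le> k"
  shows "depends_upto (k - 1) (\<lambda>x. \<integral>\<^sup>+ y. f (x(k := y)) \<partial>circle_haar)"
proof -
  have "(\<integral>\<^sup>+ y. f (x(k := y)) \<partial>circle_haar)
      = (\<integral>\<^sup>+ y. (if y \<in> sphere 0 1 then f (x(k := y)) else 0) \<partial>circle_haar)" for x
    by (rule nn_integral_cong) auto
  then show ?thesis using depends_upto_section[OF assms, of "\<lambda>g. \<integral>\<^sup>+ y. g y \<partial>circle_haar" 0] by simp
qed

lemma depends_upto_integral:
  fixes f :: "_ \<Rightarrow> 'b::{banach, second_countable_topology}"
  assumes "depends_upto k f" "1 \<le> k"
  shows "depends_upto (k - 1) (\<lambda>x. LINT y|circle_haar. f (x(k := y)))"
proof -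
  have "(LINT y|circle_haar. f (x(k := y)))
      = (LINT y|circle_haar. (if y \<in> sphere 0 1 then f (x(k := y)) else 0))" for x
    by (rule Bochner_Integration.integral_cong) auto
  then show ?thesis using depends_upto_section[OF assms, of "\<lambda>g. LINT y|circle_haar. g y" 0] by simp
qed

text \<open>For a function of the first k coordinates, conditioning on the first k - 1 means
  integrating out the k-th: sets of the smaller algebra are unaffected by overwriting it, so their
  indicators leave the inner integral.\<close>

lemma nn_cond_exp_resample:
  assumes k: "1 \<le> k" and f: "f \<in> borel_measurable torus" and d: "depends_upto k f"
  shows "AE x in torus. (\<integral>\<^sup>+ y. f (x(k := y)) \<partial>circle_haar) = nn_cond_exp torus (coord_filtration (k - 1)) f x"
proof -
  interpret S: sigma_finite_subalgebra torus "coord_filtration (k - 1)"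
    by (rule sigma_finite_subalgebra_coord_filtration)
  note [measurable] = f measurable_update[OF k]
  have gm: "(\<lambda>x. \<integral>\<^sup>+ y. f (x(k := y)) \<partial>circle_haar) \<in> borel_measurable torus"
    by (rule circle.borel_measurable_nn_integral)
        (use measurable_compose[OF measurable_update[OF k] f] in \<open>simp add: case_prod_beta'\<close>)
  show ?thesis
  proof (rule S.nn_cond_exp_charact[OF _ f])
    show "(\<lambda>x. \<integral>\<^sup>+ y. f (x(k := y)) \<partial>circle_haar) \<in> borel_measurable (coord_filtration (k - 1))"
      unfolding measurable_coord_filtration_iff using gm depends_upto_nn_integral[OF d k] by simp
    fix A assume A: "A \<in> sets (coord_filtration (k - 1))"
    then have At [measurable]: "A \<in> sets torus"
      using subalgebra_coord_filtration[of "k - 1"] by (auto simp: subalgebra_def)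
    have "(\<integral>\<^sup>+ x\<in>A. f x \<partial>torus) = (\<integral>\<^sup>+ x. (\<integral>\<^sup>+ y. f (x(k := y)) * indicator A (x(k := y)) \<partial>circle_haar) \<partial>torus)"
      by (rule nn_integral_resample[OF k]) measurable
    also have "\<dots> = (\<integral>\<^sup>+ x. (\<integral>\<^sup>+ y. f (x(k := y)) \<partial>circle_haar) * indicator A x \<partial>torus)"
    proof (rule nn_integral_cong)
      fix x assume x: "x \<in> space torus"
      have "(\<integral>\<^sup>+ y. f (x(k := y)) * indicator A (x(k := y)) \<partial>circle_haar)
          = (\<integral>\<^sup>+ y. f (x(k := y)) * indicator A x \<partial>circle_haar)"
        by (rule nn_integral_cong) (use coord_filtration_set_update[OF A k x] in \<open>auto simp: indicator_def\<close>)
      also have "\<dots> = (\<integral>\<^sup>+ y. f (x(k := y)) \<partial>circle_haar) * indicator A x"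
        by (rule nn_integral_multc) (use measurable_compose[OF measurable_update_section[OF k x] f] in simp)
      finally show "(\<integral>\<^sup>+ y. f (x(k := y)) * indicator A (x(k := y)) \<partial>circle_haar)
          = (\<integral>\<^sup>+ y. f (x(k := y)) \<partial>circle_haar) * indicator A x" .
    qed
    finally show "(\<integral>\<^sup>+ x\<in>A. f x \<partial>torus) = (\<integral>\<^sup>+ x\<in>A. (\<integral>\<^sup>+ y. f (x(k := y)) \<partial>circle_haar) \<partial>torus)" .
  qed
qed

lemma real_cond_exp_resample:
  fixes f :: "_ \<Rightarrow> real"
  assumes k: "1 \<le> k" and f: "integrable torus f" and d: "depends_upto k f"
  shows "AE x in torus. real_cond_exp torus (coord_filtration (k - 1)) f x = (LINT y|circle_haar. f (x(k := y)))"
proof -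
  interpret S: sigma_finite_subalgebra torus "coord_filtration (k - 1)"
    by (rule sigma_finite_subalgebra_coord_filtration)
  show ?thesis
  proof (rule S.real_cond_exp_charact[OF _ f integrable_resample[OF k f]])
    show "(\<lambda>x. LINT y|circle_haar. f (x(k := y))) \<in> borel_measurable (coord_filtration (k - 1))"
      unfolding measurable_coord_filtration_iff
      using integrable_resample[OF k f] depends_upto_integral[OF d k] by auto
    fix A assume A: "A \<in> sets (coord_filtration (k - 1))"
    then have At [measurable]: "A \<in> sets torus"
      using subalgebra_coord_filtration[of "k - 1"] by (auto simp: subalgebra_def)
    have "(LINT x:A|torus. f x) = (LINT x|torus. LINT y|circle_haar. indicator A (x(k := y)) *\<^sub>R f (x(k := y)))"
      unfolding set_lebesgue_integral_def
      by (rule integral_resample[OF k]) (use integrable_mult_indicator[OF At f] in simp)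
    also have "\<dots> = (LINT x|torus. indicator A x *\<^sub>R (LINT y|circle_haar. f (x(k := y))))"
    proof (rule Bochner_Integration.integral_cong)
      fix x assume x: "x \<in> space torus"
      have "(LINT y|circle_haar. indicator A (x(k := y)) *\<^sub>R f (x(k := y)))
          = (LINT y|circle_haar. indicator A x *\<^sub>R f (x(k := y)))"
        by (rule Bochner_Integration.integral_cong)
            (use coord_filtration_set_update[OF A k x] in \<open>auto simp: indicator_def\<close>)
      then show "(LINT y|circle_haar. indicator A (x(k := y)) *\<^sub>R f (x(k := y)))
          = indicator A x *\<^sub>R (LINT y|circle_haar. f (x(k := y)))"
        by simp
    qed simp
    finally show "(LINT x:A|torus. f x) = (LINT x:A|torus. LINT y|circle_haar. f (x(k := y)))"
      by (simp add: set_lebesgue_integral_def)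
  qed
qed

section \<open>Hardy martingales\<close>

lemma depends_upto_sum:
  "(\<And>j. j \<in> A \<Longrightarrow> depends_upto k (D j)) \<Longrightarrow> depends_upto k (\<lambda>x. \<Sum>j\<in>A. D j x)"
  unfolding depends_upto_def by (intro ballI impI sum.cong refl) blast

lemma depends_upto_compose: "depends_upto k f \<Longrightarrow> depends_upto k (\<lambda>x. g (f x))"
  unfolding depends_upto_def by metis

lemma depends_upto_compose2: "depends_upto k f \<Longrightarrow> depends_upto k f' \<Longrightarrow> depends_upto k (\<lambda>x. g (f x) (f' x))"
  unfolding depends_upto_def by metis

text \<open>The martingale property is automatic, since almost every section of D_k has mean 0.
  Constructing G and B thus becomes a matter of constructing their differences separately for each
  k.\<close>

lemma hardy_martingale_of_differences:
  assumes int: "\<And>k. k \<in> {1..n} \<Longrightarrow> integrable torus (D k)"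
    and dep: "\<And>k. k \<in> {1..n} \<Longrightarrow> depends_upto k (D k)"
    and hardy: "\<And>k. k \<in> {1..n} \<Longrightarrow> AE x in torus. (\<lambda>y. D k (x(k := y))) \<in> hardy_H1_0"
  shows "hardy_martingale n (\<lambda>k x. \<Sum>j=1..k. D j x)"
proof -
  let ?S = "\<lambda>k x. \<Sum>j=1..k. D j x"
  have md: "mart_diff ?S k = D k" if "1 \<le> k" for k
    using that by (cases k) (auto simp: mart_diff_def fun_eq_iff)
  have Sint: "integrable torus (?S k)" if "k \<le> n" for k
    using that int by (intro Bochner_Integration.integrable_sum) auto
  have Sdep: "depends_upto k (?S k)" if "k \<le> n" for k
    using that by (intro depends_upto_sum depends_upto_mono[OF dep]) auto
  have cond: "AE x in torus. complex_cond_exp torus (coord_filtration (k - 1)) (?S k) x = ?S (k - 1) x"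
    if k: "k \<in> {2..n}" for k
  proof -
    have k1: "1 \<le> k" "k \<in> {1..n}" "k \<le> n" using k by auto
    have "AE x in torus. real_cond_exp torus (coord_filtration (k - 1)) (\<lambda>x. Re (?S k x)) x
        = (LINT y|circle_haar. Re (?S k (x(k := y))))"
      by (rule real_cond_exp_resample[OF k1(1)]) (intro integrable_Re Sint depends_upto_compose[where g=Re, OF Sdep] k1)+
    moreover have "AE x in torus. real_cond_exp torus (coord_filtration (k - 1)) (\<lambda>x. Im (?S k x)) x
        = (LINT y|circle_haar. Im (?S k (x(k := y))))"
      by (rule real_cond_exp_resample[OF k1(1)]) (intro integrable_Im Sint depends_upto_compose[where g=Im, OF Sdep] k1)+
    ultimately show ?thesis using hardy[OF k1(2)] AE_space
    proof eventually_elim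
      case (elim x)
      note H = hardy_H1_0D[OF elim(3)]
      have eq: "?S k (x(k := y)) = ?S (k - 1) x + D k (x(k := y))" if "y \<in> space circle_haar" for y
      proof -
        have "?S k (x(k := y)) = ?S (k - 1) (x(k := y)) + D k (x(k := y))"
          using k1 by (cases k) auto
        moreover have "?S (k - 1) (x(k := y)) = ?S (k - 1) x"
          by (rule depends_upto_update[OF Sdep]) (use that elim k1 in auto)
        ultimately show ?thesis by simp
      qed
      have i: "integrable circle_haar (\<lambda>y. ?S (k - 1) x + D k (x(k := y)))" using H(1) by auto
      have "(LINT y|circle_haar. ?S (k - 1) x + D k (x(k := y))) = ?S (k - 1) x"
        using H(1,3) circle.prob_space by (subst Bochner_Integration.integral_add) auto
      then have "(LINT y|circle_haar. Re (?S (k - 1) x + D k (x(k := y)))) = Re (?S (k - 1) x)"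
          "(LINT y|circle_haar. Im (?S (k - 1) x + D k (x(k := y)))) = Im (?S (k - 1) x)"
        using integral_Re[OF i] integral_Im[OF i] by simp_all
      moreover have "(LINT y|circle_haar. Re (?S k (x(k := y)))) = (LINT y|circle_haar. Re (?S (k - 1) x
          + D k (x(k := y))))"
          "(LINT y|circle_haar. Im (?S k (x(k := y)))) = (LINT y|circle_haar. Im (?S (k - 1) x + D k (x(k := y))))"
        by (rule Bochner_Integration.integral_cong; use eq in simp)+
      ultimately show ?case using elim(1,2) by (simp add: complex_cond_exp_def complex_eq_iff)
    qed
  qed
  show ?thesis
    unfolding hardy_martingale_def integrable_martingale_def measurable_coord_filtration_iff
    using Sint Sdep cond hardy md by auto
qed

section \<open>A pathwise form of Doob's inequality\<close>

primrec running_max :: "(nat \<Rightarrow> real) \<Rightarrow> nat \<Rightarrow> real" where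
  "running_max X 0 = X 0"
| "running_max X (Suc k) = max (running_max X k) (X (Suc k))"

lemma running_max_ge: "j \<le> k \<Longrightarrow> X j \<le> running_max X k"
  by (induction k) (auto simp: le_Suc_eq max_def)

lemma running_max_in: "\<exists>j\<le>k. running_max X k = X j"
proof (induction k)
  case (Suc k)
  then show ?case by (auto simp: max_def intro: le_SucI)
qed auto

lemma running_max_cong: "(\<And>j. j \<le> k \<Longrightarrow> X j = X' j) \<Longrightarrow> running_max X k = running_max X' k"
  by (induction k) auto

text \<open>A deterministic version of Doob's L^2 inequality. The sum is a discrete stochastic
  integral with previsible integrand, of nonnegative mean for a nonnegative submartingale, so taking
  expectations leaves the constant 4 with no level sets or stopping times.\<close>

lemma running_max_square_le:
  fixes X :: "nat \<Rightarrow> real"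
  assumes "X 0 = 0"
  shows "(running_max X n)\<^sup>2 \<le> 4 * (X n)\<^sup>2 - 4 * (\<Sum>k=1..n. running_max X (k - 1) * (X k - X (k - 1)))"
proof -
  define T where "T n = (\<Sum>k=1..n. running_max X (k - 1) * (X k - X (k - 1)))" for n
  \<comment> \<open>The inductive form, before the product is split by Young's inequality. When the
    maximum jumps from Y to Z, the slack created is the square of Z - Y.\<close>
  have "(running_max X n)\<^sup>2 + 2 * T n \<le> 2 * running_max X n * X n"
  proof (induction n)
    case 0 then show ?case using assms by (simp add: T_def)
  next
    case (Suc n)
    define Y where "Y = running_max X n"
    define Z where "Z = X (Suc n)"
    have T: "T (Suc n) = T n + Y * (Z - X n)" by (simp add: T_def Y_def Z_def)
    have "(max Y Z)\<^sup>2 + 2 * (T n + Y * (Z - X n)) \<le> 2 * max Y Z * Z"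
    proof (cases "Z \<le> Y")
      case True
      then show ?thesis using Suc.IH by (simp add: Y_def[symmetric] algebra_simps)
    next
      case False
      have "0 \<le> (Z - Y)\<^sup>2" by simp
      with Suc.IH False show ?thesis
        by (simp add: Y_def[symmetric] power2_eq_square algebra_simps max_def)
    qed
    then show ?case by (simp add: T Y_def Z_def)
  qed
  moreover have "2 * running_max X n * X n \<le> (running_max X n)\<^sup>2 / 2 + 2 * (X n)\<^sup>2"
    using zero_le_power2[of "running_max X n - 2 * X n"] by (simp add: power2_eq_square algebra_simps)
  ultimately show ?thesis unfolding T_def[symmetric] by linarith
qed

lemma herglotz_cong: "(\<And>w. cmod w = 1 \<Longrightarrow> u w = v w) \<Longrightarrow> herglotz u z = herglotz v z"
  unfolding herglotz_def by (rule Bochner_Integration.integral_cong) auto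

text \<open>Points of the torus with the same first coordinates have sections that agree on the
  circle only, so values elsewhere must not influence the construction.\<close>

lemma damped_cong:
  assumes "\<And>w. cmod w = 1 \<Longrightarrow> h w = h' w"
  shows "damped \<alpha> r z h = damped \<alpha> r z h'"
proof -
  have "harmonic_extension h x = harmonic_extension h' x" for x
    by (rule harmonic_extension_cong[OF assms])
  moreover have "herglotz (excess M h) x = herglotz (excess M h') x" for M x
    by (rule herglotz_cong) (simp add: excess_def assms)
  ultimately show ?thesis by (simp add: damped_def fun_eq_iff)
qed

section \<open>Joint measurability in the point and the new coordinate\<close>

context
  fixes f :: "(nat \<Rightarrow> complex) \<Rightarrow> complex" and k :: nat
  assumes k: "1 \<le> k" and f [measurable]: "f \<in> borel_measurable torus"
begin

lemma update_measurable_triple: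
  "(\<lambda>p. f ((fst (fst p))(k := snd p))) \<in> borel_measurable ((torus \<Otimes>\<^sub>M circle_haar) \<Otimes>\<^sub>M circle_haar)"
proof -
  have "(\<lambda>p. (fst (fst p), snd p)) \<in> measurable ((torus \<Otimes>\<^sub>M circle_haar) \<Otimes>\<^sub>M circle_haar) (torus \<Otimes>\<^sub>M circle_haar)"
    by measurable
  from measurable_compose[OF measurable_compose[OF this measurable_update[OF k]] f] show ?thesis by simp
qed

lemma harmonic_extension_section_measurable:
  "(\<lambda>p. harmonic_extension (\<lambda>y. f ((fst p)(k := y))) (of_real r * snd p))
      \<in> borel_measurable (torus \<Otimes>\<^sub>M circle_haar)"
proof -
  note [measurable] = update_measurable_triple
  have "(\<lambda>(p, y). of_real (poisson (of_real r * snd p) y) * f ((fst p)(k := y)))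
      \<in> borel_measurable ((torus \<Otimes>\<^sub>M circle_haar) \<Otimes>\<^sub>M circle_haar)"
    unfolding case_prod_beta' poisson_def by measurable
  then show ?thesis
    unfolding harmonic_extension_poisson by (rule circle.borel_measurable_lebesgue_integral)
qed

text \<open>With r independent of x, both factors are parameter integrals of jointly measurable
  integrands.\<close>

lemma damped_section_measurable:
  assumes [measurable]: "g \<in> borel_measurable torus"
  shows "(\<lambda>p. damped \<alpha> r (g (fst p)) (\<lambda>y. f ((fst p)(k := y))) (snd p)) \<in> borel_measurable (torus \<Otimes>\<^sub>M circle_haar)"
proof -
  note [measurable] = update_measurable_triple
  have "(\<lambda>(p, y). (y + of_real r * snd p) / (y - of_real r * snd p) *
      of_real (max 0 (cmod (f ((fst p)(k := y))) / (4 * cmod (g (fst p)) / \<alpha>) - 1)))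
      \<in> borel_measurable ((torus \<Otimes>\<^sub>M circle_haar) \<Otimes>\<^sub>M circle_haar)"
    unfolding case_prod_beta' by measurable
  then have [measurable]: "(\<lambda>p. herglotz (excess (4 * cmod (g (fst p)) / \<alpha>) (\<lambda>y. f ((fst p)(k := y)))) (of_real r * snd p))
     \<in> borel_measurable (torus \<Otimes>\<^sub>M circle_haar)"
    unfolding herglotz_def excess_def by (rule circle.borel_measurable_lebesgue_integral)
  note [measurable] = harmonic_extension_section_measurable[of r]
  show ?thesis unfolding damped_def by measurable
qed

end

lemma coordinate_measurable: "1 \<le> k \<Longrightarrow> (\<lambda>x. x k) \<in> measurable torus circle_haar"
  unfolding torus_def by (rule measurable_component_singleton) auto

lemma ennreal_sqrt_ennreal: "0 \<le> t \<Longrightarrow> ennreal_sqrt (ennreal t) = ennreal (sqrt t)"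
  by (simp add: ennreal_sqrt_def)

lemma ennreal_sqrt_mono: "s \<le> t \<Longrightarrow> ennreal_sqrt s \<le> ennreal_sqrt t"
  by (auto simp: ennreal_sqrt_def top_unique less_top intro!: ennreal_leI enn2real_mono)

section \<open>Gains and maximal function of the given martingale\<close>

locale hardy_decomposition = convexity_constant +
  fixes n :: nat and F :: "nat \<Rightarrow> (nat \<Rightarrow> complex) \<Rightarrow> complex"
  assumes F: "hardy_martingale n F"
begin

abbreviation "slice k x \<equiv> (\<lambda>y. mart_diff F k (x(k := y)))"

lemma F_0: "F 0 = (\<lambda>_. 0)"
  using F by (simp add: hardy_martingale_def)

lemma F_integrable: "k \<le> n \<Longrightarrow> integrable torus (F k)"
  using F by (cases "k = 0") (auto simp: F_0 hardy_martingale_def integrable_martingale_def)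

lemma F_depends: "k \<le> n \<Longrightarrow> depends_upto k (F k)"
  using F by (cases "k = 0")
    (auto simp: hardy_martingale_def integrable_martingale_def measurable_coord_filtration_iff, simp add: depends_upto_def)

lemma F_measurable: "k \<le> n \<Longrightarrow> F k \<in> borel_measurable torus"
  using F_integrable by auto

lemma diff_integrable: "k \<le> n \<Longrightarrow> integrable torus (mart_diff F k)"
  unfolding mart_diff_def[abs_def] by (intro Bochner_Integration.integrable_diff F_integrable) auto

lemma diff_measurable: "k \<le> n \<Longrightarrow> mart_diff F k \<in> borel_measurable torus"
  using diff_integrable by auto

lemma diff_depends: "k \<le> n \<Longrightarrow> depends_upto k (mart_diff F k)"
  unfolding mart_diff_def[abs_def]
  by (rule depends_upto_compose2[where g="\<lambda>a b. a - b", OF F_depends depends_upto_mono[OF F_depends]]) auto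

lemma slice_hardy: "k \<in> {1..n} \<Longrightarrow> AE x in torus. slice k x \<in> hardy_H1_0"
  using F by (auto simp: hardy_martingale_def)

lemma F_split:
  assumes "k \<in> {1..n}" "x \<in> space torus" "y \<in> sphere 0 1"
  shows "F k (x(k := y)) = F (k - 1) x + slice k x y"
proof -
  have "F (k - 1) (x(k := y)) = F (k - 1) x"
    by (rule depends_upto_update[OF F_depends]) (use assms in auto)
  then show ?thesis by (simp add: mart_diff_def)
qed

definition mean_norm :: "nat \<Rightarrow> real" where
  "mean_norm k = (LINT x|torus. cmod (F k x))"

lemma mean_norm_0: "mean_norm 0 = 0" by (simp add: mean_norm_def F_0)

lemma gain_slice:
  assumes "k \<in> {1..n}" "x \<in> space torus"
  shows "gain (F (k - 1) x) (slice k x) = (LINT y|circle_haar. cmod (F k (x(k := y)))) - cmod (F (k - 1) x)"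
proof -
  have "(LINT y|circle_haar. cmod (F (k - 1) x + slice k x y)) = (LINT y|circle_haar. cmod (F k (x(k := y))))"
    by (rule Bochner_Integration.integral_cong) (use F_split[OF assms] in auto)
  then show ?thesis by (simp add: gain_def)
qed

text \<open>Resampling the k-th coordinate turns the mean of |F_k| into its mean over sections, so
  the gains telescope to E|F_n|.\<close>

lemma integral_gain:
  assumes k: "k \<in> {1..n}"
  shows "integrable torus (\<lambda>x. gain (F (k - 1) x) (slice k x))"
    and "(LINT x|torus. gain (F (k - 1) x) (slice k x)) = mean_norm k - mean_norm (k - 1)"
proof -
  have k': "1 \<le> k" "k \<le> n" "k - 1 \<le> n" using k by auto
  have i: "integrable torus (\<lambda>x. cmod (F k x))" "integrable torus (\<lambda>x. cmod (F (k - 1) x))"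
    using F_integrable k' by auto
  note r = integrable_resample[OF k'(1) i(1)] integral_resample[OF k'(1) i(1)]
  show "integrable torus (\<lambda>x. gain (F (k - 1) x) (slice k x))"
    by (subst Bochner_Integration.integrable_cong[OF refl gain_slice[OF k]]) (use r i in auto)
  have "(LINT x|torus. gain (F (k - 1) x) (slice k x))
      = (LINT x|torus. (LINT y|circle_haar. cmod (F k (x(k := y)))) - cmod (F (k - 1) x))"
    by (rule Bochner_Integration.integral_cong[OF refl gain_slice[OF k]])
  then show "(LINT x|torus. gain (F (k - 1) x) (slice k x)) = mean_norm k - mean_norm (k - 1)"
    using r i by (simp add: mean_norm_def)
qed

lemma AE_gain_nonneg:
  assumes "k \<in> {1..n}"
  shows "AE x in torus. 0 \<le> gain (F (k - 1) x) (slice k x)"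
  using slice_hardy[OF assms] by eventually_elim (rule gain_nonneg)

lemma mean_norm_mono: "j \<le> k \<Longrightarrow> k \<le> n \<Longrightarrow> mean_norm j \<le> mean_norm k"
proof (induction k)
  case (Suc k)
  have "0 \<le> (LINT x|torus. gain (F (Suc k - 1) x) (slice (Suc k) x))"
    by (rule integral_nonneg_AE, rule AE_gain_nonneg) (use Suc in auto)
  then have "mean_norm k \<le> mean_norm (Suc k)"
    using integral_gain(2)[of "Suc k"] Suc.prems by simp
  then show ?case using Suc by (cases "j = Suc k") auto
qed auto

lemma mean_norm_nonneg: "0 \<le> mean_norm k" by (simp add: mean_norm_def)

abbreviation "root_norm k x \<equiv> sqrt (cmod (F k x))"
abbreviation "root_max k x \<equiv> running_max (\<lambda>j. sqrt (cmod (F j x))) k"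

lemma root_max_nonneg: "0 \<le> root_max k x"
  by (rule order_trans[OF _ running_max_ge[of 0]]) auto

text \<open>A crude majorant, serving integrability only; the sharp bound is
  \<open>maximal_inequality\<close>.\<close>

lemma root_max_square_le: "k \<le> n \<Longrightarrow> (root_max k x)\<^sup>2 \<le> (\<Sum>j\<le>n. cmod (F j x))"
proof -
  assume k: "k \<le> n"
  obtain j where j: "j \<le> k" "root_max k x = root_norm j x" using running_max_in by blast
  then have "(root_max k x)\<^sup>2 = cmod (F j x)" by simp
  also have "\<dots> \<le> (\<Sum>j\<le>n. cmod (F j x))" by (rule member_le_sum) (use j k in auto)
  finally show ?thesis .
qed

lemma root_max_measurable: "k \<le> n \<Longrightarrow> root_max k \<in> borel_measurable torus"
proof (induction k)
  case 0
  then show ?case using F_measurable[of 0] by simp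
next
  case (Suc k)
  then have [measurable]: "F (Suc k) \<in> borel_measurable torus" "root_max k \<in> borel_measurable torus"
    using F_measurable by auto
  show ?case unfolding running_max.simps by measurable
qed

lemma sum_norm_integrable: "integrable torus (\<lambda>x. \<Sum>j\<le>n. cmod (F j x))"
  using F_integrable by (intro Bochner_Integration.integrable_sum) auto

lemma root_max_update:
  assumes "1 \<le> k" "k \<le> n" "x \<in> space torus" "y \<in> sphere 0 1"
  shows "root_max (k - 1) (x(k := y)) = root_max (k - 1) x"
proof (rule running_max_cong)
  fix j assume "j \<le> k - 1"
  then have "F j (x(k := y)) = F j x"
    using assms by (intro depends_upto_update[OF F_depends]) auto
  then show "root_norm j (x(k := y)) = root_norm j x" by simp
qed

text \<open>The integrand factor \<open>root_max (k - 1)\<close> is nonnegative and fixed by the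
  first k - 1 coordinates, and \<open>sqrt_norm_submean\<close> makes the conditional increment of
  |F_k|^(1/2) nonnegative.\<close>

lemma submartingale_increment:
  assumes k: "k \<in> {1..n}"
  shows "integrable torus (\<lambda>x. root_max (k - 1) x * (root_norm k x - root_norm (k - 1) x))" (is ?I)
    and "0 \<le> (LINT x|torus. root_max (k - 1) x * (root_norm k x - root_norm (k - 1) x))"
proof -
  have k': "1 \<le> k" "k \<le> n" "k - 1 \<le> n" using k by auto
  have [measurable]: "F k \<in> borel_measurable torus" "F (k - 1) \<in> borel_measurable torus" "root_max (k - 1)
      \<in> borel_measurable torus"
    using F_measurable root_max_measurable k' by auto
  show i: ?I
  proof (rule Bochner_Integration.integrable_bound)
    show "integrable torus (\<lambda>x. 3 * (\<Sum>j\<le>n. cmod (F j x)))" using sum_norm_integrable by auto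
    show "AE x in torus. norm (root_max (k - 1) x * (root_norm k x - root_norm (k - 1) x))
        \<le> norm (3 * (\<Sum>j\<le>n. cmod (F j x)))"
    proof (rule AE_I2)
      fix x
      let ?S = "\<Sum>j\<le>n. cmod (F j x)"
      have le: "cmod (F j x) \<le> ?S" if "j \<le> n" for j by (rule member_le_sum) (use that in auto)
      define y a b where "y = root_max (k - 1) x" and "a = root_norm k x" and "b = root_norm (k - 1) x"
      have "y\<^sup>2 \<le> ?S" "a\<^sup>2 \<le> ?S" "b\<^sup>2 \<le> ?S" "0 \<le> y" "0 \<le> a" "0 \<le> b"
        using root_max_square_le[OF k'(3)] le k' root_max_nonneg by (auto simp: y_def a_def b_def)
      moreover have "\<bar>y * (a - b)\<bar> \<le> y\<^sup>2 + a\<^sup>2 + b\<^sup>2"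
      proof -
        have "\<bar>y * (a - b)\<bar> \<le> y * (a + b)" using \<open>0 \<le> y\<close> \<open>0 \<le> a\<close> \<open>0 \<le> b\<close>
          by (simp add: abs_mult mult_left_mono)
        moreover have "2 * (y * a) \<le> y\<^sup>2 + a\<^sup>2" "2 * (y * b) \<le> y\<^sup>2 + b\<^sup>2"
          using sum_squares_bound[of y a] sum_squares_bound[of y b] by (auto simp: algebra_simps)
        moreover have "0 \<le> a\<^sup>2" "0 \<le> b\<^sup>2" by auto
        ultimately show ?thesis unfolding distrib_left by linarith
      qed
      ultimately have "\<bar>y * (a - b)\<bar> \<le> 3 * ?S" by linarith
      moreover have "0 \<le> ?S" by (intro sum_nonneg) auto
      ultimately show "norm (root_max (k - 1) x * (root_norm k x - root_norm (k - 1) x)) \<le> norm (3 * ?S)"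
        by (simp add: y_def a_def b_def)
    qed
  qed measurable
  have Xi: "integrable torus (root_norm k)"
  proof (rule Bochner_Integration.integrable_bound)
    show "integrable torus (\<lambda>x. 1 + cmod (F k x))" using F_integrable[OF k'(2)] by auto
    have "sqrt t \<le> 1 + t" if "t \<ge> 0" for t
      using that by (intro real_le_lsqrt) (auto simp: power2_eq_square algebra_simps)
    then show "AE x in torus. norm (root_norm k x) \<le> norm (1 + cmod (F k x))"
      by (intro AE_I2) (simp add: abs_of_nonneg)
  qed measurable
  have "(LINT x|torus. root_max (k - 1) x * (root_norm k x - root_norm (k - 1) x))
      = (LINT x|torus. LINT y|circle_haar. root_max (k - 1) (x(k := y)) * (root_norm k (x(k := y)) - root_norm (k - 1) (x(k := y))))"
    by (rule integral_resample[OF k'(1) i])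
  also have "\<dots> \<ge> 0"
  proof (rule integral_nonneg_AE)
    show "AE x in torus. 0 \<le> (LINT y|circle_haar. root_max (k - 1) (x(k := y)) * (root_norm k (x(k := y)) - root_norm (k - 1) (x(k := y))))"
      using slice_hardy[OF k] AE_integrable_resample[OF k'(1) Xi] AE_space
    proof eventually_elim
      case (elim x)
      have "(LINT y|circle_haar. root_max (k - 1) (x(k := y)) * (root_norm k (x(k := y)) - root_norm (k - 1) (x(k := y))))
         = (LINT y|circle_haar. root_max (k - 1) x * (root_norm k (x(k := y)) - root_norm (k - 1) x))"
      proof (rule Bochner_Integration.integral_cong)
        fix y assume y: "y \<in> space circle_haar"
        then have "F (k - 1) (x(k := y)) = F (k - 1) x"
          using elim k' by (intro depends_upto_update[OF F_depends]) auto
        then show "root_max (k - 1) (x(k := y)) * (root_norm k (x(k := y)) - root_norm (k - 1) (x(k := y)))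
            = root_max (k - 1) x * (root_norm k (x(k := y)) - root_norm (k - 1) x)"
          using root_max_update[OF k'(1,2) elim(3)] y by simp
      qed simp
      also have "\<dots> = root_max (k - 1) x * ((LINT y|circle_haar. root_norm k (x(k := y))) - root_norm (k - 1) x)"
        using elim(2) circle.prob_space by simp
      also have "(LINT y|circle_haar. root_norm k (x(k := y))) = (LINT y|circle_haar. sqrt (cmod (F (k - 1) x
          + slice k x y)))"
        by (rule Bochner_Integration.integral_cong) (use F_split[OF k elim(3)] in auto)
      finally have eq: "(LINT y|circle_haar. root_max (k - 1) (x(k := y)) * (root_norm k (x(k := y)) - root_norm (k - 1) (x(k := y))))
         = root_max (k - 1) x * ((LINT y|circle_haar. sqrt (cmod (F (k - 1) x
             + slice k x y))) - root_norm (k - 1) x)" .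
      show ?case
        unfolding eq using sqrt_norm_submean[OF elim(1), of "F (k - 1) x"]
        by (intro mult_nonneg_nonneg root_max_nonneg) simp
    qed
  qed
  finally show "0 \<le> (LINT x|torus. root_max (k - 1) x * (root_norm k x - root_norm (k - 1) x))" .
qed

lemma root_max_square_integrable: "integrable torus (\<lambda>x. (root_max n x)\<^sup>2)"
proof (rule Bochner_Integration.integrable_bound[OF sum_norm_integrable])
  show "AE x in torus. norm ((root_max n x)\<^sup>2) \<le> norm (\<Sum>j\<le>n. cmod (F j x))"
    using root_max_square_le[of n] by (intro AE_I2) (auto simp: abs_of_nonneg sum_nonneg)
qed (use root_max_measurable[of n] in measurable)

text \<open>Integration of the pathwise inequality for |F_k|^(1/2). The squares turn it into a bound
  for the maximum of |F_k| by E|F_n|.\<close>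

lemma maximal_inequality: "(LINT x|torus. (root_max n x)\<^sup>2) \<le> 4 * mean_norm n"
proof -
  let ?T = "\<lambda>x. \<Sum>k=1..n. root_max (k - 1) x * (root_norm k x - root_norm (k - 1) x)"
  have iT: "integrable torus ?T" by (intro Bochner_Integration.integrable_sum submartingale_increment(1))
  have iF: "integrable torus (\<lambda>x. cmod (F n x))" using F_integrable by auto
  have "(LINT x|torus. (root_max n x)\<^sup>2) \<le> (LINT x|torus. 4 * cmod (F n x) - 4 * ?T x)"
  proof (rule integral_mono[OF root_max_square_integrable])
    show "integrable torus (\<lambda>x. 4 * cmod (F n x) - 4 * ?T x)" using iT iF
        by (intro Bochner_Integration.integrable_diff integrable_mult_right)
    fix x
    show "(root_max n x)\<^sup>2 \<le> 4 * cmod (F n x) - 4 * ?T x"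
      using running_max_square_le[of "\<lambda>k. root_norm k x" n] F_0 by simp
  qed
  also have "\<dots> = 4 * mean_norm n - 4 * (LINT x|torus. ?T x)"
    using iT iF by (subst Bochner_Integration.integral_diff) (auto simp: mean_norm_def)
  also have "(LINT x|torus. ?T x) = (\<Sum>k=1..n. LINT x|torus. root_max (k - 1) x * (root_norm k x - root_norm (k - 1) x))"
    by (intro Bochner_Integration.integral_sum submartingale_increment(1))
  also have "4 * mean_norm n - 4 * \<dots> \<le> 4 * mean_norm n"
    using sum_nonneg[OF submartingale_increment(2), of "{1..n}" "\<lambda>k. k"] by simp
  finally show ?thesis .
qed

end

section \<open>One radius for all steps of the martingale\<close>

context hardy_decomposition
begin

definition dilation_error :: "nat \<Rightarrow> nat \<Rightarrow> (nat \<Rightarrow> complex) \<Rightarrow> real" where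
  "dilation_error k i x =
     (LINT y|circle_haar. cmod (slice k x y - harmonic_extension (slice k x) (of_real (radius i) * y)))"

lemma dilation_error_nonneg: "0 \<le> dilation_error k i x"
  by (simp add: dilation_error_def)

text \<open>Independent of the radius index i, hence a dominating function for the limit over
  i.\<close>

lemma dilation_error_le:
  assumes "integrable circle_haar (slice k x)"
  shows "dilation_error k i x \<le> 2 * (LINT y|circle_haar. cmod (slice k x y))"
proof -
  note c = harmonic_extension_contraction[OF assms radius_nonneg radius_less_1, of i]
  have "dilation_error k i x \<le> (LINT y|circle_haar. cmod (slice k x y)
      + cmod (harmonic_extension (slice k x) (of_real (radius i) * y)))"
    unfolding dilation_error_def using assms c(1) by (intro integral_mono norm_triangle_ineq4) auto
  also have "\<dots> = (LINT y|circle_haar. cmod (slice k x y))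
      + (LINT y|circle_haar. cmod (harmonic_extension (slice k x) (of_real (radius i) * y)))"
    using assms c(1) by (intro Bochner_Integration.integral_add) auto
  finally show ?thesis using c(2) by simp
qed

lemma dilation_error_measurable:
  assumes k: "k \<in> {1..n}"
  shows "dilation_error k i \<in> borel_measurable torus"
proof -
  have k': "1 \<le> k" "k \<le> n" using k by auto
  note [measurable] = harmonic_extension_section_measurable[OF k'(1) diff_measurable[OF k'(2)], of "radius i"]
    measurable_compose[OF measurable_update[OF k'(1)] diff_measurable[OF k'(2)], unfolded case_prod_beta']
  have "(\<lambda>(x, y). cmod (slice k x y - harmonic_extension (slice k x) (of_real (radius i) * y)))
      \<in> borel_measurable (torus \<Otimes>\<^sub>M circle_haar)"
    unfolding case_prod_beta' by measurable
  then show ?thesis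
    unfolding dilation_error_def[abs_def] by (rule circle.borel_measurable_lebesgue_integral)
qed

context
  fixes k :: nat assumes k: "k \<in> {1..n}"
begin

lemma slice_integrable: "AE x in torus. integrable circle_haar (slice k x)"
  using slice_hardy[OF k] by eventually_elim (rule hardy_H1_0D(1))

lemma slice_norm_integrable: "integrable torus (\<lambda>x. LINT y|circle_haar. cmod (slice k x y))"
  by (rule integrable_resample[where f="\<lambda>x. cmod (mart_diff F k x)"]) (use k diff_integrable in auto)

lemma dilation_error_integrable: "integrable torus (dilation_error k i)"
proof (rule Bochner_Integration.integrable_bound)
  show "integrable torus (\<lambda>x. 2 * (LINT y|circle_haar. cmod (slice k x y)))"
    using slice_norm_integrable by (rule integrable_mult_right)
  show "AE x in torus. norm (dilation_error k i x) \<le> norm (2 * (LINT y|circle_haar. cmod (slice k x y)))"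
    using slice_integrable
  proof eventually_elim
    case (elim x)
    from dilation_error_le[OF this, of i] dilation_error_nonneg[of k i x] show ?case by (simp only: real_norm_def)
  qed
qed (rule dilation_error_measurable[OF k])

text \<open>Shows that the errors vanish when E|F_n| = 0, the case that convergence alone cannot
  settle.\<close>

lemma integral_dilation_error_le: "(LINT x|torus. dilation_error k i x) \<le> 2 * (mean_norm k + mean_norm (k - 1))"
proof -
  have i: "integrable torus (\<lambda>x. cmod (F k x))" "integrable torus (\<lambda>x. cmod (F (k - 1) x))"
    using F_integrable k by auto
  have d: "integrable torus (\<lambda>x. cmod (mart_diff F k x))" using diff_integrable k by auto
  have "(LINT x|torus. dilation_error k i x) \<le> (LINT x|torus. 2 * (LINT y|circle_haar. cmod (slice k x y)))"
  proof (rule integral_mono_AE[OF dilation_error_integrable integrable_mult_right[OF slice_norm_integrable]])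
    show "AE x in torus. dilation_error k i x \<le> 2 * (LINT y|circle_haar. cmod (slice k x y))"
      using slice_integrable by eventually_elim (rule dilation_error_le)
  qed
  also have "\<dots> = 2 * (LINT x|torus. cmod (mart_diff F k x))"
    using integral_resample[OF _ d, of k] k by simp
  also have "(LINT x|torus. cmod (mart_diff F k x)) \<le> (LINT x|torus. cmod (F k x) + cmod (F (k - 1) x))"
    using i d by (intro integral_mono) (auto simp: mart_diff_def norm_triangle_ineq4)
  also have "\<dots> = mean_norm k + mean_norm (k - 1)" using i by (simp add: mean_norm_def)
  finally show ?thesis by simp
qed

lemma dilation_error_tendsto: "(\<lambda>i. LINT x|torus. dilation_error k i x) \<longlonglongrightarrow> 0"
proof -
  have "(\<lambda>i. LINT x|torus. dilation_error k i x) \<longlonglongrightarrow> (LINT x|torus. 0)"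
  proof (rule integral_dominated_convergence[where w="\<lambda>x. 2 * (LINT y|circle_haar. cmod (slice k x y))"])
    show "integrable torus (\<lambda>x. 2 * (LINT y|circle_haar. cmod (slice k x y)))"
      using slice_norm_integrable by (rule integrable_mult_right)
    show "AE x in torus. (\<lambda>i. dilation_error k i x) \<longlonglongrightarrow> 0"
      using slice_integrable
    proof eventually_elim
      case (elim x)
      from abel_summable_integrable[OF this] show ?case
        by (simp only: abel_summable_def dilation_error_def norm_minus_commute)
    qed
    show "AE x in torus. norm (dilation_error k i x) \<le> 2 * (LINT y|circle_haar. cmod (slice k x y))" for i
      using slice_integrable
    proof eventually_elim
      case (elim x)
      from dilation_error_le[OF this, of i] dilation_error_nonneg[of k i x] show ?case
          by (simp only: real_norm_def)
    qed
  qed (use dilation_error_measurable[OF k] in auto)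
  then show ?thesis by simp
qed

end

text \<open>Finitely many errors tend to 0 in mean, so a single index brings their sum below any
  positive target; the target E|F_n| is what the final bound can absorb.\<close>

lemma exists_small_dilation_error: "\<exists>i. (\<Sum>k=1..n. LINT x|torus. dilation_error k i x) \<le> mean_norm n"
proof (cases "mean_norm n = 0")
  \<comment> \<open>The target is 0 and must be attained exactly. All earlier means vanish by
    monotonicity, and so does every error, at any radius; index 0 is taken.\<close>
  case True
  have "mean_norm k = 0" if "k \<le> n" for k
    using mean_norm_mono[OF that order_refl] mean_norm_nonneg[of k] True by simp
  then have "(LINT x|torus. dilation_error k 0 x) \<le> 0" if "k \<in> {1..n}" for k
    using integral_dilation_error_le[OF that, of 0] that by auto
  then have "(\<Sum>k=1..n. LINT x|torus. dilation_error k 0 x) \<le> 0"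
    by (rule sum_nonpos)
  then show ?thesis using True by auto
next
  case False
  then have "0 < mean_norm n" using mean_norm_nonneg[of n] by simp
  moreover have "(\<lambda>i. \<Sum>k=1..n. LINT x|torus. dilation_error k i x) \<longlonglongrightarrow> (\<Sum>k=1..n. 0)"
    by (intro tendsto_sum dilation_error_tendsto)
  ultimately have "\<forall>\<^sub>F i in sequentially. (\<Sum>k=1..n. LINT x|torus. dilation_error k i x) < mean_norm n"
    by (intro order_tendstoD(2)) auto
  then show ?thesis by (auto simp: eventually_sequentially intro: less_imp_le)
qed

section \<open>The damped differences and the remainders\<close>

definition good_diff :: "nat \<Rightarrow> nat \<Rightarrow> (nat \<Rightarrow> complex) \<Rightarrow> complex" where
  "good_diff i k x = damped \<alpha> (radius i) (F (k - 1) x) (slice k x) (x k)"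

context
  fixes i k :: nat assumes k: "k \<in> {1..n}"
begin

lemma good_diff_update:
  assumes "x \<in> space torus" "y \<in> sphere 0 1"
  shows "good_diff i k (x(k := y)) = damped \<alpha> (radius i) (F (k - 1) x) (slice k x) y"
proof -
  have "F (k - 1) (x(k := y)) = F (k - 1) x"
    by (rule depends_upto_update[OF F_depends]) (use assms k in auto)
  then show ?thesis by (simp add: good_diff_def)
qed

lemma good_diff_depends: "depends_upto k (good_diff i k)"
  unfolding depends_upto_def
proof (intro ballI impI)
  fix x x' assume x: "x \<in> space torus" "x' \<in> space torus" and eq: "\<forall>j\<in>{1..k}. x j = x' j"
  have "F (k - 1) x = F (k - 1) x'"
    by (rule depends_uptoD[OF F_depends x]) (use k eq in auto)
  moreover have "x k = x' k" using k eq by auto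
  moreover have "slice k x y = slice k x' y" if y: "cmod y = 1" for y
    by (rule depends_uptoD[OF diff_depends update_in_space_torus[OF x(1)] update_in_space_torus[OF x(2)]])
       (use k eq y in auto)
  ultimately show "good_diff i k x = good_diff i k x'"
    unfolding good_diff_def using damped_cong[of "slice k x" "slice k x'"] by metis
qed

lemma good_diff_measurable: "good_diff i k \<in> borel_measurable torus"
proof -
  have k': "1 \<le> k" "k \<le> n" "k - 1 \<le> n" using k by auto
  have "(\<lambda>x. (x, x k)) \<in> measurable torus (torus \<Otimes>\<^sub>M circle_haar)"
    using coordinate_measurable[OF k'(1)] by (intro measurable_Pair) auto
  from measurable_compose[OF this damped_section_measurable[OF k'(1) diff_measurable[OF k'(2)] F_measurable[OF k'(3)]]]
  show ?thesis by (simp add: good_diff_def[abs_def])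
qed

lemma AE_norm_good_diff: "AE x in torus. cmod (good_diff i k x) \<le> 4 * cmod (F (k - 1) x) / \<alpha>"
  using slice_hardy[OF k] AE_space
proof eventually_elim
  case (elim x)
  have "x k \<in> sphere 0 1" using elim(2) k by (auto simp: space_torus PiE_iff)
  then show ?case unfolding good_diff_def
    by (intro norm_damped[OF elim(1) radius_nonneg radius_less_1]) simp
qed

lemma good_diff_integrable: "integrable torus (good_diff i k)"
proof (rule Bochner_Integration.integrable_bound[OF _ good_diff_measurable])
  show "integrable torus (\<lambda>x. 4 * cmod (F (k - 1) x) / \<alpha>)"
    using F_integrable[of "k - 1"] k by auto
  show "AE x in torus. norm (good_diff i k x) \<le> norm (4 * cmod (F (k - 1) x) / \<alpha>)"
    using AE_norm_good_diff by eventually_elim (use pos in simp)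
qed

lemma good_diff_hardy: "AE x in torus. (\<lambda>y. good_diff i k (x(k := y))) \<in> hardy_H1_0"
  using slice_hardy[OF k] AE_space
proof eventually_elim
  case (elim x)
  show ?case
    by (rule hardy_H1_0_cong[OF damped_hardy[OF elim(1) radius_nonneg radius_less_1]])
       (use good_diff_update[OF elim(2)] in auto)
qed

text \<open>Integrating out the k-th coordinate reduces the conditional second moment to
  \<open>integral_square_damped\<close> for the section over x, with z = F_(k-1)(x).\<close>

lemma cond_exp_good_diff_le:
  "AE x in torus. nn_cond_exp torus (coord_filtration (k - 1)) (\<lambda>x. ennreal ((cmod (good_diff i k x))\<^sup>2)) x
     \<le> ennreal (6 * cmod (F (k - 1) x) * gain (F (k - 1) x) (slice k x) / \<alpha>\<^sup>2)"
proof -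
  have k': "1 \<le> k" using k by auto
  note [measurable] = good_diff_measurable
  have "AE x in torus. (\<integral>\<^sup>+ y. ennreal ((cmod (good_diff i k (x(k := y))))\<^sup>2) \<partial>circle_haar)
     = nn_cond_exp torus (coord_filtration (k - 1)) (\<lambda>x. ennreal ((cmod (good_diff i k x))\<^sup>2)) x"
    by (rule nn_cond_exp_resample[OF k'])
       (measurable, rule depends_upto_compose[where g="\<lambda>c. ennreal ((cmod c)\<^sup>2)", OF good_diff_depends])
  then show ?thesis using slice_hardy[OF k] AE_space
  proof eventually_elim
    case (elim x)
    let ?d = "damped \<alpha> (radius i) (F (k - 1) x) (slice k x)"
    have m: "?d \<in> borel_measurable circle_haar"
      using hardy_H1_0D(1)[OF damped_hardy[OF elim(2) radius_nonneg radius_less_1]] by auto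
    have int: "integrable circle_haar (\<lambda>y. (cmod (?d y))\<^sup>2)"
    proof (rule circle.integrable_const_bound[where B="(4 * cmod (F (k - 1) x) / \<alpha>)\<^sup>2"])
      show "AE y in circle_haar. norm ((cmod (?d y))\<^sup>2) \<le> (4 * cmod (F (k - 1) x) / \<alpha>)\<^sup>2"
        using norm_damped[OF elim(2) radius_nonneg radius_less_1]
        by (intro AE_I2) (auto intro!: power_mono)
    qed (use m in measurable)
    have "nn_cond_exp torus (coord_filtration (k - 1)) (\<lambda>x. ennreal ((cmod (good_diff i k x))\<^sup>2)) x
       = (\<integral>\<^sup>+ y. ennreal ((cmod (good_diff i k (x(k := y))))\<^sup>2) \<partial>circle_haar)"
      using elim(1) by simp
    also have "\<dots> = (\<integral>\<^sup>+ y. ennreal ((cmod (?d y))\<^sup>2) \<partial>circle_haar)"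
      by (rule nn_integral_cong) (use good_diff_update[OF elim(3)] in auto)
    also have "\<dots> = ennreal (LINT y|circle_haar. (cmod (?d y))\<^sup>2)"
      by (rule nn_integral_eq_integral[OF int]) auto
    also have "(LINT y|circle_haar. (cmod (?d y))\<^sup>2) = \<alpha>\<^sup>2 * (LINT y|circle_haar. (cmod (?d y))\<^sup>2) / \<alpha>\<^sup>2"
      using pos by simp
    also have "ennreal \<dots> \<le> ennreal (6 * cmod (F (k - 1) x) * gain (F (k - 1) x) (slice k x) / \<alpha>\<^sup>2)"
      by (intro ennreal_leI divide_right_mono integral_square_damped[OF elim(2) radius_nonneg radius_less_1]) simp
    finally show ?case .
  qed
qed

lemma bad_diff_integrable: "integrable torus (\<lambda>x. mart_diff F k x - good_diff i k x)"
  using good_diff_integrable diff_integrable k by auto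

text \<open>The single-function estimate for the sections, averaged over the torus; the gain then
  becomes an increment of E|F_k| and will telescope.\<close>

lemma integral_bad_diff_le:
  "(LINT x|torus. cmod (mart_diff F k x - good_diff i k x))
     \<le> (LINT x|torus. dilation_error k i x) + 4 / \<alpha> * (mean_norm k - mean_norm (k - 1))"
proof -
  have k': "1 \<le> k" using k by auto
  have int: "integrable torus (\<lambda>x. cmod (mart_diff F k x - good_diff i k x))"
    using bad_diff_integrable by auto
  have "(LINT x|torus. cmod (mart_diff F k x - good_diff i k x))
     = (LINT x|torus. LINT y|circle_haar. cmod (slice k x y - good_diff i k (x(k := y))))"
    by (rule integral_resample[OF k' int])
  also have "\<dots> \<le> (LINT x|torus. dilation_error k i x + 4 / \<alpha> * gain (F (k - 1) x) (slice k x))"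
  proof (rule integral_mono_AE)
    show "integrable torus (\<lambda>x. LINT y|circle_haar. cmod (slice k x y - good_diff i k (x(k := y))))"
      by (rule integrable_resample[OF k' int])
    show "integrable torus (\<lambda>x. dilation_error k i x + 4 / \<alpha> * gain (F (k - 1) x) (slice k x))"
      by (intro Bochner_Integration.integrable_add integrable_mult_right dilation_error_integrable integral_gain(1) k)
    show "AE x in torus. (LINT y|circle_haar. cmod (slice k x y - good_diff i k (x(k := y))))
       \<le> dilation_error k i x + 4 / \<alpha> * gain (F (k - 1) x) (slice k x)"
      using slice_hardy[OF k] AE_space
    proof eventually_elim
      case (elim x)
      have "(LINT y|circle_haar. cmod (slice k x y - good_diff i k (x(k := y))))
         = (LINT y|circle_haar. cmod (slice k x y - damped \<alpha> (radius i) (F (k - 1) x) (slice k x) y))" (is "_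
             = ?L")
        by (rule Bochner_Integration.integral_cong) (use good_diff_update[OF elim(2)] in auto)
      moreover have "\<alpha> * ?L \<le> \<alpha> * dilation_error k i x + 4 * gain (F (k - 1) x) (slice k x)"
        unfolding dilation_error_def by (rule integral_minus_damped[OF elim(1) radius_nonneg radius_less_1])
      then have "?L \<le> dilation_error k i x + 4 / \<alpha> * gain (F (k - 1) x) (slice k x)"
        using pos by (simp add: field_simps)
      ultimately show ?case by simp
    qed
  qed
  also have "\<dots> = (LINT x|torus. dilation_error k i x) + 4 / \<alpha> * (mean_norm k - mean_norm (k - 1))"
    using dilation_error_integrable[OF k] integral_gain[OF k]
    by (subst Bochner_Integration.integral_add) auto
  finally show ?thesis .
qed

end

lemma sum_mean_norm: "(\<Sum>k=1..m. mean_norm k - mean_norm (k - 1)) = mean_norm m"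
  by (induction m) (auto simp: mean_norm_0)

lemma integral_sum_bad_diff_le:
  assumes "(\<Sum>k=1..n. LINT x|torus. dilation_error k i x) \<le> mean_norm n"
  shows "(LINT x|torus. (\<Sum>k=1..n. cmod (mart_diff F k x - good_diff i k x))) \<le> (1 + 4 / \<alpha>) * mean_norm n"
proof -
  have "(LINT x|torus. (\<Sum>k=1..n. cmod (mart_diff F k x - good_diff i k x)))
     = (\<Sum>k=1..n. LINT x|torus. cmod (mart_diff F k x - good_diff i k x))"
    using bad_diff_integrable by (intro Bochner_Integration.integral_sum) auto
  also have "\<dots> \<le> (\<Sum>k=1..n. (LINT x|torus. dilation_error k i x) + 4 / \<alpha> * (mean_norm k - mean_norm (k - 1)))"
    by (intro sum_mono integral_bad_diff_le)
  also have "\<dots> = (\<Sum>k=1..n. LINT x|torus. dilation_error k i x) + 4 / \<alpha> * mean_norm n"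
    by (simp only: sum.distrib sum_distrib_left[symmetric] sum_mean_norm)
  also have "\<dots> \<le> (1 + 4 / \<alpha>) * mean_norm n" using assms by (simp add: algebra_simps)
  finally show ?thesis .
qed

text \<open>Each |F_(k-1)| is replaced by the maximum, which comes out of the sum and leaves the
  root of a product of two integrable functions, the maximum of |F_k| and the sum of the
  gains.\<close>

lemma nn_integral_sqrt_good_diff_le:
  "(\<integral>\<^sup>+ x. ennreal_sqrt (\<Sum>k=1..n. nn_cond_exp torus (coord_filtration (k - 1))
      (\<lambda>x. ennreal ((cmod (good_diff i k x))\<^sup>2)) x) \<partial>torus) \<le> ennreal (5 / \<alpha> * mean_norm n)"
proof -
  define \<Gamma> where "\<Gamma> x = (\<Sum>k=1..n. gain (F (k - 1) x) (slice k x))" for x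
  \<comment> \<open>The weight 1/4 compensates the constant 4 of the maximal inequality, so that
    each summand has mean at most E|F_n|. The factor 5/2 is a rational bound for sqrt 6.\<close>
  define b where "b x = 5 / (2 * \<alpha>) * ((root_max n x)\<^sup>2 / 4 + \<Gamma> x)" for x
  have \<Gamma>_int: "integrable torus \<Gamma>" unfolding \<Gamma>_def[abs_def]
    by (intro Bochner_Integration.integrable_sum integral_gain(1))
  have b_int: "integrable torus b" unfolding b_def[abs_def]
    by (intro integrable_mult_right Bochner_Integration.integrable_add Bochner_Integration.integrable_divide root_max_square_integrable \<Gamma>_int)
  have AE_gain: "AE x in torus. \<forall>k\<in>{1..n}. 0 \<le> gain (F (k - 1) x) (slice k x)"
    by (intro AE_finite_allI AE_gain_nonneg) auto
  have AE_ce: "AE x in torus. \<forall>k\<in>{1..n}. nn_cond_exp torus (coord_filtration (k - 1)) (\<lambda>x. ennreal ((cmod (good_diff i k x))\<^sup>2)) x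
     \<le> ennreal (6 * cmod (F (k - 1) x) * gain (F (k - 1) x) (slice k x) / \<alpha>\<^sup>2)"
    by (intro AE_finite_allI cond_exp_good_diff_le) auto
  have "(\<integral>\<^sup>+ x. ennreal_sqrt (\<Sum>k=1..n. nn_cond_exp torus (coord_filtration (k - 1))
      (\<lambda>x. ennreal ((cmod (good_diff i k x))\<^sup>2)) x) \<partial>torus) \<le> (\<integral>\<^sup>+ x. ennreal (b x) \<partial>torus)"
  proof (rule nn_integral_mono_AE)
    show "AE x in torus. ennreal_sqrt (\<Sum>k=1..n. nn_cond_exp torus (coord_filtration (k - 1))
      (\<lambda>x. ennreal ((cmod (good_diff i k x))\<^sup>2)) x) \<le> ennreal (b x)"
      using AE_gain AE_ce
    proof eventually_elim
      case (elim x)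
      let ?g = "\<lambda>k. gain (F (k - 1) x) (slice k x)"
      let ?Z = "(root_max n x)\<^sup>2"
      have \<Gamma>0: "0 \<le> \<Gamma> x" unfolding \<Gamma>_def using elim(1) by (intro sum_nonneg) auto
      have FZ: "cmod (F (k - 1) x) \<le> ?Z" if "k \<in> {1..n}" for k
      proof -
        have "root_norm (k - 1) x \<le> root_max n x" by (rule running_max_ge) (use that in auto)
        then have "(root_norm (k - 1) x)\<^sup>2 \<le> ?Z" by (intro power_mono) auto
        then show ?thesis by simp
      qed
      have "(\<Sum>k=1..n. nn_cond_exp torus (coord_filtration (k - 1)) (\<lambda>x. ennreal ((cmod (good_diff i k x))\<^sup>2)) x)
          \<le> (\<Sum>k=1..n. ennreal (6 / \<alpha>\<^sup>2 * ?Z * ?g k))"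
      proof (rule sum_mono)
        fix k assume k: "k \<in> {1..n}"
        have "6 * cmod (F (k - 1) x) * ?g k / \<alpha>\<^sup>2 = 6 / \<alpha>\<^sup>2 * cmod (F (k - 1) x) * ?g k" by simp
        also have "\<dots> \<le> 6 / \<alpha>\<^sup>2 * ?Z * ?g k"
          using FZ[OF k] elim(1) k by (intro mult_right_mono mult_left_mono) auto
        finally show "nn_cond_exp torus (coord_filtration (k - 1)) (\<lambda>x. ennreal ((cmod (good_diff i k x))\<^sup>2)) x
           \<le> ennreal (6 / \<alpha>\<^sup>2 * ?Z * ?g k)"
          using elim(2) k ennreal_leI order_trans by blast
      qed
      also have "\<dots> = ennreal (\<Sum>k=1..n. 6 / \<alpha>\<^sup>2 * ?Z * ?g k)"
        using elim(1) by (intro sum_ennreal) auto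
      also have "(\<Sum>k=1..n. 6 / \<alpha>\<^sup>2 * ?Z * ?g k) = 6 / \<alpha>\<^sup>2 * ?Z * \<Gamma> x"
        by (simp add: \<Gamma>_def sum_distrib_left)
      finally have "ennreal_sqrt (\<Sum>k=1..n. nn_cond_exp torus (coord_filtration (k - 1)) (\<lambda>x. ennreal ((cmod (good_diff i k x))\<^sup>2)) x)
          \<le> ennreal_sqrt (ennreal (6 / \<alpha>\<^sup>2 * ?Z * \<Gamma> x))"
        by (rule ennreal_sqrt_mono)
      also have "\<dots> = ennreal (sqrt (6 / \<alpha>\<^sup>2 * ?Z * \<Gamma> x))"
        using \<Gamma>0 by (intro ennreal_sqrt_ennreal) auto
      also have "sqrt (6 / \<alpha>\<^sup>2 * ?Z * \<Gamma> x) \<le> b x"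
      proof (rule real_le_lsqrt)
        show "0 \<le> b x" using \<Gamma>0 pos by (simp add: b_def)
        have "?Z * \<Gamma> x \<le> (?Z / 4 + \<Gamma> x)\<^sup>2"
          using zero_le_power2[of "?Z / 4 - \<Gamma> x"] by (simp add: power2_eq_square algebra_simps)
        then have "6 / \<alpha>\<^sup>2 * (?Z * \<Gamma> x) \<le> (25 / 4) / \<alpha>\<^sup>2 * (?Z / 4 + \<Gamma> x)\<^sup>2"
          using \<Gamma>0 pos by (intro mult_mono divide_right_mono) auto
        moreover have "(5 / (2 * \<alpha>) * w)\<^sup>2 = (25 / 4) / \<alpha>\<^sup>2 * w\<^sup>2" for w
          by (simp add: power_mult_distrib power_divide)
        ultimately show "6 / \<alpha>\<^sup>2 * ?Z * \<Gamma> x \<le> (b x)\<^sup>2"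
          unfolding b_def by (simp only: mult.assoc)
      qed
      finally show ?case by (simp add: ennreal_leI)
    qed
  qed
  also have "\<dots> = ennreal (LINT x|torus. b x)"
  proof (rule nn_integral_eq_integral[OF b_int])
    show "AE x in torus. 0 \<le> b x"
      using AE_gain unfolding b_def \<Gamma>_def
      by eventually_elim (use pos in \<open>intro mult_nonneg_nonneg add_nonneg_nonneg sum_nonneg; simp\<close>)
  qed
  also have "(LINT x|torus. b x) \<le> 5 / \<alpha> * mean_norm n"
  proof -
    have "(LINT x|torus. \<Gamma> x) = (\<Sum>k=1..n. LINT x|torus. gain (F (k - 1) x) (slice k x))"
      unfolding \<Gamma>_def by (rule Bochner_Integration.integral_sum[OF integral_gain(1)])
    also have "\<dots> = (\<Sum>k=1..n. mean_norm k - mean_norm (k - 1))"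
      by (intro sum.cong refl integral_gain(2))
    finally have "(LINT x|torus. \<Gamma> x) = (\<Sum>k=1..n. mean_norm k - mean_norm (k - 1))" .
    then have "(LINT x|torus. \<Gamma> x) = mean_norm n" by (simp only: sum_mean_norm)
    moreover have "(LINT x|torus. b x) = 5 / (2 * \<alpha>) * ((LINT x|torus. (root_max n x)\<^sup>2) / 4
        + (LINT x|torus. \<Gamma> x))"
      unfolding b_def using root_max_square_integrable \<Gamma>_int by simp
    ultimately have "(LINT x|torus. b x) \<le> 5 / (2 * \<alpha>) * (mean_norm n + mean_norm n)"
      using maximal_inequality pos by (simp only:) (intro mult_left_mono add_right_mono; simp)
    also have "\<dots> = 5 / \<alpha> * mean_norm n" by simp
    finally show ?thesis .
  qed
  finally show ?thesis by (simp add: ennreal_leI)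
qed

end

theorem theorem3p2:
  fixes \<alpha>\<^sub>0 A\<^sub>0 C\<^sub>1 :: real and n :: nat
    and F :: "nat \<Rightarrow> (nat \<Rightarrow> complex) \<Rightarrow> complex"
  assumes "\<alpha>\<^sub>0 > 0"
    and "\<And>(z::complex) h. h \<in> hardy_H1_0 \<Longrightarrow>
           (LINT w|circle_haar. sqrt ((cmod z)\<^sup>2 + \<alpha>\<^sub>0\<^sup>2 * (cmod (h w))\<^sup>2))
             \<le> (LINT w|circle_haar. cmod (z + h w))"
    and "A\<^sub>0 = 4 * inverse \<alpha>\<^sub>0"
    and "C\<^sub>1 = 4 * inverse \<alpha>\<^sub>0 * sqrt 10 * A\<^sub>0"
    and "hardy_martingale n F"
  shows "\<exists>G B. hardy_martingale n G \<and> hardy_martingale n B \<and>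
    (\<forall>k\<in>{1..n}. \<forall>x\<in>space torus. F k x = G k x + B k x) \<and>
    (\<integral>\<^sup>+ x. ennreal_sqrt (\<Sum>k=1..n.
        nn_cond_exp torus (coord_filtration (k - 1))
          (\<lambda>x'. ennreal ((cmod (mart_diff G k x'))\<^sup>2)) x) \<partial>torus)
      + (\<integral>\<^sup>+ x. ennreal (\<Sum>k=1..n. cmod (mart_diff B k x)) \<partial>torus)
      \<le> ennreal (C\<^sub>1 * (LINT x|torus. cmod (F n x))) \<and>
    (AE x in torus. \<forall>k\<in>{1..n}. cmod (mart_diff G k x) \<le> A\<^sub>0 * cmod (F (k - 1) x))"
proof -
  interpret hardy_decomposition \<alpha>\<^sub>0 n F
    by unfold_locales (use assms in auto)
  obtain i where i: "(\<Sum>k=1..n. LINT x|torus. dilation_error k i x) \<le> mean_norm n"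
    using exists_small_dilation_error by blast
  define G where "G k x = (\<Sum>j=1..k. good_diff i j x)" for k x
  define B where "B k x = (\<Sum>j=1..k. mart_diff F j x - good_diff i j x)" for k x
  have G: "mart_diff G k = good_diff i k" and B: "mart_diff B k = (\<lambda>x. mart_diff F k x - good_diff i k x)"
    if "k \<in> {1..n}" for k
    using that by (cases k; auto simp: mart_diff_def G_def B_def fun_eq_iff)+
  have "hardy_martingale n G"
    unfolding G_def[abs_def]
    by (rule hardy_martingale_of_differences) (intro good_diff_integrable good_diff_depends good_diff_hardy; assumption)+
  moreover have "hardy_martingale n B"
    unfolding B_def[abs_def]
  proof (rule hardy_martingale_of_differences)
    fix k assume k: "k \<in> {1..n}"
    show "integrable torus (\<lambda>x. mart_diff F k x - good_diff i k x)" by (rule bad_diff_integrable[OF k])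
    show "depends_upto k (\<lambda>x. mart_diff F k x - good_diff i k x)"
      by (rule depends_upto_compose2[where g="\<lambda>a b. a - b", OF diff_depends good_diff_depends]) (use k in auto)
    show "AE x in torus. (\<lambda>y. slice k x y - good_diff i k (x(k := y))) \<in> hardy_H1_0"
      using slice_hardy[OF k] good_diff_hardy[OF k, of i] by eventually_elim (rule hardy_H1_0_diff)
  qed
  \<comment> \<open>Telescoping from \<open>F 0\<close>, which is 0; the identity holds at every
    point and index, not just almost surely.\<close>
  moreover have "F k x = G k x + B k x" for k x
  proof (induction k)
    case 0 then show ?case by (simp add: F_0 G_def B_def)
  next
    case (Suc k) then show ?case by (simp add: G_def B_def) (simp add: mart_diff_def)
  qed
  moreover have "(\<integral>\<^sup>+ x. ennreal_sqrt (\<Sum>k=1..n. nn_cond_exp torus (coord_filtration (k - 1))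
          (\<lambda>x'. ennreal ((cmod (mart_diff G k x'))\<^sup>2)) x) \<partial>torus)
      + (\<integral>\<^sup>+ x. ennreal (\<Sum>k=1..n. cmod (mart_diff B k x)) \<partial>torus) \<le> ennreal (C\<^sub>1 * (LINT x|torus. cmod (F n x)))"
  proof -
    have "(\<integral>\<^sup>+ x. ennreal (\<Sum>k=1..n. cmod (mart_diff B k x)) \<partial>torus)
       = (\<integral>\<^sup>+ x. ennreal (\<Sum>k=1..n. cmod (mart_diff F k x - good_diff i k x)) \<partial>torus)"
      by (simp add: B)
    also have "\<dots> = ennreal (LINT x|torus. (\<Sum>k=1..n. cmod (mart_diff F k x - good_diff i k x)))"
      using bad_diff_integrable by (intro nn_integral_eq_integral) (auto intro!: sum_nonneg)
    also have "\<dots> \<le> ennreal ((1 + 4 / \<alpha>\<^sub>0) * mean_norm n)"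
      by (intro ennreal_leI integral_sum_bad_diff_le i)
    finally have b: "(\<integral>\<^sup>+ x. ennreal (\<Sum>k=1..n. cmod (mart_diff B k x)) \<partial>torus) \<le> ennreal ((1
        + 4 / \<alpha>\<^sub>0) * mean_norm n)" .
    have g: "(\<integral>\<^sup>+ x. ennreal_sqrt (\<Sum>k=1..n. nn_cond_exp torus (coord_filtration (k - 1))
          (\<lambda>x'. ennreal ((cmod (mart_diff G k x'))\<^sup>2)) x) \<partial>torus) \<le> ennreal (5 / \<alpha>\<^sub>0 * mean_norm n)"
      using nn_integral_sqrt_good_diff_le[of i] by (simp add: G)
    \<comment> \<open>The total is 1 + 9 / \<alpha>. As 1 / \<alpha> is at least 1, it is at most 10
      / \<alpha>^2, while \<open>C\<^sub>1\<close> equals 16 sqrt 10 / \<alpha>^2.\<close>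
    have c: "5 / \<alpha>\<^sub>0 * mean_norm n + (1 + 4 / \<alpha>\<^sub>0) * mean_norm n \<le> C\<^sub>1 * mean_norm n"
    proof -
      have "1 \<le> inverse \<alpha>\<^sub>0" using le_1 pos by (simp add: one_le_inverse)
      then have "1 + 9 * inverse \<alpha>\<^sub>0 \<le> 10 * inverse \<alpha>\<^sub>0" by simp
      also have "\<dots> \<le> 10 * inverse \<alpha>\<^sub>0 * inverse \<alpha>\<^sub>0"
        using \<open>1 \<le> inverse \<alpha>\<^sub>0\<close> pos by simp
      also have "\<dots> \<le> 16 * sqrt 10 * (inverse \<alpha>\<^sub>0 * inverse \<alpha>\<^sub>0)"
      proof -
        have "1 \<le> sqrt (10::real)" by simp
        then have "10 \<le> 16 * sqrt (10::real)" by linarith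
        from mult_right_mono[OF this, of "inverse \<alpha>\<^sub>0 * inverse \<alpha>\<^sub>0"]
        have "10 * (inverse \<alpha>\<^sub>0 * inverse \<alpha>\<^sub>0) \<le> 16 * sqrt 10 * (inverse \<alpha>\<^sub>0 * inverse \<alpha>\<^sub>0)"
          using pos by simp
        then show ?thesis by (simp only: mult.assoc)
      qed
      also have "\<dots> = C\<^sub>1" using assms(3,4) by simp
      finally have "1 + 9 * inverse \<alpha>\<^sub>0 \<le> C\<^sub>1" .
      from mult_right_mono[OF this mean_norm_nonneg[of n]] show ?thesis
        by (simp add: divide_inverse algebra_simps)
    qed
    have "ennreal (5 / \<alpha>\<^sub>0 * mean_norm n) + ennreal ((1 + 4 / \<alpha>\<^sub>0) * mean_norm n)
        = ennreal (5 / \<alpha>\<^sub>0 * mean_norm n + (1 + 4 / \<alpha>\<^sub>0) * mean_norm n)"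
      using pos mean_norm_nonneg[of n] by (intro ennreal_plus[symmetric]) auto
    also have "\<dots> \<le> ennreal (C\<^sub>1 * mean_norm n)" by (rule ennreal_leI[OF c])
    finally show ?thesis
      using add_mono[OF g b] unfolding mean_norm_def by (rule order_trans[rotated])
  qed
  moreover have "AE x in torus. \<forall>k\<in>{1..n}. cmod (mart_diff G k x) \<le> A\<^sub>0 * cmod (F (k - 1) x)"
  proof (intro AE_finite_allI)
    fix k assume k: "k \<in> {1..n}"
    show "AE x in torus. cmod (mart_diff G k x) \<le> A\<^sub>0 * cmod (F (k - 1) x)"
      using AE_norm_good_diff[OF k, of i]
      by eventually_elim (simp add: G[OF k] assms(3) divide_inverse mult_ac)
  qed auto
  ultimately show ?thesis by blast
qed

end
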